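(* Let $d\ge1$ and let $\vec a=(a_1,\dots,a_d)\in[1,\infty)^d$ be any anisotropy. Then the associated tensor-product brushlet system $$\mathcal W:=\{w_{n,R_{j,k}}: n\in\mathbb N_0^d,\ j\in\mathbb Z,\ k\in E\}$$ (see context) is an orthonormal basis for $L_2(\mathbb R^d)$.
   Context: $\mathbb{N}_0=\{0,1,2,\dots\}$. Fourier transform on $\mathbb R^d$: $\hat f(\xi)=(2\pi)^{-d/2}\int f(x)e^{-ix\cdot\xi}dx$ (and likewise on $\mathbb R$). **Brushlet system.** Fix a non-negative $\rho\in C^\infty(\mathbb R)$ with $\rho(\xi)=0$ for $\xi\le-1$, $\rho(\xi)=1$ for $\xi\ge1$ and $\rho(\xi)^2+\rho(-\xi)^2=1$ for all $\xi$. For an interval $I=[\alpha_I,\alpha_I')$ with cutoff radii $\varepsilon_I>0$ at $\alpha_I$ and $\varepsilon_I'>0$ at $\alpha_I'$, let $b_I(\xi)=\rho\big(\tfrac{\xi-\alpha_I}{\varepsilon_I}\big)\rho\big(\tfrac{\alpha_I'-\xi}{\varepsilon_I'}\big)$ and define $w_{n,I}$, $n\in\mathbb N_0$, by $\hat w_{n,I}(\xi)=\sqrt{2/|I|}\;b_I(\xi)\cos\!\big(\pi(n+\tfrac12)\tfrac{\xi-\alpha_I}{|I|}\big)$. For $j\in\mathbb Z$, $1\le i\le d$, put $I^i_{j,1}=[0,2^{(j-1)a_i})$, $I^i_{j,2}=[2^{(j-1)a_i},2^{ja_i})$, $I^i_{j,-1}=[-2^{(j-1)a_i},0)$, $I^i_{j,-2}=[-2^{ja_i},-2^{(j-1)a_i})$;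 for these level-$j$ intervals the cutoff radius is $2^{(j-2)a_i}$ at the endpoints $\pm2^{ja_i}$ and $2^{(j-3)a_i}$ at the endpoints $0,\pm2^{(j-1)a_i}$. Let $E:=\{\pm1,\pm2\}^d\setminus\{\pm1\}^d$, $R_{j,k}:=I^1_{j,k_1}\times\cdots\times I^d_{j,k_d}$ for $k\in E$, and $w_{n,R_{j,k}}:=\bigotimes_{i=1}^dw_{n_i,I^i_{j,k_i}}$ for $n\in\mathbb N_0^d$. *)

theory Defs
  imports "HOL-Analysis.Analysis"
begin

definition smooth :: "(real \<Rightarrow> real) \<Rightarrow> bool" where
  "smooth f \<longleftrightarrow> (\<forall>m x. (deriv ^^ m) f field_differentiable at x)"

definition fourier :: "(real \<Rightarrow> complex) \<Rightarrow> real \<Rightarrow> complex" where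
  "fourier f \<xi> = complex_of_real ((2 * pi) powr (- 1 / 2)) *
     (LINT x|lebesgue. f x * exp (- (\<i> * complex_of_real (x * \<xi>))))"

text \<open>Elements of $L_2$ are represented by square-integrable functions; equality in $L_2$ is
  equality almost everywhere.\<close>

definition L2_fun :: "'a measure \<Rightarrow> ('a \<Rightarrow> complex) set" where
  "L2_fun M = {f \<in> borel_measurable M. integrable M (\<lambda>x. (cmod (f x))\<^sup>2)}"

definition L2_inner :: "'a measure \<Rightarrow> ('a \<Rightarrow> complex) \<Rightarrow> ('a \<Rightarrow> complex) \<Rightarrow> complex" where
  "L2_inner M f g = (LINT x|M. f x * cnj (g x))"

definition L2_norm :: "'a measure \<Rightarrow> ('a \<Rightarrow> complex) \<Rightarrow> real" where
  "L2_norm M f = sqrt (LINT x|M. (cmod (f x))\<^sup>2)"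

text \<open>An orthonormal family whose finite linear combinations are dense in $L_2$.\<close>

definition orthonormal_basis_L2 :: "'a measure \<Rightarrow> 'i set \<Rightarrow> ('i \<Rightarrow> 'a \<Rightarrow> complex) \<Rightarrow> bool" where
  "orthonormal_basis_L2 M P w \<longleftrightarrow>
     (\<forall>p\<in>P. w p \<in> L2_fun M) \<and>
     (\<forall>p\<in>P. \<forall>q\<in>P. L2_inner M (w p) (w q) = (if p = q then 1 else 0)) \<and>
     (\<forall>f\<in>L2_fun M. \<forall>e>0. \<exists>F c. finite F \<and> F \<subseteq> P \<and>
        L2_norm M (\<lambda>x. f x - (\<Sum>p\<in>F. c p * w p x)) < e)"

text \<open>A tuple \<open>(\<alpha>, \<alpha>', \<epsilon>, \<epsilon>')\<close> stands for the interval $[\alpha, \alpha')$ with cutoff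
  radius \<open>\<epsilon>\<close> at the left and \<open>\<epsilon>'\<close> at the right endpoint.\<close>

type_synonym cutoff_interval = "real \<times> real \<times> real \<times> real"

fun bell :: "(real \<Rightarrow> real) \<Rightarrow> cutoff_interval \<Rightarrow> real \<Rightarrow> real" where
  "bell \<rho> (\<alpha>, \<alpha>', \<epsilon>, \<epsilon>') \<xi> = \<rho> ((\<xi> - \<alpha>) / \<epsilon>) * \<rho> ((\<alpha>' - \<xi>) / \<epsilon>')"

fun brushlet_hat :: "(real \<Rightarrow> real) \<Rightarrow> nat \<Rightarrow> cutoff_interval \<Rightarrow> real \<Rightarrow> real" where
  "brushlet_hat \<rho> n (\<alpha>, \<alpha>', \<epsilon>, \<epsilon>') \<xi> =
     sqrt (2 / (\<alpha>' - \<alpha>)) * bell \<rho> (\<alpha>, \<alpha>', \<epsilon>, \<epsilon>') \<xi> *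
     cos (pi * (real n + 1 / 2) * ((\<xi> - \<alpha>) / (\<alpha>' - \<alpha>)))"

text \<open>A brushlet is given through its Fourier transform, which determines an integrable function
  only almost everywhere; continuity singles out one representative.\<close>

definition brushlet :: "(real \<Rightarrow> real) \<Rightarrow> nat \<Rightarrow> cutoff_interval \<Rightarrow> real \<Rightarrow> complex" where
  "brushlet \<rho> n I = (THE w. continuous_on UNIV w \<and> integrable lebesgue w \<and>
     (\<forall>\<xi>. fourier w \<xi> = complex_of_real (brushlet_hat \<rho> n I \<xi>)))"

text \<open>Only the labels \<open>k \<in> {1, 2, -1, -2}\<close> are meaningful.\<close>

definition level_interval :: "real \<Rightarrow> int \<Rightarrow> int \<Rightarrow> cutoff_interval" where
  "level_interval a j k =
     (let p = 2 powr (real_of_int (j - 1) * a); q = 2 powr (real_of_int j * a);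
          \<delta> = 2 powr (real_of_int (j - 3) * a); \<eta> = 2 powr (real_of_int (j - 2) * a)
      in if k = 1 then (0, p, \<delta>, \<delta>)
         else if k = 2 then (p, q, \<delta>, \<eta>)
         else if k = - 1 then (- p, 0, \<delta>, \<delta>)
         else if k = - 2 then (- q, - p, \<eta>, \<delta>)
         else undefined)"

definition corona_labels :: "(int ^ 'd::finite) set" where
  "corona_labels = {k. \<forall>i. k $ i \<in> {1, - 1, 2, - 2}} - {k. \<forall>i. k $ i \<in> {1, - 1}}"

definition tensor_brushlet ::
  "(real \<Rightarrow> real) \<Rightarrow> real ^ 'd::finite \<Rightarrow> nat ^ 'd \<Rightarrow> int \<Rightarrow> int ^ 'd \<Rightarrow> real ^ 'd \<Rightarrow> complex" where
  "tensor_brushlet \<rho> a n j k x =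
     (\<Prod>i\<in>UNIV. brushlet \<rho> (n $ i) (level_interval (a $ i) j (k $ i)) (x $ i))"

end

theory Submission
  imports Defs "HOL-Probability.Characteristic_Functions" "HOL-Probability.Sinc_Integral"
begin

text \<open>
  On the Fourier side a brushlet is a bell times a cosine, and the cosine is even about the left
  endpoint of its interval and odd about the right one. Folding a function \<open>h\<close> across both
  endpoints of $[\<alpha>,\<beta>)$ (\<open>fold_back_integral\<close>) turns its coefficients against all the bell-cosines of
  that interval into coefficients against the half-integer cosines on $[\<alpha>,\<beta>]$, which are orthonormal
  and, by the Stone--Weierstrass theorem, complete (\<open>interval_cos_parseval\<close>). Because
  $\<rho>(t)^2+\<rho>(-t)^2=1$, the folding rotates the pair of values of \<open>h\<close> at two mirror points. So the
  coefficients of one interval have total energy $\<integral>_\<alpha>^\<beta> h^2 + D_\<alpha> - D_\<beta>$, where the defect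
  $D$ depends only on the endpoint and its cutoff radius (\<open>local_cosine_parseval\<close>). When two intervals
  share an endpoint and a radius, the defects cancel and the energies add, and the opposite parities of
  the two cosines make the bell-cosines orthogonal. The radii of the level intervals are matched in this
  way: the four intervals of level \<open>j\<close> on one axis have the same total energy $E_{j+1}$ as the two
  inner intervals of level \<open>j + 1\<close> (\<open>inner_energy_Suc\<close>), while $E_j$ tends to $\<integral> h^2$ as
  $j\<rightarrow>\<infinity>$ and to $0$ as $j\<rightarrow>-\<infinity>$ (\<open>inner_energy_limits\<close>).

  In several variables the squared coefficients of a tensor product $f=\<Otimes>_i\<phi>_i$ over the corona of
  level \<open>j\<close> add up to $\<Prod>_i E_{j+1}(\<phi>_i)-\<Prod>_i E_j(\<phi>_i)$, since the corona labels are all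
  label tuples minus the inner ones. The sum over \<open>j\<close> telescopes to $\<Prod>_i\<parallel>\<phi>_i\<parallel>^2=\<parallel>f\<parallel>^2$, and
  with orthonormality this puts \<open>f\<close> into the closed span of the system (\<open>tensor_parseval\<close>). Two brushlets of
  different levels are orthogonal because the corona label of the higher level has an entry
  \<open>2\<close> or \<open>- 2\<close>, and on that axis its interval lies beyond all intervals of the lower level, or touches the
  outermost one with the same radius.

  The passage between a brushlet and its Fourier transform needs only functions $\<phi>$ and $g$ that are
  twice continuously differentiable with compact support. For these the inverse transform decays like
  $1/(1+x^2)$, and inversion (\<open>fourier_inversion\<close>), Plancherel's identity and uniqueness follow from
  Fubini's theorem and a Gaussian regularisation. Products of bump functions built from $\<rho>$ approximate the
  indicators of boxes, and a closed subspace that contains these is all of $L_2$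
  (\<open>L2_closed_subspace_boxes\<close>).
\<close>

section \<open>Twice differentiable functions of compact support\<close>

text \<open>The derivatives are quantified rather than computed by \<open>deriv\<close>: the integrations by parts below need just
  some first and second derivative, and closure under products and affine substitutions is then direct.\<close>

definition C2 :: "(real \<Rightarrow> real) \<Rightarrow> bool" where
  "C2 g \<longleftrightarrow> (\<exists>g' g''. (\<forall>x. (g has_real_derivative g' x) (at x)) \<and>
     (\<forall>x. (g' has_real_derivative g'' x) (at x)) \<and> continuous_on UNIV g'')"

definition C2c :: "(real \<Rightarrow> real) \<Rightarrow> bool" where
  "C2c g \<longleftrightarrow> C2 g \<and> (\<exists>R. \<forall>x. R \<le> \<bar>x\<bar> \<longrightarrow> g x = 0)"

lemma C2_continuous: "C2 g \<Longrightarrow> continuous_on S g"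
  unfolding C2_def by (meson DERIV_isCont continuous_at_imp_continuous_on)

lemma C2_mult:
  assumes "C2 f" "C2 g"
  shows "C2 (\<lambda>x. f x * g x)"
proof -
  from assms obtain f' f'' g' g'' where
    f: "\<And>x. (f has_real_derivative f' x) (at x)" "\<And>x. (f' has_real_derivative f'' x) (at x)"
       "continuous_on UNIV f''" and
    g: "\<And>x. (g has_real_derivative g' x) (at x)" "\<And>x. (g' has_real_derivative g'' x) (at x)"
       "continuous_on UNIV g''"
    unfolding C2_def by blast
  have cont: "continuous_on UNIV f" "continuous_on UNIV f'" "continuous_on UNIV g" "continuous_on UNIV g'"
    using f(1,2) g(1,2) by (meson DERIV_isCont continuous_at_imp_continuous_on)+
  show ?thesis
    unfolding C2_def
  proof (intro exI conjI allI)
    show "((\<lambda>x. f x * g x) has_real_derivative f' x * g x + f x * g' x) (at x)" for x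
      by (auto intro!: derivative_eq_intros f g)
    show "((\<lambda>x. f' x * g x + f x * g' x) has_real_derivative
        f'' x * g x + 2 * f' x * g' x + f x * g'' x) (at x)" for x
      by (auto intro!: derivative_eq_intros f g)
    show "continuous_on UNIV (\<lambda>x. f'' x * g x + 2 * f' x * g' x + f x * g'' x)"
      by (intro continuous_intros cont f g)
  qed
qed

lemma C2_affine:
  assumes "C2 f"
  shows "C2 (\<lambda>x. f (c * x + t))"
proof -
  from assms obtain f' f'' where
    f: "\<And>x. (f has_real_derivative f' x) (at x)" "\<And>x. (f' has_real_derivative f'' x) (at x)"
       "continuous_on UNIV f''"
    unfolding C2_def by blast
  have aff: "((\<lambda>x. c * x + t) has_real_derivative c) (at x)" for x
    by (auto intro!: derivative_eq_intros)
  show ?thesis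
    unfolding C2_def
  proof (intro exI conjI allI)
    show "((\<lambda>x. f (c * x + t)) has_real_derivative f' (c * x + t) * c) (at x)" for x
      using DERIV_chain2[OF f(1) aff] .
    show "((\<lambda>x. f' (c * x + t) * c) has_real_derivative f'' (c * x + t) * c * c) (at x)" for x
      using DERIV_cmult_right[OF DERIV_chain2[OF f(2) aff]] .
    show "continuous_on UNIV (\<lambda>x. f'' (c * x + t) * c * c)"
      by (intro continuous_intros continuous_on_compose2[OF f(3)]) auto
  qed
qed

lemma C2_const: "C2 (\<lambda>x. c)"
  unfolding C2_def by (intro exI[of _ "\<lambda>x. 0"]) auto

lemma C2_cos: "C2 cos"
  unfolding C2_def
proof (intro exI conjI allI)
  show "(cos has_real_derivative - sin x) (at x)" for x :: real
    by (auto intro!: derivative_eq_intros)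
  show "((\<lambda>x. - sin x) has_real_derivative - cos x) (at x)" for x :: real
    by (auto intro!: derivative_eq_intros)
  show "continuous_on UNIV (\<lambda>x::real. - cos x)"
    by (intro continuous_intros)
qed

lemma smooth_imp_C2:
  assumes "smooth f"
  shows "C2 f"
proof -
  have d: "(deriv ^^ m) f field_differentiable at x" for m x
    using assms unfolding smooth_def by blast
  have D: "((deriv ^^ m) f has_real_derivative (deriv ^^ Suc m) f x) (at x)" for m x
    using d[of m x] by (simp add: DERIV_deriv_iff_field_differentiable)
  show ?thesis
    unfolding C2_def
  proof (intro exI conjI allI)
    show "(f has_real_derivative deriv f x) (at x)" for x
      using D[of 0 x] by simp
    show "(deriv f has_real_derivative deriv (deriv f) x) (at x)" for x
      using D[of 1 x] by simp
    show "continuous_on UNIV (deriv (deriv f))"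
      using D[of 2] by (auto simp: numeral_2_eq_2 intro!: continuous_at_imp_continuous_on DERIV_isCont)
  qed
qed

lemma integrable_compact_support:
  fixes f :: "real \<Rightarrow> 'b::{banach, second_countable_topology}"
  assumes "continuous_on UNIV f" "\<And>x. R \<le> \<bar>x\<bar> \<Longrightarrow> f x = 0"
  shows "integrable lborel f"
proof -
  have "integrable lborel (\<lambda>x. indicator {-R..R} x *\<^sub>R f x)"
    by (rule borel_integrable_compact) (auto intro: continuous_on_subset assms)
  also have "(\<lambda>x. indicator {-R..R} x *\<^sub>R f x) = f"
    using assms(2) by (auto simp: fun_eq_iff indicator_def abs_le_iff)
  finally show ?thesis .
qed

lemma lborel_integral_compact_support:
  fixes f :: "real \<Rightarrow> 'b::euclidean_space"
  assumes "continuous_on UNIV f" "\<And>x. x \<notin> {a..b} \<Longrightarrow> f x = 0"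
  shows "(LINT x|lborel. f x) = integral {a..b} f"
proof -
  have "f x = 0" if "\<bar>a\<bar> + \<bar>b\<bar> + 1 \<le> \<bar>x\<bar>" for x
    using that by (intro assms(2)) auto
  then have "integrable lborel f"
    by (intro integrable_compact_support[of f "\<bar>a\<bar> + \<bar>b\<bar> + 1"] assms(1))
  then have "(LINT x|lborel. f x) = integral UNIV f"
    by (simp add: integral_lborel)
  also have "\<dots> = integral {a..b} f"
  proof -
    have "f = (\<lambda>x. if x \<in> {a..b} then f x else 0)"
      using assms(2) by auto
    then show ?thesis
      by (metis Henstock_Kurzweil_Integration.integral_restrict_UNIV)
  qed
  finally show ?thesis .
qed

lemma inverse_1_plus_square_integrable: "integrable lborel (\<lambda>x::real. 1 / (1 + x\<^sup>2))"
  using integrable_inverse_1_plus_square by (simp add: set_integrable_def field_simps)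

section \<open>Fourier inversion and Plancherel\<close>

definition osc :: "real \<Rightarrow> complex" where "osc t = exp (\<i> * complex_of_real t)"

lemma osc_simps [simp]: "cmod (osc t) = 1" "cnj (osc t) = osc (- t)" "osc 0 = 1"
  by (simp_all add: osc_def exp_cnj)

lemma osc_add: "osc (s + t) = osc s * osc t"
  by (simp add: osc_def ring_distribs exp_add)

lemma continuous_osc [continuous_intros]:
  "continuous_on S f \<Longrightarrow> continuous_on S (\<lambda>x. osc (f x))"
  unfolding osc_def by (intro continuous_intros)

lemma measurable_osc [measurable]: "osc \<in> borel_measurable borel"
  by (intro borel_measurable_continuous_onI continuous_intros)

lemma osc_vector_derivative:
  "((\<lambda>t. osc (x * t)) has_vector_derivative \<i> * x * osc (x * t)) (at t within S)"
proof -
  have "((\<lambda>z. exp (\<i> * (of_real x * z))) has_field_derivative exp (\<i> * (of_real x * of_real t)) * (\<i> * of_real x)) (at (of_real t))"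
    by (auto intro!: derivative_eq_intros)
  from has_vector_derivative_real_field[OF this]
  show ?thesis unfolding osc_def by (simp add: mult_ac)
qed

abbreviation fourier_const :: complex where "fourier_const \<equiv> complex_of_real ((2 * pi) powr (- 1 / 2))"

text \<open>The transformed functions are all real: bell-cosines on the frequency side and bump functions on the space side.\<close>

definition inv_fourier :: "(real \<Rightarrow> real) \<Rightarrow> real \<Rightarrow> complex" where
  "inv_fourier g x = fourier_const * (LINT \<xi>|lborel. complex_of_real (g \<xi>) * osc (x * \<xi>))"

text \<open>The support radius is enlarged so that the derivatives vanish on the same closed set as the function,
  in particular at the end points of the interval over which one integrates by parts.\<close>

lemma C2cE:
  assumes "C2c g"
  obtains g' g'' R where "\<And>x. (g has_real_derivative g' x) (at x)"
    "\<And>x. (g' has_real_derivative g'' x) (at x)" "continuous_on UNIV g" "continuous_on UNIV g'"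
    "continuous_on UNIV g''"
    "R > 0" "\<And>x. R \<le> \<bar>x\<bar> \<Longrightarrow> g x = 0" "\<And>x. R \<le> \<bar>x\<bar> \<Longrightarrow> g' x = 0" "\<And>x. R \<le> \<bar>x\<bar> \<Longrightarrow> g'' x = 0"
proof -
  from assms obtain f' f'' R where
    f: "\<And>x. (g has_real_derivative f' x) (at x)" "\<And>x. (f' has_real_derivative f'' x) (at x)"
       "continuous_on UNIV f''" and R: "\<And>x. R \<le> \<bar>x\<bar> \<Longrightarrow> g x = 0"
    unfolding C2_def C2c_def by blast
  have op: "open {x::real. R < \<bar>x\<bar>}"
    by (intro open_Collect_less continuous_intros)
  have z1: "f' x = 0" if "R < \<bar>x\<bar>" for x
  proof (rule DERIV_unique[OF f(1)])
    show "(g has_real_derivative 0) (at x)"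
      by (rule has_field_derivative_transform_within_open[where S="{x. R < \<bar>x\<bar>}" and f="\<lambda>x. 0"])
         (use that R op in auto)
  qed
  have z2: "f'' x = 0" if "R < \<bar>x\<bar>" for x
  proof (rule DERIV_unique[OF f(2)])
    show "(f' has_real_derivative 0) (at x)"
      by (rule has_field_derivative_transform_within_open[where S="{x. R < \<bar>x\<bar>}" and f="\<lambda>x. 0"])
         (use that z1 op in auto)
  qed
  \<comment> \<open>The derivatives are known to vanish only where \<open>R < \<bar>x\<bar>\<close>, so the radius is moved strictly beyond \<open>R\<close>.\<close>
  show thesis
  proof (rule that[of f' f'' "\<bar>R\<bar> + 1"])
    show "continuous_on UNIV g" "continuous_on UNIV f'"
      using f(1,2) by (meson DERIV_isCont continuous_at_imp_continuous_on)+
  qed (use f R z1 z2 in auto)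
qed

lemma C2c_continuous: "C2c g \<Longrightarrow> continuous_on S g"
  by (simp add: C2c_def C2_continuous)

lemma C2c_borel [measurable_dest]: "C2c g \<Longrightarrow> g \<in> borel_measurable borel"
  by (intro borel_measurable_continuous_onI C2c_continuous)

lemma C2c_integrable: "C2c g \<Longrightarrow> integrable lborel g"
  by (metis integrable_compact_support C2c_continuous C2c_def)

lemma C2c_osc_integrable:
  assumes "C2c g"
  shows "integrable lborel (\<lambda>\<xi>. complex_of_real (g \<xi>) * osc (x * \<xi>))"
proof (rule Bochner_Integration.integrable_bound[OF C2c_integrable[OF assms]])
  note [measurable] = C2c_borel[OF assms]
  show "(\<lambda>\<xi>. complex_of_real (g \<xi>) * osc (x * \<xi>)) \<in> borel_measurable lborel"
    by measurable
qed (auto simp: norm_mult)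

text \<open>Integrating by parts twice gives $x^2\<integral> g e^{ix\<xi>} = -\<integral> g'' e^{ix\<xi>}$, hence
  $(1+x^2)\<integral> g e^{ix\<xi>}=\<integral> (g-g'')e^{ix\<xi>}$, which is bounded in \<open>x\<close>. This decay makes the inverse
  transform integrable and square-integrable.\<close>

lemma inv_fourier_decay:
  assumes "C2c g"
  obtains B where "\<And>x. cmod (inv_fourier g x) \<le> B / (1 + x\<^sup>2)"
proof -
  obtain g' g'' R where g: "\<And>x. (g has_real_derivative g' x) (at x)"
    "\<And>x. (g' has_real_derivative g'' x) (at x)" "continuous_on UNIV g" "continuous_on UNIV g'"
    "continuous_on UNIV g''" and
    R: "R > 0" "\<And>x. R \<le> \<bar>x\<bar> \<Longrightarrow> g x = 0" "\<And>x. R \<le> \<bar>x\<bar> \<Longrightarrow> g' x = 0" "\<And>x. R \<le> \<bar>x\<bar> \<Longrightarrow> g'' x = 0"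
    using C2cE[OF assms] by blast
  define B where "B = (2 * pi) powr (- 1 / 2) * (LINT \<xi>|lborel. \<bar>g \<xi> - g'' \<xi>\<bar>)"
  have "cmod (inv_fourier g x) \<le> B / (1 + x\<^sup>2)" for x
  proof -
    define k where "k \<xi> = complex_of_real (g'' \<xi> + x\<^sup>2 * g \<xi>) * osc (x * \<xi>)" for \<xi>
    have kR: "k \<xi> = 0" if "\<xi> \<notin> {-R..R}" for \<xi>
      using that R(2,4)[of \<xi>] by (auto simp: k_def)
    have kc: "continuous_on UNIV k"
      unfolding k_def by (intro continuous_intros g)
    \<comment> \<open>Both partial integrations at once: $(g' - i x g) e^{ix\<xi>}$ is a primitive of
      $(g'' + x^2 g) e^{ix\<xi>}$, and it vanishes at $\<plusminus>R$.\<close>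
    have "(k has_integral (of_real (g' R) - \<i> * of_real x * of_real (g R)) * osc (x * R)
        - (of_real (g' (-R)) - \<i> * of_real x * of_real (g (-R))) * osc (x * (-R))) {-R..R}"
    proof (rule fundamental_theorem_of_calculus)
      show "((\<lambda>\<xi>. (of_real (g' \<xi>) - \<i> * of_real x * of_real (g \<xi>)) * osc (x * \<xi>)) has_vector_derivative k \<xi>) (at \<xi> within {-R..R})" for \<xi>
      proof -
        have g1: "((\<lambda>\<xi>. complex_of_real (g \<xi>)) has_vector_derivative of_real (g' \<xi>)) (at \<xi> within {-R..R})"
          using g(1) by (intro has_vector_derivative_of_real) (auto intro: has_vector_derivative_at_within simp: has_real_derivative_iff_has_vector_derivative)
        have g2: "((\<lambda>\<xi>. complex_of_real (g' \<xi>)) has_vector_derivative of_real (g'' \<xi>)) (at \<xi> within {-R..R})"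
          using g(2) by (intro has_vector_derivative_of_real) (auto intro: has_vector_derivative_at_within simp: has_real_derivative_iff_has_vector_derivative)
        have "((\<lambda>\<xi>. (of_real (g' \<xi>) - \<i> * of_real x * of_real (g \<xi>)) * osc (x * \<xi>)) has_vector_derivative
          (of_real (g' \<xi>) - \<i> * of_real x * of_real (g \<xi>)) * (\<i> * x * osc (x * \<xi>)) + (of_real (g'' \<xi>) - \<i> * of_real x * of_real (g' \<xi>)) * osc (x * \<xi>)) (at \<xi> within {-R..R})"
          by (intro has_vector_derivative_mult has_vector_derivative_diff has_vector_derivative_mult_right g1 g2 osc_vector_derivative)
        also have "(of_real (g' \<xi>) - \<i> * of_real x * of_real (g \<xi>)) * (\<i> * x * osc (x * \<xi>)) + (of_real (g'' \<xi>) - \<i> * of_real x * of_real (g' \<xi>)) * osc (x * \<xi>) = k \<xi>"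
          by (simp add: k_def algebra_simps power2_eq_square)
        finally show ?thesis .
      qed
    qed (use R in auto)
    then have "integral {-R..R} k = 0"
      using R by (simp add: integral_unique)
    then have k0: "(LINT \<xi>|lborel. k \<xi>) = 0"
      using lborel_integral_compact_support[OF kc kR] by simp
    have ki: "integrable lborel k"
    proof (rule integrable_compact_support[OF kc])
      fix x :: real assume "R + 1 \<le> \<bar>x\<bar>"
      then show "k x = 0" by (intro kR) auto
    qed
    have "(1 + x\<^sup>2) *\<^sub>R (LINT \<xi>|lborel. of_real (g \<xi>) * osc (x * \<xi>))
       = (LINT \<xi>|lborel. (1 + x\<^sup>2) *\<^sub>R (of_real (g \<xi>) * osc (x * \<xi>))) - (LINT \<xi>|lborel. k \<xi>)"
      by (simp add: k0)
    also have "\<dots> = (LINT \<xi>|lborel. of_real (g \<xi> - g'' \<xi>) * osc (x * \<xi>))"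
      by (subst Bochner_Integration.integral_diff[OF integrable_scaleR_right[OF C2c_osc_integrable[OF assms]] ki, symmetric])
         (auto intro!: Bochner_Integration.integral_cong simp: k_def algebra_simps scaleR_conv_of_real)
    finally have "(1 + x\<^sup>2) * cmod (LINT \<xi>|lborel. of_real (g \<xi>) * osc (x * \<xi>)) =
       cmod (LINT \<xi>|lborel. of_real (g \<xi> - g'' \<xi>) * osc (x * \<xi>))"
      by (metis abs_of_nonneg add_nonneg_nonneg norm_scaleR zero_le_one zero_le_power2)
    also have "\<dots> \<le> (LINT \<xi>|lborel. \<bar>g \<xi> - g'' \<xi>\<bar>)"
      by (rule order_trans[OF integral_norm_bound]) (simp add: norm_mult del: of_real_diff)
    finally have 1: "(1 + x\<^sup>2) * cmod (LINT \<xi>|lborel. of_real (g \<xi>) * osc (x * \<xi>)) \<le> (LINT \<xi>|lborel. \<bar>g \<xi> - g'' \<xi>\<bar>)" .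
    have "0 < 1 + x\<^sup>2"
      by (simp add: add_pos_nonneg)
    then show ?thesis
      using mult_left_mono[OF 1, of "(2 * pi) powr (- 1 / 2)"]
      by (simp add: inv_fourier_def B_def norm_mult field_simps)
  qed
  then show thesis by (rule that)
qed

lemma inv_fourier_continuous:
  assumes "C2c g"
  shows "continuous_on S (inv_fourier g)"
proof -
  note [measurable] = C2c_borel[OF assms]
  have "isCont (inv_fourier g) x" for x
  proof (unfold isCont_def tendsto_at_iff_sequentially comp_def, intro allI impI)
    fix s assume s: "s \<longlonglongrightarrow> x"
    show "(\<lambda>n. inv_fourier g (s n)) \<longlonglongrightarrow> inv_fourier g x"
      unfolding inv_fourier_def
    proof (intro tendsto_mult tendsto_const integral_dominated_convergence[where w="\<lambda>\<xi>. \<bar>g \<xi>\<bar>"])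
      show "integrable lborel (\<lambda>\<xi>. \<bar>g \<xi>\<bar>)"
        using C2c_integrable[OF assms] by simp
      have "isCont osc t" for t
        unfolding osc_def by (intro continuous_intros)
      then have "(\<lambda>n. osc (s n * \<xi>)) \<longlonglongrightarrow> osc (x * \<xi>)" for \<xi>
        by (rule isCont_tendsto_compose) (intro tendsto_intros s)
      then show "AE \<xi> in lborel. (\<lambda>n. complex_of_real (g \<xi>) * osc (s n * \<xi>)) \<longlonglongrightarrow> complex_of_real (g \<xi>) * osc (x * \<xi>)"
        by (intro AE_I2 tendsto_intros)
    qed (auto simp: norm_mult)
  qed
  then show ?thesis by (simp add: continuous_at_imp_continuous_on)
qed

lemma inv_fourier_borel: "C2c g \<Longrightarrow> inv_fourier g \<in> borel_measurable borel"
  by (intro borel_measurable_continuous_onI inv_fourier_continuous)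

lemma inv_fourier_integrable:
  assumes "C2c g"
  shows "integrable lborel (inv_fourier g)" "integrable lborel (\<lambda>x. (cmod (inv_fourier g x))\<^sup>2)"
proof -
  obtain B where B: "\<And>x. cmod (inv_fourier g x) \<le> B / (1 + x\<^sup>2)"
    using inv_fourier_decay[OF assms] by blast
  note [measurable] = inv_fourier_borel[OF assms]
  have B0: "0 \<le> B"
    using order_trans[OF norm_ge_zero B[of 0]] by simp
  have i: "integrable lborel (\<lambda>x. B * (1 / (1 + x\<^sup>2)))" for B :: real
    using inverse_1_plus_square_integrable by (rule integrable_mult_right)
  show "integrable lborel (inv_fourier g)"
    by (rule Bochner_Integration.integrable_bound[OF i[of B]])
       (use B B0 in \<open>auto simp: intro: order_trans[OF _ abs_ge_self]\<close>)
  have "(cmod (inv_fourier g x))\<^sup>2 \<le> B * B * (1 / (1 + x\<^sup>2))" for x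
  proof -
    have "B / (1 + x\<^sup>2) \<le> B"
      using B0 by (simp add: divide_le_eq mult_le_cancel_left1 add_pos_nonneg)
    then have "(cmod (inv_fourier g x))\<^sup>2 \<le> B * (B / (1 + x\<^sup>2))"
      unfolding power2_eq_square[of "cmod _"] using B[of x] B0 by (intro mult_mono) auto
    then show ?thesis by simp
  qed
  then show "integrable lborel (\<lambda>x. (cmod (inv_fourier g x))\<^sup>2)"
    by (intro Bochner_Integration.integrable_bound[OF i[of "B * B"]])
       (auto intro: order_trans[OF _ abs_ge_self])
qed

text \<open>Every exchange of integrals in this section has this form, with an exponential kernel of modulus one.\<close>

lemma fubini_kernel:
  fixes f g :: "real \<Rightarrow> complex" and k :: "real \<Rightarrow> real \<Rightarrow> complex"
  assumes f: "integrable lborel f" and g: "integrable lborel g"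
    and k [measurable]: "(\<lambda>(x, y). k x y) \<in> borel_measurable (borel \<Otimes>\<^sub>M borel)"
    and k1: "\<And>x y. cmod (k x y) \<le> 1"
  shows "(LINT x|lborel. f x * (LINT y|lborel. g y * k x y)) =
         (LINT y|lborel. g y * (LINT x|lborel. f x * k x y))"
proof -
  note [measurable] = borel_measurable_integrable[OF f] borel_measurable_integrable[OF g]
  have i: "integrable (lborel \<Otimes>\<^sub>M lborel) (\<lambda>(x, y). f x * g y * k x y)"
  proof (rule lborel_pair.Fubini_integrable)
    have b: "cmod (g y * k x y) \<le> cmod (g y)" for x y
      using k1[of x y] by (simp add: norm_mult mult_left_le)
    have gk: "integrable lborel (\<lambda>y. g y * k x y)" for x
      by (rule Bochner_Integration.integrable_bound[OF g]) (auto simp: b)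
    have "(LINT y|lborel. cmod (f x * g y * k x y)) \<le> cmod (f x) * (LINT y|lborel. cmod (g y))" for x
    proof -
      have "(LINT y|lborel. cmod (f x * g y * k x y)) = cmod (f x) * (LINT y|lborel. cmod (g y * k x y))"
        by (simp add: norm_mult mult.assoc)
      also have "\<dots> \<le> cmod (f x) * (LINT y|lborel. cmod (g y))"
        by (intro mult_left_mono integral_mono integrable_norm gk g b) auto
      finally show ?thesis .
    qed
    then have "(LINT y|lborel. cmod (f x * g y * k x y)) \<le> \<bar>cmod (f x) * (LINT y|lborel. cmod (g y))\<bar>" for x
      using abs_ge_self order_trans by blast
    then show "integrable lborel (\<lambda>x. LINT y|lborel. cmod (case (x, y) of (x, y) \<Rightarrow> f x * g y * k x y))"
      by (intro Bochner_Integration.integrable_bound[OF integrable_mult_left[OF integrable_norm[OF f], of "LINT y|lborel. cmod (g y)"]])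
         (auto simp: abs_of_nonneg integral_nonneg_AE)
    show "AE x in lborel. integrable lborel (\<lambda>y. case (x, y) of (x, y) \<Rightarrow> f x * g y * k x y)"
      using gk by (auto simp: mult.assoc)
  qed measurable
  have "(LINT x|lborel. f x * (LINT y|lborel. g y * k x y)) = (LINT x|lborel. LINT y|lborel. f x * g y * k x y)"
    by (simp add: mult.assoc)
  also have "\<dots> = (LINT y|lborel. LINT x|lborel. f x * g y * k x y)"
    using lborel_pair.Fubini_integral[OF i] by simp
  also have "\<dots> = (LINT y|lborel. g y * (LINT x|lborel. f x * k x y))"
    by (subst Bochner_Integration.integral_mult_right_zero[symmetric]) (simp add: mult_ac)
  finally show ?thesis .
qed

text \<open>The characteristic function of the standard normal distribution, rescaled.\<close>

lemma gaussian_fourier: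
  fixes \<epsilon> t :: real
  assumes "\<epsilon> > 0"
  shows "(LINT x|lborel. complex_of_real (exp (- (\<epsilon> * x)\<^sup>2 / 2)) * osc (x * t)) =
    complex_of_real (sqrt (2 * pi) / \<epsilon> * exp (- (t / \<epsilon>)\<^sup>2 / 2))"
proof -
  have "complex_of_real (exp (- (t / \<epsilon>)\<^sup>2 / 2)) = char std_normal_distribution (t / \<epsilon>)"
    by (simp add: char_std_normal_distribution)
  also have "\<dots> = (LINT x|lborel. complex_of_real (std_normal_density x) * osc (t / \<epsilon> * x))"
    by (subst integral_density[where g = std_normal_density, symmetric, unfolded scaleR_conv_of_real] |
        simp add: char_def osc_def integral_density scaleR_conv_of_real mult_ac)+
  also have "\<dots> = \<epsilon> *\<^sub>R (LINT x|lborel. complex_of_real (std_normal_density (\<epsilon> * x)) * osc (t / \<epsilon> * (\<epsilon> * x)))"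
    using assms lborel_integral_real_affine[of \<epsilon> "\<lambda>x. complex_of_real (std_normal_density x) * osc (t / \<epsilon> * x)" 0] by simp
  also have "\<dots> = \<epsilon> *\<^sub>R (LINT x|lborel. of_real (1 / sqrt (2 * pi)) * (complex_of_real (exp (- (\<epsilon> * x)\<^sup>2 / 2)) * osc (x * t)))"
    using assms by (simp add: std_normal_density_def mult_ac)
  also have "\<dots> = of_real (\<epsilon> / sqrt (2 * pi)) * (LINT x|lborel. (complex_of_real (exp (- (\<epsilon> * x)\<^sup>2 / 2)) * osc (x * t)))"
    by (simp add: scaleR_conv_of_real)
  finally show ?thesis
    using assms by (simp add: field_simps)
qed

lemma gaussian_integrable: "integrable lborel (\<lambda>x::real. exp (- x\<^sup>2 / 2))"
proof -
  have "integrable lborel (\<lambda>x. sqrt (2 * pi) * std_normal_density x)"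
    by (intro integrable_mult_right) simp
  then show ?thesis by (simp add: std_normal_density_def)
qed

lemma gaussian_integral: "(LINT x|lborel. exp (- x\<^sup>2 / 2)) = sqrt (2 * pi)"
proof -
  have "(LINT x|lborel. sqrt (2 * pi) * std_normal_density x) = sqrt (2 * pi)"
    by simp
  then show ?thesis by (simp add: std_normal_density_def)
qed

lemma fourier_const_sqrt: "fourier_const * complex_of_real (sqrt (2 * pi)) = 1"
proof -
  have "(2 * pi) powr (- 1 / 2) * sqrt (2 * pi) = 1"
    by (simp add: powr_half_sqrt[symmetric] powr_add[symmetric])
  then show ?thesis by (metis of_real_mult of_real_1)
qed

text \<open>A factor $e^{-\<epsilon>^2x^2/2}$ makes the double integral absolutely convergent. Fubini's theorem
  and the Gaussian transform turn the regularised integral into an average of \<open>g\<close> against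
  a normal density of width $\<epsilon>$ centred at $\<xi>$, which tends to $g(\<xi>)$ as $\<epsilon>\<rightarrow>0$.\<close>

lemma fourier_inversion:
  assumes g: "C2c g"
  shows "fourier_const * (LINT x|lborel. inv_fourier g x * osc (- (x * \<xi>))) = complex_of_real (g \<xi>)"
proof -
  note [measurable] = C2c_borel[OF g] inv_fourier_borel[OF g]
  define \<epsilon> where "\<epsilon> n = 1 / real (Suc n)" for n
  have \<epsilon>: "\<epsilon> n > 0" for n by (simp add: \<epsilon>_def)
  have \<epsilon>0: "\<epsilon> \<longlonglongrightarrow> 0" unfolding \<epsilon>_def by (rule LIMSEQ_Suc[OF lim_1_over_n])
  define A where "A n = (LINT x|lborel. inv_fourier g x * osc (- (x * \<xi>)) * of_real (exp (- (\<epsilon> n * x)\<^sup>2 / 2)))" for n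
  have A1: "A \<longlonglongrightarrow> (LINT x|lborel. inv_fourier g x * osc (- (x * \<xi>)))"
    unfolding A_def
  proof (rule integral_dominated_convergence[where w="\<lambda>x. cmod (inv_fourier g x)"])
    show "integrable lborel (\<lambda>x. cmod (inv_fourier g x))"
      by (intro integrable_norm inv_fourier_integrable g)
    show "AE x in lborel. (\<lambda>n. inv_fourier g x * osc (- (x * \<xi>)) * of_real (exp (- (\<epsilon> n * x)\<^sup>2 / 2))) \<longlonglongrightarrow> inv_fourier g x * osc (- (x * \<xi>))"
    proof (rule AE_I2)
      fix x
      have "(\<lambda>n. inv_fourier g x * osc (- (x * \<xi>)) * of_real (exp (- (\<epsilon> n * x)\<^sup>2 / 2))) \<longlonglongrightarrow> inv_fourier g x * osc (- (x * \<xi>)) * of_real (exp (- (0 * x)\<^sup>2 / 2))"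
        by (intro tendsto_intros \<epsilon>0) auto
      then show "(\<lambda>n. inv_fourier g x * osc (- (x * \<xi>)) * of_real (exp (- (\<epsilon> n * x)\<^sup>2 / 2))) \<longlonglongrightarrow> inv_fourier g x * osc (- (x * \<xi>))"
        by simp
    qed
  qed (auto simp: norm_mult mult_left_le)
  have "A n = complex_of_real (fc' * (LINT z|lborel. g (\<xi> + \<epsilon> n * z) * exp (- z\<^sup>2 / 2))) * of_real (sqrt (2 * pi))"
     if "fc' = (2 * pi) powr (- 1 / 2)" for n fc'
  proof -
    have gi: "integrable lborel (\<lambda>x. complex_of_real (exp (- (\<epsilon> n * x)\<^sup>2 / 2)))"
      using lborel_integrable_real_affine[OF gaussian_integrable, of "\<epsilon> n" 0] \<epsilon>[of n] by simp
    have "A n = (LINT x|lborel. fourier_const * (of_real (exp (- (\<epsilon> n * x)\<^sup>2 / 2)) * (LINT \<eta>|lborel. complex_of_real (g \<eta>) * osc (x * (\<eta> - \<xi>)))))"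
      unfolding A_def inv_fourier_def
    proof (intro Bochner_Integration.integral_cong refl)
      fix x
      have "(LINT \<eta>|lborel. complex_of_real (g \<eta>) * osc (x * (\<eta> - \<xi>))) = (LINT \<eta>|lborel. complex_of_real (g \<eta>) * osc (x * \<eta>) * osc (- (x * \<xi>)))"
        by (intro Bochner_Integration.integral_cong refl)
           (simp add: mult.assoc osc_add[symmetric] algebra_simps)
      then show "fourier_const * (LINT \<xi>|lborel. complex_of_real (g \<xi>) * osc (x * \<xi>)) * osc (- (x * \<xi>)) * complex_of_real (exp (- (\<epsilon> n * x)\<^sup>2 / 2)) =
        fourier_const * (of_real (exp (- (\<epsilon> n * x)\<^sup>2 / 2)) * (LINT \<eta>|lborel. complex_of_real (g \<eta>) * osc (x * (\<eta> - \<xi>))))"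
        by simp
    qed
    also have "\<dots> = fourier_const * (LINT x|lborel. of_real (exp (- (\<epsilon> n * x)\<^sup>2 / 2)) * (LINT \<eta>|lborel. complex_of_real (g \<eta>) * osc (x * (\<eta> - \<xi>))))"
      by simp
    also have "(LINT x|lborel. of_real (exp (- (\<epsilon> n * x)\<^sup>2 / 2)) * (LINT \<eta>|lborel. complex_of_real (g \<eta>) * osc (x * (\<eta> - \<xi>))))
      = (LINT \<eta>|lborel. complex_of_real (g \<eta>) * (LINT x|lborel. of_real (exp (- (\<epsilon> n * x)\<^sup>2 / 2)) * osc (x * (\<eta> - \<xi>))))"
      using C2c_integrable[OF g] by (intro fubini_kernel gi) auto
    also have "\<dots> = (LINT \<eta>|lborel. complex_of_real (g \<eta>) * complex_of_real (sqrt (2 * pi) / \<epsilon> n * exp (- ((\<eta> - \<xi>) / \<epsilon> n)\<^sup>2 / 2)))"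
      by (subst gaussian_fourier[OF \<epsilon>]) simp
    also have "\<dots> = complex_of_real (LINT \<eta>|lborel. sqrt (2 * pi) / \<epsilon> n * (g \<eta> * exp (- ((\<eta> - \<xi>) / \<epsilon> n)\<^sup>2 / 2)))"
      by (subst integral_complex_of_real[symmetric]) (simp add: mult_ac)
    also have "(LINT \<eta>|lborel. sqrt (2 * pi) / \<epsilon> n * (g \<eta> * exp (- ((\<eta> - \<xi>) / \<epsilon> n)\<^sup>2 / 2)))
      = sqrt (2 * pi) / \<epsilon> n * (LINT \<eta>|lborel. g \<eta> * exp (- ((\<eta> - \<xi>) / \<epsilon> n)\<^sup>2 / 2))"
      by (rule integral_mult_right_zero)
    also have "(LINT \<eta>|lborel. g \<eta> * exp (- ((\<eta> - \<xi>) / \<epsilon> n)\<^sup>2 / 2)) = \<epsilon> n * (LINT z|lborel. g (\<xi> + \<epsilon> n * z) * exp (- z\<^sup>2 / 2))"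
      using \<epsilon>[of n] lborel_integral_real_affine[of "\<epsilon> n" "\<lambda>\<eta>. g \<eta> * exp (- ((\<eta> - \<xi>) / \<epsilon> n)\<^sup>2 / 2)" \<xi>] by simp
    finally show ?thesis
      using \<epsilon>[of n] that by (simp add: mult_ac)
  qed
  note A2 = this[OF refl]
  have A3: "(\<lambda>n. LINT z|lborel. g (\<xi> + \<epsilon> n * z) * exp (- z\<^sup>2 / 2)) \<longlonglongrightarrow> (LINT z|lborel. g \<xi> * exp (- z\<^sup>2 / 2))"
  proof -
    obtain B where B: "\<And>x. \<bar>g x\<bar> \<le> B"
    proof -
      obtain R where R: "\<And>x. R \<le> \<bar>x\<bar> \<Longrightarrow> g x = 0"
        using g by (auto simp: C2c_def)
      have "bounded (g ` {-R..R})"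
        by (intro compact_imp_bounded compact_continuous_image C2c_continuous g) auto
      then obtain B where "\<And>x. x \<in> {-R..R} \<Longrightarrow> \<bar>g x\<bar> \<le> B"
        unfolding bounded_iff real_norm_def by blast
      then have "\<bar>g x\<bar> \<le> \<bar>B\<bar>" for x
        using R[of x] by (cases "x \<in> {-R..R}") fastforce+
      then show thesis using that by blast
    qed
    show ?thesis
    proof (rule integral_dominated_convergence[where w="\<lambda>z. B * exp (- z\<^sup>2 / 2)"])
      show "integrable lborel (\<lambda>z. B * exp (- z\<^sup>2 / 2))"
        by (intro integrable_mult_right gaussian_integrable)
      have "isCont g \<xi>"
        using C2c_continuous[OF g, of UNIV] by (simp add: continuous_on_eq_continuous_at)
      then have "(\<lambda>n. g (\<xi> + \<epsilon> n * z)) \<longlonglongrightarrow> g \<xi>" for z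
        by (rule isCont_tendsto_compose) (auto intro!: tendsto_eq_intros \<epsilon>0)
      then show "AE z in lborel. (\<lambda>n. g (\<xi> + \<epsilon> n * z) * exp (- z\<^sup>2 / 2)) \<longlonglongrightarrow> g \<xi> * exp (- z\<^sup>2 / 2)"
        by (intro AE_I2 tendsto_intros)
    qed (use B in \<open>auto simp: abs_mult\<close>)
  qed
  have "(LINT z|lborel. g \<xi> * exp (- z\<^sup>2 / 2)) = g \<xi> * sqrt (2 * pi)"
    by (subst integral_mult_right_zero) (simp only: gaussian_integral)
  then have "A \<longlonglongrightarrow> complex_of_real ((2 * pi) powr (- 1 / 2) * (g \<xi> * sqrt (2 * pi))) * of_real (sqrt (2 * pi))"
    using tendsto_mult[OF tendsto_of_real[OF tendsto_mult[OF tendsto_const[of "(2 * pi) powr (- 1 / 2)"] A3]] tendsto_const[of "complex_of_real (sqrt (2 * pi))"]]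
    by (simp only: A2[abs_def])
  then have "(LINT x|lborel. inv_fourier g x * osc (- (x * \<xi>))) = complex_of_real ((2 * pi) powr (- 1 / 2) * (g \<xi> * sqrt (2 * pi))) * of_real (sqrt (2 * pi))"
    using A1 LIMSEQ_unique by blast
  then have "(LINT x|lborel. inv_fourier g x * osc (- (x * \<xi>))) = fourier_const * of_real (g \<xi>) * of_real (sqrt (2 * pi)) * of_real (sqrt (2 * pi))"
    by simp
  then have "fourier_const * (LINT x|lborel. inv_fourier g x * osc (- (x * \<xi>))) = of_real (g \<xi>) * (fourier_const * of_real (sqrt (2 * pi))) * (fourier_const * of_real (sqrt (2 * pi)))"
    by (simp only: mult_ac)
  then show ?thesis
    unfolding fourier_const_sqrt by simp
qed

lemma fourier_lborel:
  assumes "w \<in> borel_measurable borel"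
  shows "fourier w \<xi> = fourier_const * (LINT x|lborel. w x * osc (- (x * \<xi>)))"
proof -
  note [measurable] = assms
  have "(LINT x|lebesgue. w x * osc (- (x * \<xi>))) = (LINT x|lborel. w x * osc (- (x * \<xi>)))"
    by (rule integral_completion) measurable
  then show ?thesis by (simp add: fourier_def osc_def)
qed

lemma fourier_inv_fourier: "C2c g \<Longrightarrow> fourier (inv_fourier g) \<xi> = complex_of_real (g \<xi>)"
  unfolding fourier_lborel[OF inv_fourier_borel] by (rule fourier_inversion)

text \<open>Fubini's theorem moves the transform of \<open>h\<close> onto \<open>inv_fourier g\<close>, and inversion returns \<open>g\<close>.\<close>

lemma inv_fourier_plancherel:
  assumes g: "C2c g" and h: "C2c h"
  shows "(LINT x|lborel. inv_fourier g x * cnj (inv_fourier h x)) = complex_of_real (LINT \<xi>|lborel. g \<xi> * h \<xi>)"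
proof -
  have cnj_if: "cnj (inv_fourier h x) = fourier_const * (LINT \<xi>|lborel. complex_of_real (h \<xi>) * osc (- (x * \<xi>)))" for x
    unfolding inv_fourier_def by (simp add: Bochner_Integration.integral_cnj[symmetric] del: Bochner_Integration.integral_cnj)
  have "(LINT x|lborel. inv_fourier g x * cnj (inv_fourier h x)) =
     (LINT x|lborel. fourier_const * (inv_fourier g x * (LINT \<xi>|lborel. complex_of_real (h \<xi>) * osc (- (x * \<xi>)))))"
    unfolding cnj_if by (simp add: mult_ac)
  also have "\<dots> = fourier_const * (LINT x|lborel. (inv_fourier g x * (LINT \<xi>|lborel. complex_of_real (h \<xi>) * osc (- (x * \<xi>)))))"
    by (rule integral_mult_right_zero)
  also have "(LINT x|lborel. (inv_fourier g x * (LINT \<xi>|lborel. complex_of_real (h \<xi>) * osc (- (x * \<xi>))))) =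
     (LINT \<xi>|lborel. complex_of_real (h \<xi>) * (LINT x|lborel. inv_fourier g x * osc (- (x * \<xi>))))"
    using C2c_integrable[OF h] by (intro fubini_kernel inv_fourier_integrable g) auto
  also have "fourier_const * \<dots> = (LINT \<xi>|lborel. complex_of_real (h \<xi>) * (fourier_const * (LINT x|lborel. inv_fourier g x * osc (- (x * \<xi>)))))"
    by (subst integral_mult_right_zero[symmetric]) (simp only: mult_ac)
  also have "\<dots> = (LINT \<xi>|lborel. complex_of_real (g \<xi> * h \<xi>))"
    unfolding fourier_inversion[OF g] by (simp add: mult_ac)
  finally show ?thesis by (simp only: integral_complex_of_real)
qed

text \<open>This carries the inner product of a test function and a brushlet to the frequency side, where the local cosine
  expansions live; Fubini's theorem applies because both functions have compact support.\<close>

lemma inner_inv_fourier: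
  assumes \<phi>: "C2c \<phi>" and g: "C2c g"
  shows "(LINT x|lborel. complex_of_real (\<phi> x) * cnj (inv_fourier g x)) =
     (LINT \<xi>|lborel. inv_fourier \<phi> (- \<xi>) * of_real (g \<xi>))"
proof -
  have cnj_if: "cnj (inv_fourier g x) = fourier_const * (LINT \<xi>|lborel. complex_of_real (g \<xi>) * osc (- (x * \<xi>)))" for x
    unfolding inv_fourier_def by (simp add: Bochner_Integration.integral_cnj[symmetric] del: Bochner_Integration.integral_cnj)
  have "(LINT x|lborel. complex_of_real (\<phi> x) * cnj (inv_fourier g x)) =
     (LINT x|lborel. fourier_const * (complex_of_real (\<phi> x) * (LINT \<xi>|lborel. complex_of_real (g \<xi>) * osc (- (x * \<xi>)))))"
    unfolding cnj_if by (simp add: mult_ac)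
  also have "\<dots> = fourier_const * (LINT x|lborel. (complex_of_real (\<phi> x) * (LINT \<xi>|lborel. complex_of_real (g \<xi>) * osc (- (x * \<xi>)))))"
    by (rule integral_mult_right_zero)
  also have "(LINT x|lborel. (complex_of_real (\<phi> x) * (LINT \<xi>|lborel. complex_of_real (g \<xi>) * osc (- (x * \<xi>))))) =
     (LINT \<xi>|lborel. complex_of_real (g \<xi>) * (LINT x|lborel. complex_of_real (\<phi> x) * osc (- (x * \<xi>))))"
    using C2c_integrable[OF g] C2c_integrable[OF \<phi>] by (intro fubini_kernel) auto
  also have "fourier_const * \<dots> = (LINT \<xi>|lborel. fourier_const * (LINT x|lborel. complex_of_real (\<phi> x) * osc (- (x * \<xi>))) * complex_of_real (g \<xi>))"
    by (subst integral_mult_right_zero[symmetric]) (simp only: mult_ac)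
  finally show ?thesis by (simp add: inv_fourier_def mult_ac)
qed

text \<open>Every test function is itself the Fourier transform of an integrable function, by inversion, so
  its pairing with \<open>w\<close> is a pairing with the Fourier transform of \<open>w\<close>.\<close>

lemma fourier_eq_0_imp_weak_0:
  assumes w: "integrable lborel w" and 0: "\<And>\<xi>. fourier w \<xi> = 0" and \<phi>: "C2c \<phi>"
  shows "(LINT x|lborel. w x * of_real (\<phi> x)) = 0"
proof -
  note [measurable] = borel_measurable_integrable[OF w]
  have F: "fourier_const * (LINT x|lborel. w x * osc (- (x * \<xi>))) = 0" for \<xi>
    using 0[of \<xi>] by (simp add: fourier_lborel)
  have "(LINT x|lborel. w x * of_real (\<phi> x)) = (LINT x|lborel. fourier_const * (w x * (LINT y|lborel. inv_fourier \<phi> y * osc (- (x * y)))))"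
    by (subst fourier_inversion[OF \<phi>, symmetric]) (simp add: mult_ac)
  also have "\<dots> = fourier_const * (LINT x|lborel. w x * (LINT y|lborel. inv_fourier \<phi> y * osc (- (x * y))))"
    by (rule integral_mult_right_zero)
  also have "\<dots> = fourier_const * (LINT y|lborel. inv_fourier \<phi> y * (LINT x|lborel. w x * osc (- (x * y))))"
    by (subst fubini_kernel) (auto intro: w inv_fourier_integrable \<phi>)
  also have "\<dots> = 0"
    using F by simp
  finally show ?thesis .
qed

section \<open>Half-integer cosines on an interval\<close>

definition interval_cos :: "real \<Rightarrow> real \<Rightarrow> nat \<Rightarrow> real \<Rightarrow> real" where
  "interval_cos \<alpha> \<beta> n \<xi> = sqrt (2 / (\<beta> - \<alpha>)) * cos (pi * (real n + 1 / 2) * ((\<xi> - \<alpha>) / (\<beta> - \<alpha>)))"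

lemma continuous_interval_cos [continuous_intros]:
  fixes f :: "real \<Rightarrow> real"
  shows "continuous_on S f \<Longrightarrow> continuous_on S (\<lambda>x. interval_cos \<alpha> \<beta> n (f x))"
proof -
  assume f: "continuous_on S f"
  have "continuous_on S (\<lambda>x. A * cos (B * ((f x - \<alpha>) * C)))" for A B C
    by (intro continuous_intros f)
  note c = this[of "sqrt (2 / (\<beta> - \<alpha>))" "pi * (real n + 1 / 2)" "inverse (\<beta> - \<alpha>)"]
  show ?thesis
    unfolding interval_cos_def divide_inverse[of "_ - _"] by (rule c)
qed

lemma integral_cos_int:
  fixes k :: int
  assumes "\<alpha> < \<beta>"
  shows "((\<lambda>\<xi>. cos (pi * of_int k * ((\<xi> - \<alpha>) / (\<beta> - \<alpha>)))) has_integral (if k = 0 then \<beta> - \<alpha> else 0)) {\<alpha>..\<beta>}"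
proof (cases "k = 0")
  case True
  then show ?thesis using has_integral_const_real[of "1::real" \<alpha> \<beta>] assms by simp
next
  case False
  define A where "A = pi * of_int k / (\<beta> - \<alpha>)"
  have A: "A \<noteq> 0" using False assms by (simp add: A_def)
  have "((\<lambda>\<xi>. cos (A * (\<xi> - \<alpha>))) has_integral sin (A * (\<beta> - \<alpha>)) / A - sin (A * (\<alpha> - \<alpha>)) / A) {\<alpha>..\<beta>}"
  proof (rule fundamental_theorem_of_calculus)
    show "((\<lambda>\<xi>. sin (A * (\<xi> - \<alpha>)) / A) has_vector_derivative cos (A * (\<xi> - \<alpha>))) (at \<xi> within {\<alpha>..\<beta>})" for \<xi>
      unfolding has_real_derivative_iff_has_vector_derivative[symmetric]
      using A by (auto intro!: derivative_eq_intros)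
  qed (use assms in auto)
  moreover have "A * (\<beta> - \<alpha>) = pi * of_int k"
    using assms by (simp add: A_def)
  moreover have "A * (\<xi> - \<alpha>) = pi * of_int k * ((\<xi> - \<alpha>) / (\<beta> - \<alpha>))" for \<xi>
    by (simp add: A_def)
  ultimately show ?thesis using False by simp
qed

text \<open>The product of two half-integer cosines is a combination of two integer cosines, with
  frequencies $n-m$ and $n+m+1$; the second is never zero.\<close>

lemma interval_cos_orthonormal:
  assumes "\<alpha> < \<beta>"
  shows "integral {\<alpha>..\<beta>} (\<lambda>\<xi>. interval_cos \<alpha> \<beta> n \<xi> * interval_cos \<alpha> \<beta> m \<xi>) = (if n = m then 1 else 0)"
proof (rule integral_unique)
  have "((\<lambda>\<xi>. 1 / (\<beta> - \<alpha>) * (cos (pi * of_int (int n - int m) * ((\<xi> - \<alpha>) / (\<beta> - \<alpha>))) +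
     cos (pi * of_int (int n + int m + 1) * ((\<xi> - \<alpha>) / (\<beta> - \<alpha>))))) has_integral
     1 / (\<beta> - \<alpha>) * ((if int n - int m = 0 then \<beta> - \<alpha> else 0) + (if int n + int m + 1 = 0 then \<beta> - \<alpha> else 0))) {\<alpha>..\<beta>}"
    by (intro has_integral_mult_right has_integral_add integral_cos_int assms)
  moreover have "1 / (\<beta> - \<alpha>) * (cos (pi * of_int (int n - int m) * ((\<xi> - \<alpha>) / (\<beta> - \<alpha>))) +
     cos (pi * of_int (int n + int m + 1) * ((\<xi> - \<alpha>) / (\<beta> - \<alpha>)))) = interval_cos \<alpha> \<beta> n \<xi> * interval_cos \<alpha> \<beta> m \<xi>" for \<xi>
  proof -
    define y where "y = (\<xi> - \<alpha>) / (\<beta> - \<alpha>)"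
    have "interval_cos \<alpha> \<beta> n \<xi> * interval_cos \<alpha> \<beta> m \<xi> = (sqrt (2 / (\<beta> - \<alpha>)))\<^sup>2 *
      (cos (pi * (real n + 1 / 2) * y) * cos (pi * (real m + 1 / 2) * y))"
      unfolding interval_cos_def y_def power2_eq_square by (simp only: mult_ac)
    also have "\<dots> = 2 / (\<beta> - \<alpha>) * (cos (pi * (real n + 1 / 2) * y) * cos (pi * (real m + 1 / 2) * y))"
      using assms by simp
    also have "cos (pi * (real n + 1 / 2) * y) * cos (pi * (real m + 1 / 2) * y) =
      (cos (pi * of_int (int n - int m) * y) + cos (pi * of_int (int n + int m + 1) * y)) / 2"
    proof -
      have "pi * (real n + 1 / 2) * y - pi * (real m + 1 / 2) * y = pi * of_int (int n - int m) * y"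
        "pi * (real n + 1 / 2) * y + pi * (real m + 1 / 2) * y = pi * of_int (int n + int m + 1) * y"
        by (simp_all add: algebra_simps)
      then show ?thesis by (simp only: cos_times_cos)
    qed
    also have "2 / d * (z / 2) = 1 / d * z" for d z :: real
      by simp
    finally show ?thesis by (simp only: y_def)
  qed
  ultimately show "((\<lambda>\<xi>. interval_cos \<alpha> \<beta> n \<xi> * interval_cos \<alpha> \<beta> m \<xi>) has_integral (if n = m then 1 else 0)) {\<alpha>..\<beta>}"
    using assms by (cases "n = m") simp_all
qed

inductive_set cos_span :: "real \<Rightarrow> real \<Rightarrow> (real \<Rightarrow> real) set" for \<alpha> \<beta> where
  base: "interval_cos \<alpha> \<beta> n \<in> cos_span \<alpha> \<beta>"
| add: "s \<in> cos_span \<alpha> \<beta> \<Longrightarrow> t \<in> cos_span \<alpha> \<beta> \<Longrightarrow> (\<lambda>x. s x + t x) \<in> cos_span \<alpha> \<beta>"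
| scale: "s \<in> cos_span \<alpha> \<beta> \<Longrightarrow> (\<lambda>x. c * s x) \<in> cos_span \<alpha> \<beta>"

lemma cos_span_explicit:
  assumes "s \<in> cos_span \<alpha> \<beta>"
  obtains N b where "s = (\<lambda>x. \<Sum>n<N. b n * interval_cos \<alpha> \<beta> n x)"
proof -
  from assms have "\<exists>N b. s = (\<lambda>x. \<Sum>n<N. b n * interval_cos \<alpha> \<beta> n x)"
  proof induction
    case (base n)
    show ?case
      by (intro exI[of _ "Suc n"] exI[of _ "\<lambda>k. if k = n then 1 else 0"]) (simp add: fun_eq_iff)
  next
    case (add s t)
    then obtain N b M d where s: "s = (\<lambda>x. \<Sum>n<N. b n * interval_cos \<alpha> \<beta> n x)"
      and t: "t = (\<lambda>x. \<Sum>n<M. d n * interval_cos \<alpha> \<beta> n x)"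
      by blast
    have ext: "(\<Sum>n<N. b n * interval_cos \<alpha> \<beta> n x) = (\<Sum>n<max N M. (if n < N then b n else 0) * interval_cos \<alpha> \<beta> n x)"
      for N b x M
      by (rule sum.mono_neutral_cong_left) auto
    have "(\<lambda>x. s x + t x) = (\<lambda>x. \<Sum>n<max N M. ((if n < N then b n else 0) + (if n < M then d n else 0)) * interval_cos \<alpha> \<beta> n x)"
      unfolding s t unfolding ext[where N=N and M=M and b=b] ext[where N=M and M=N and b=d] max.commute[of M N]
      by (simp only: ring_distribs sum.distrib)
    then show ?case by (intro exI)
  next
    case (scale s c)
    then obtain N b where s: "s = (\<lambda>x. \<Sum>n<N. b n * interval_cos \<alpha> \<beta> n x)" by blast
    have "(\<lambda>x. c * s x) = (\<lambda>x. \<Sum>n<N. (c * b n) * interval_cos \<alpha> \<beta> n x)"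
      unfolding s by (simp add: sum_distrib_left mult.assoc)
    then show ?case by (intro exI)
  qed
  then show thesis using that by blast
qed

text \<open>With $c_n(y)=\cos((n+1/2)\<pi> y)$, the addition theorem gives $2\cos(\<pi> y)c_n=c_{n+1}+c_{n-1}$. For $n=0$ the last
  term is $\cos(-\<pi> y/2)=c_0(y)$, so truncated subtraction yields the right index.\<close>

lemma cos_span_mult_cos:
  assumes "s \<in> cos_span \<alpha> \<beta>"
  shows "(\<lambda>x. cos (pi * ((x - \<alpha>) / (\<beta> - \<alpha>))) * s x) \<in> cos_span \<alpha> \<beta>"
  using assms
proof induction
  case (base n)
  have "cos (pi * y) * cos (pi * (real n + 1 / 2) * y) =
    1 / 2 * cos (pi * (real (Suc n) + 1 / 2) * y) + 1 / 2 * cos (pi * (real (n - 1) + 1 / 2) * y)" for y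
  proof (cases n)
    case 0
    have "cos (pi * y - pi * y / 2) = cos (pi * y / 2)" by (simp add: field_simps)
    then show ?thesis using 0 by (simp add: cos_times_cos algebra_simps)
  next
    case (Suc k)
    have "cos (pi * y - pi * (real n + 1 / 2) * y) = cos (pi * (real (n - 1) + 1 / 2) * y)"
      by (subst cos_minus[symmetric]) (simp add: Suc algebra_simps)
    moreover have "pi * y + pi * (real n + 1 / 2) * y = pi * (real (Suc n) + 1 / 2) * y"
      by (simp add: algebra_simps)
    ultimately show ?thesis by (simp add: cos_times_cos add.commute add_divide_distrib)
  qed
  then have "cos (pi * ((x - \<alpha>) / (\<beta> - \<alpha>))) * interval_cos \<alpha> \<beta> n x =
    1 / 2 * interval_cos \<alpha> \<beta> (Suc n) x + 1 / 2 * interval_cos \<alpha> \<beta> (n - 1) x" for x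
    unfolding interval_cos_def by (simp only: mult.left_commute[of "cos _" "sqrt _"]) (simp only: ring_distribs mult_ac)
  then show ?case
    by (simp only:) (intro cos_span.intros)
next
  case (add s t)
  then show ?case
    by (simp only: distrib_left) (rule cos_span.add)
next
  case (scale s c)
  then show ?case
    by (simp only: mult.left_commute[of _ c]) (rule cos_span.scale)
qed

text \<open>The continuous functions that multiply the span into itself form an algebra. It contains
  $\cos(\<pi>(x-\<alpha>)/(\<beta>-\<alpha>))$, which is injective on the interval, so it is uniformly dense by
  Stone--Weierstrass. To approximate \<open>u\<close>, divide it by the lowest cosine \<open>C\<close>, approximate the quotient by a multiplier
  \<open>p\<close>, and take \<open>p * C\<close>. As \<open>C\<close> vanishes at the right endpoint, the division is by \<open>C + \<delta>\<close>, and the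
  error $u\<delta>/(C+\<delta>)$ tends to zero in mean square as $\<delta>\<rightarrow>0$ by dominated convergence.\<close>

lemma cos_span_dense:
  assumes "\<alpha> < \<beta>" and u: "continuous_on {\<alpha>..\<beta>} u" and e: "e > 0"
  obtains s where "s \<in> cos_span \<alpha> \<beta>" "integral {\<alpha>..\<beta>} (\<lambda>x. (u x - s x)\<^sup>2) < e"
proof -
  define R where "R = {p. continuous_on {\<alpha>..\<beta>} p \<and> (\<forall>s\<in>cos_span \<alpha> \<beta>. (\<lambda>x. p x * s x) \<in> cos_span \<alpha> \<beta>)}"
  interpret R: function_ring_on R "{\<alpha>..\<beta>}"
  proof
    show "f \<in> R \<Longrightarrow> continuous_on {\<alpha>..\<beta>} f" for f
      by (simp add: R_def)
    show "(\<lambda>x. f x + g x) \<in> R" if "f \<in> R" "g \<in> R" for f g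
      using that by (auto simp: R_def ring_distribs intro!: continuous_intros cos_span.add)
    show "(\<lambda>x. f x * g x) \<in> R" if "f \<in> R" "g \<in> R" for f g
      using that by (auto simp: R_def mult.assoc intro!: continuous_intros)
    show "(\<lambda>x. c) \<in> R" for c
      by (auto simp: R_def intro!: cos_span.scale)
    show "\<exists>f\<in>R. f x \<noteq> f y" if "x \<in> {\<alpha>..\<beta>}" "y \<in> {\<alpha>..\<beta>}" "x \<noteq> y" for x y
    proof (rule bexI)
      have bnd: "0 \<le> pi * ((z - \<alpha>) / (\<beta> - \<alpha>)) \<and> pi * ((z - \<alpha>) / (\<beta> - \<alpha>)) \<le> pi" if "z \<in> {\<alpha>..\<beta>}" for z
      proof -
        have "0 \<le> (z - \<alpha>) / (\<beta> - \<alpha>)" "(z - \<alpha>) / (\<beta> - \<alpha>) \<le> 1"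
          using that assms(1) by (auto simp: divide_le_eq)
        then show ?thesis using pi_ge_zero by (metis mult_left_le mult_nonneg_nonneg)
      qed
      have "pi * ((x - \<alpha>) / (\<beta> - \<alpha>)) \<noteq> pi * ((y - \<alpha>) / (\<beta> - \<alpha>))"
        using \<open>x \<noteq> y\<close> assms(1) by simp
      then show "cos (pi * ((x - \<alpha>) / (\<beta> - \<alpha>))) \<noteq> cos (pi * ((y - \<alpha>) / (\<beta> - \<alpha>)))"
        using cos_inj_pi bnd[OF \<open>x \<in> _\<close>] bnd[OF \<open>y \<in> _\<close>] by blast
      show "(\<lambda>x. cos (pi * ((x - \<alpha>) / (\<beta> - \<alpha>)))) \<in> R"
        unfolding R_def using assms(1) cos_span_mult_cos by (auto intro!: continuous_intros simp only: mem_Collect_eq)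
    qed
  qed auto
  define C where "C = interval_cos \<alpha> \<beta> 0"
  have Cc: "continuous_on {\<alpha>..\<beta>} C"
    unfolding C_def using continuous_interval_cos[OF continuous_on_id] by simp
  have C0: "0 < C x" if "x \<in> {\<alpha>..<\<beta>}" for x
  proof -
    have "pi * (x - \<alpha>) / (2 * (\<beta> - \<alpha>)) < pi / 2"
      using that assms(1) by (simp add: field_simps)
    then show ?thesis
      using that assms(1) unfolding C_def interval_cos_def
      by (intro mult_pos_pos cos_gt_zero_pi) (auto simp: mult_ac intro: less_le_trans[of _ 0])
  qed
  have Cb: "C \<beta> = 0" using assms(1) by (simp add: C_def interval_cos_def)
  have C0': "0 \<le> C x" if "x \<in> {\<alpha>..\<beta>}" for x
    using that C0[of x] Cb by (cases "x = \<beta>") auto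
  define d where "d k = 1 / real (Suc k)" for k
  have d: "0 < d k" for k by (simp add: d_def)
  have d0: "d \<longlonglongrightarrow> 0" unfolding d_def by (rule LIMSEQ_Suc[OF lim_1_over_n])
  define r where "r k x = u x * (d k / (C x + d k))" for k x
  have den: "C x + d k \<noteq> 0" if "x \<in> {\<alpha>..\<beta>}" for x k
    using C0'[OF that] d[of k] by linarith
  have rc: "continuous_on {\<alpha>..\<beta>} (r k)" for k
    unfolding r_def using den by (intro continuous_intros u Cc) auto
  \<comment> \<open>The pointwise limit is not zero at $\<beta>$, where \<open>C\<close> vanishes, but a single point does not count.\<close>
  have "(\<lambda>k. integral {\<alpha>..\<beta>} (\<lambda>x. (r k x)\<^sup>2)) \<longlonglongrightarrow> integral {\<alpha>..\<beta>} (\<lambda>x. if x = \<beta> then (u x)\<^sup>2 else 0)"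
  proof (rule dominated_convergence[where h="\<lambda>x. (u x)\<^sup>2"])
    show "(\<lambda>x. (r k x)\<^sup>2) integrable_on {\<alpha>..\<beta>}" for k
      by (intro integrable_continuous_interval continuous_intros rc)
    show "(\<lambda>x. (u x)\<^sup>2) integrable_on {\<alpha>..\<beta>}"
      by (intro integrable_continuous_interval continuous_intros u)
    show "norm ((r k x)\<^sup>2) \<le> (u x)\<^sup>2" if "x \<in> {\<alpha>..\<beta>}" for k x
    proof -
      have "(d k / (C x + d k))\<^sup>2 \<le> 1"
        using C0'[OF that] d[of k] by (intro power_le_one) auto
      then show ?thesis
        using mult_left_mono[of "(d k / (C x + d k))\<^sup>2" 1 "(u x)\<^sup>2"]
        unfolding r_def power_mult_distrib by simp
    qed
    show "(\<lambda>k. (r k x)\<^sup>2) \<longlonglongrightarrow> (if x = \<beta> then (u x)\<^sup>2 else 0)" if x: "x \<in> {\<alpha>..\<beta>}" for x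
    proof (cases "x = \<beta>")
      case True
      have "r k x = u x" for k
        using d[of k] by (simp add: r_def True Cb)
      then show ?thesis using True by simp
    next
      case False
      then have "C x + 0 \<noteq> 0" using C0[of x] x by auto
      from tendsto_divide[OF d0 tendsto_add[OF tendsto_const d0] this]
      have "(\<lambda>k. (r k x)\<^sup>2) \<longlonglongrightarrow> (u x * (0 / (C x + 0)))\<^sup>2"
        unfolding r_def by (rule tendsto_power[OF tendsto_mult_left])
      then show ?thesis using False by simp
    qed
  qed
  also have "integral {\<alpha>..\<beta>} (\<lambda>x. if x = \<beta> then (u x)\<^sup>2 else 0) = 0"
    by (rule integral_unique, rule has_integral_spike[where S="{\<beta>}" and f="\<lambda>x. 0"]) auto
  finally have "eventually (\<lambda>k. integral {\<alpha>..\<beta>} (\<lambda>x. (r k x)\<^sup>2) < e / 4) sequentially"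
    by (rule order_tendstoD) (use e in auto)
  then obtain k where k: "integral {\<alpha>..\<beta>} (\<lambda>x. (r k x)\<^sup>2) < e / 4"
    by (auto simp: eventually_sequentially)
  define M where "M = sqrt (2 / (\<beta> - \<alpha>))"
  have CM: "\<bar>C x\<bar> \<le> M" for x
    using assms(1) by (simp add: C_def interval_cos_def M_def abs_mult mult_left_le)
  have M: "M > 0" using assms(1) by (simp add: M_def)
  \<comment> \<open>Chosen so that $2\<eta>^2M^2(\<beta>-\<alpha>) = e/2$, as $M^2(\<beta>-\<alpha>) = 2$.\<close>
  define \<eta> where "\<eta> = sqrt (e / 8)"
  have \<eta>: "\<eta> > 0" "\<eta>\<^sup>2 = e / 8" using e by (auto simp: \<eta>_def)
  have "continuous_on {\<alpha>..\<beta>} (\<lambda>x. u x / (C x + d k))"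
    using den by (intro continuous_intros u Cc) auto
  then have "\<exists>p\<in>R. \<forall>x\<in>{\<alpha>..\<beta>}. \<bar>u x / (C x + d k) - p x\<bar> < \<eta>"
    using R.Stone_Weierstrass_basic \<eta> by blast
  then obtain p where p: "p \<in> R" "\<And>x. x \<in> {\<alpha>..\<beta>} \<Longrightarrow> \<bar>u x / (C x + d k) - p x\<bar> < \<eta>"
    by blast
  define s where "s x = p x * C x" for x
  have sspan: "s \<in> cos_span \<alpha> \<beta>"
    using p(1) cos_span.base[of \<alpha> \<beta> 0] unfolding R_def s_def[abs_def] C_def by auto
  have pc: "continuous_on {\<alpha>..\<beta>} p" using p(1) by (simp add: R_def)
  have bd: "(u x - s x)\<^sup>2 \<le> 2 * (r k x)\<^sup>2 + 2 * (\<eta>\<^sup>2 * M\<^sup>2)" if x: "x \<in> {\<alpha>..\<beta>}" for x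
  proof -
    define v where "v = (u x / (C x + d k) - p x) * C x"
    have eq: "u x - s x = r k x + v"
    proof -
      define q where "q = u x / (C x + d k)"
      have "u x = q * (C x + d k)"
        using den[OF x, of k] by (simp add: q_def)
      moreover have "r k x = q * d k" by (simp add: r_def q_def)
      ultimately show ?thesis
        unfolding s_def v_def q_def[symmetric] by (simp add: algebra_simps)
    qed
    have "\<bar>v\<bar> \<le> \<eta> * M"
      unfolding v_def abs_mult using p(2)[OF x] CM[of x] by (intro mult_mono) auto
    then have "v\<^sup>2 \<le> (\<eta> * M)\<^sup>2"
      using power_mono[of "\<bar>v\<bar>" "\<eta> * M" 2] by simp
    moreover have "(r k x + v)\<^sup>2 \<le> 2 * (r k x)\<^sup>2 + 2 * v\<^sup>2"
      using sum_squares_bound[of "r k x" v] by (simp add: power2_sum)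
    ultimately show ?thesis by (simp add: eq power_mult_distrib)
  qed
  have "integral {\<alpha>..\<beta>} (\<lambda>x. (u x - s x)\<^sup>2) \<le> integral {\<alpha>..\<beta>} (\<lambda>x. 2 * (r k x)\<^sup>2 + 2 * (\<eta>\<^sup>2 * M\<^sup>2))"
    unfolding s_def using bd[unfolded s_def]
    by (intro integral_le integrable_continuous_interval continuous_intros u pc Cc rc) auto
  also have "\<dots> = 2 * integral {\<alpha>..\<beta>} (\<lambda>x. (r k x)\<^sup>2) + (\<beta> - \<alpha>) * (2 * (\<eta>\<^sup>2 * M\<^sup>2))"
    using assms(1) by (subst integral_add) (auto intro!: integrable_continuous_interval continuous_intros rc)
  also have "(\<beta> - \<alpha>) * (2 * (\<eta>\<^sup>2 * M\<^sup>2)) = e / 2"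
    using assms(1) e by (simp add: \<eta> M_def field_simps)
  also have "2 * integral {\<alpha>..\<beta>} (\<lambda>x. (r k x)\<^sup>2) + e / 2 < e"
    using k by simp
  finally show thesis using that sspan by blast
qed

text \<open>Completing the square shows that the coefficients of \<open>u\<close> minimise the mean square distance; density of
  the span then forces equality in Bessel's inequality.\<close>

lemma interval_cos_parseval:
  assumes "\<alpha> < \<beta>" and u: "continuous_on {\<alpha>..\<beta>} u"
  shows "(\<lambda>n. (integral {\<alpha>..\<beta>} (\<lambda>x. u x * interval_cos \<alpha> \<beta> n x))\<^sup>2) sums integral {\<alpha>..\<beta>} (\<lambda>x. (u x)\<^sup>2)"
proof -
  define a where "a n = integral {\<alpha>..\<beta>} (\<lambda>x. u x * interval_cos \<alpha> \<beta> n x)" for n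
  have ci: "continuous_on {\<alpha>..\<beta>} f \<Longrightarrow> f integrable_on {\<alpha>..\<beta>}" for f :: "real \<Rightarrow> real"
    by (rule integrable_continuous_interval)
  have expand: "integral {\<alpha>..\<beta>} (\<lambda>x. (u x - (\<Sum>n<N. b n * interval_cos \<alpha> \<beta> n x))\<^sup>2) =
    integral {\<alpha>..\<beta>} (\<lambda>x. (u x)\<^sup>2) - (\<Sum>n<N. (a n)\<^sup>2) + (\<Sum>n<N. (b n - a n)\<^sup>2)" for N b
  proof -
    have eq: "(u x)\<^sup>2 - (\<Sum>n<N. 2 * b n * (u x * interval_cos \<alpha> \<beta> n x)) + (\<Sum>n<N. \<Sum>m<N. b n * b m * (interval_cos \<alpha> \<beta> n x * interval_cos \<alpha> \<beta> m x)) =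
       (u x - (\<Sum>n<N. b n * interval_cos \<alpha> \<beta> n x))\<^sup>2" for x
      by (simp add: power2_diff power2_eq_square[of "sum _ _"] sum_product sum_distrib_left mult_ac)
    have "((\<lambda>x. u x * interval_cos \<alpha> \<beta> n x) has_integral a n) {\<alpha>..\<beta>}" for n
      unfolding a_def by (intro integrable_integral ci continuous_on_mult u continuous_interval_cos continuous_on_id)
    moreover have "((\<lambda>x. interval_cos \<alpha> \<beta> n x * interval_cos \<alpha> \<beta> m x) has_integral (if n = m then 1 else 0)) {\<alpha>..\<beta>}" for n m
      unfolding interval_cos_orthonormal[OF assms(1), symmetric]
      by (intro integrable_integral ci continuous_on_mult continuous_interval_cos continuous_on_id)
    moreover have "((\<lambda>x. (u x)\<^sup>2) has_integral integral {\<alpha>..\<beta>} (\<lambda>x. (u x)\<^sup>2)) {\<alpha>..\<beta>}"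
      by (intro integrable_integral ci continuous_on_power u)
    ultimately have "((\<lambda>x. (u x)\<^sup>2 - (\<Sum>n<N. 2 * b n * (u x * interval_cos \<alpha> \<beta> n x)) + (\<Sum>n<N. \<Sum>m<N. b n * b m * (interval_cos \<alpha> \<beta> n x * interval_cos \<alpha> \<beta> m x))) has_integral
       integral {\<alpha>..\<beta>} (\<lambda>x. (u x)\<^sup>2) - (\<Sum>n<N. 2 * b n * a n) + (\<Sum>n<N. \<Sum>m<N. b n * b m * (if n = m then 1 else 0))) {\<alpha>..\<beta>}"
      by (intro has_integral_add has_integral_diff has_integral_sum has_integral_mult_right finite_lessThan)
    then have "integral {\<alpha>..\<beta>} (\<lambda>x. (u x - (\<Sum>n<N. b n * interval_cos \<alpha> \<beta> n x))\<^sup>2) =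
       integral {\<alpha>..\<beta>} (\<lambda>x. (u x)\<^sup>2) - (\<Sum>n<N. 2 * b n * a n) + (\<Sum>n<N. \<Sum>m<N. b n * b m * (if n = m then 1 else 0))"
      unfolding eq by (rule integral_unique)
    also have "(\<Sum>n<N. \<Sum>m<N. b n * b m * (if n = m then 1 else 0)) = (\<Sum>n<N. (b n)\<^sup>2)"
      by (simp add: if_distrib[of "\<lambda>x. _ * x"] power2_eq_square cong: if_cong)
    finally show ?thesis
      by (simp add: power2_diff sum.distrib sum_subtractf mult_ac)
  qed
  have "(\<lambda>N. \<Sum>n<N. (a n)\<^sup>2) \<longlonglongrightarrow> integral {\<alpha>..\<beta>} (\<lambda>x. (u x)\<^sup>2)"
  proof (rule LIMSEQ_I)
    fix e :: real assume "e > 0"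
    then obtain s where s: "s \<in> cos_span \<alpha> \<beta>" "integral {\<alpha>..\<beta>} (\<lambda>x. (u x - s x)\<^sup>2) < e"
      using cos_span_dense[OF assms] by blast
    then obtain N b where sb: "s = (\<lambda>x. \<Sum>n<N. b n * interval_cos \<alpha> \<beta> n x)"
      using cos_span_explicit by blast
    define S where "S M = (\<Sum>n<M. (a n)\<^sup>2)" for M
    define I where "I = integral {\<alpha>..\<beta>} (\<lambda>x. (u x)\<^sup>2)"
    have close: "I - S N < e"
      using s(2) expand[where b=b and N=N] sum_nonneg[of "{..<N}" "\<lambda>n. (b n - a n)\<^sup>2"]
      by (simp add: sb S_def I_def)
    have mono: "S N \<le> S M" if "N \<le> M" for M
      unfolding S_def using that by (intro sum_mono2) auto
    have bessel: "S M \<le> I" for M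
    proof -
      have "0 \<le> integral {\<alpha>..\<beta>} (\<lambda>x. (u x - (\<Sum>n<M. a n * interval_cos \<alpha> \<beta> n x))\<^sup>2)"
        by (intro integral_nonneg ci continuous_intros u) auto
      then show ?thesis by (simp add: expand S_def I_def)
    qed
    show "\<exists>N. \<forall>M\<ge>N. norm ((\<Sum>n<M. (a n)\<^sup>2) - integral {\<alpha>..\<beta>} (\<lambda>x. (u x)\<^sup>2)) < e"
      unfolding S_def[symmetric] I_def[symmetric] real_norm_def
    proof (intro exI[of _ N] allI impI)
      fix M assume "N \<le> M"
      then show "\<bar>S M - I\<bar> < e"
        using close mono[of M] bessel[of M] by linarith
    qed
  qed
  then show ?thesis by (simp add: sums_def a_def)
qed

section \<open>Bells and the explicit form of a brushlet\<close>

locale brushlet_cutoff =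
  fixes \<rho> :: "real \<Rightarrow> real"
  assumes \<rho>_smooth: "smooth \<rho>"
    and \<rho>_nonneg: "\<rho> \<xi> \<ge> 0"
    and \<rho>_0: "\<xi> \<le> - 1 \<Longrightarrow> \<rho> \<xi> = 0"
    and \<rho>_1: "\<xi> \<ge> 1 \<Longrightarrow> \<rho> \<xi> = 1"
    and \<rho>_sq: "(\<rho> \<xi>)\<^sup>2 + (\<rho> (- \<xi>))\<^sup>2 = 1"
begin

lemma \<rho>_le_1: "\<rho> \<xi> \<le> 1"
proof -
  have "(\<rho> \<xi>)\<^sup>2 \<le> 1\<^sup>2"
    using \<rho>_sq[of \<xi>] zero_le_power2[of "\<rho> (- \<xi>)"] unfolding one_power2 by linarith
  then show ?thesis by (rule power2_le_imp_le) simp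
qed

lemma C2_\<rho>: "C2 \<rho>" by (rule smooth_imp_C2[OF \<rho>_smooth])

lemma C2_bell: "C2 (bell \<rho> (\<alpha>, \<alpha>', \<epsilon>, \<epsilon>'))"
proof -
  have "C2 (\<lambda>x. \<rho> (1 / \<epsilon> * x + - \<alpha> / \<epsilon>) * \<rho> (- 1 / \<epsilon>' * x + \<alpha>' / \<epsilon>'))"
    by (intro C2_mult C2_affine C2_\<rho>)
  also have "(\<lambda>x. \<rho> (1 / \<epsilon> * x + - \<alpha> / \<epsilon>) * \<rho> (- 1 / \<epsilon>' * x + \<alpha>' / \<epsilon>')) = bell \<rho> (\<alpha>, \<alpha>', \<epsilon>, \<epsilon>')"
    by (simp add: fun_eq_iff diff_divide_distrib)
  finally show ?thesis .
qed

lemma bell_eq_0: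
  assumes "\<epsilon> > 0" "\<epsilon>' > 0" "\<xi> \<le> \<alpha> - \<epsilon> \<or> \<alpha>' + \<epsilon>' \<le> \<xi>"
  shows "bell \<rho> (\<alpha>, \<alpha>', \<epsilon>, \<epsilon>') \<xi> = 0"
  using assms by (auto simp: field_simps intro!: \<rho>_0)

lemma C2c_bell:
  assumes "\<epsilon> > 0" "\<epsilon>' > 0"
  shows "C2c (bell \<rho> (\<alpha>, \<alpha>', \<epsilon>, \<epsilon>'))"
  unfolding C2c_def
proof (intro conjI exI allI impI C2_bell)
  fix \<xi> assume "\<bar>\<alpha>\<bar> + \<epsilon> + \<bar>\<alpha>'\<bar> + \<epsilon>' \<le> \<bar>\<xi>\<bar>"
  then have "\<xi> \<le> \<alpha> - \<epsilon> \<or> \<alpha>' + \<epsilon>' \<le> \<xi>"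
    using assms by (auto simp: abs_if split: if_splits)
  then show "bell \<rho> (\<alpha>, \<alpha>', \<epsilon>, \<epsilon>') \<xi> = 0"
    by (rule bell_eq_0[OF assms])
qed

lemma C2c_brushlet_hat:
  assumes "\<epsilon> > 0" "\<epsilon>' > 0"
  shows "C2c (brushlet_hat \<rho> n (\<alpha>, \<alpha>', \<epsilon>, \<epsilon>'))"
proof -
  have "C2 (\<lambda>\<xi>. sqrt (2 / (\<alpha>' - \<alpha>)) * bell \<rho> (\<alpha>, \<alpha>', \<epsilon>, \<epsilon>') \<xi> *
     cos ((pi * (real n + 1 / 2) / (\<alpha>' - \<alpha>)) * \<xi> + - pi * (real n + 1 / 2) * \<alpha> / (\<alpha>' - \<alpha>)))"
    by (intro C2_mult C2_const C2_bell C2_affine C2_cos)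
  also have "(\<lambda>\<xi>. sqrt (2 / (\<alpha>' - \<alpha>)) * bell \<rho> (\<alpha>, \<alpha>', \<epsilon>, \<epsilon>') \<xi> *
     cos ((pi * (real n + 1 / 2) / (\<alpha>' - \<alpha>)) * \<xi> + - pi * (real n + 1 / 2) * \<alpha> / (\<alpha>' - \<alpha>))) =
     brushlet_hat \<rho> n (\<alpha>, \<alpha>', \<epsilon>, \<epsilon>')"
    by (simp add: fun_eq_iff diff_divide_distrib right_diff_distrib del: bell.simps)
  finally have "C2 (brushlet_hat \<rho> n (\<alpha>, \<alpha>', \<epsilon>, \<epsilon>'))" .
  then show ?thesis
    using C2c_bell[OF assms, of \<alpha> \<alpha>'] unfolding C2c_def by (auto simp del: bell.simps)
qed

text \<open>The transition zones end exactly at \<open>l\<close> and \<open>u\<close>, so the support stays in $[l,u]$; for small \<open>m\<close>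
  the two zones may overlap.\<close>

definition bump :: "nat \<Rightarrow> real \<Rightarrow> real \<Rightarrow> real \<Rightarrow> real" where
  "bump m l u = bell \<rho> (l + 1 / real (Suc m), u - 1 / real (Suc m), 1 / real (Suc m), 1 / real (Suc m))"

lemma C2c_bump: "C2c (bump m l u)"
  unfolding bump_def by (rule C2c_bell) auto

lemma bump_bounds: "0 \<le> bump m l u x" "bump m l u x \<le> indicator {l<..<u} x"
proof -
  show "0 \<le> bump m l u x"
    by (simp add: bump_def \<rho>_nonneg)
  have "bump m l u x \<le> 1"
    by (simp add: bump_def \<rho>_nonneg \<rho>_le_1 mult_le_one)
  moreover have "bump m l u x = 0" if "x \<notin> {l<..<u}"
    unfolding bump_def by (rule bell_eq_0) (use that in \<open>auto simp: not_less\<close>)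
  ultimately show "bump m l u x \<le> indicator {l<..<u} x"
    by (auto simp: indicator_def)
qed

lemma bump_tendsto: "(\<lambda>m. bump m l u x) \<longlonglongrightarrow> indicator {l<..<u} x"
proof (cases "x \<in> {l<..<u}")
  case True
  have "(\<lambda>m. 1 / real (Suc m)) \<longlonglongrightarrow> 0"
    by (rule LIMSEQ_Suc[OF lim_1_over_n])
  moreover have "0 < min ((x - l) / 2) ((u - x) / 2)"
    using True by auto
  ultimately have "eventually (\<lambda>m. 1 / real (Suc m) < min ((x - l) / 2) ((u - x) / 2)) sequentially"
    by (rule order_tendstoD)
  then have "eventually (\<lambda>m. bump m l u x = 1) sequentially"
  proof eventually_elim
    case (elim m)
    define h where "h = 1 / real (Suc m)"
    have "h > 0" "2 * h < x - l" "2 * h < u - x"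
      using elim by (auto simp: h_def)
    then have "\<rho> ((x - (l + h)) / h) = 1" "\<rho> ((u - h - x) / h) = 1"
      by (auto intro!: \<rho>_1 simp: le_divide_eq)
    then show ?case
      unfolding bump_def h_def[symmetric] by simp
  qed
  then show ?thesis
    using True by (simp add: tendsto_eventually)
next
  case False
  then have "bump m l u x = 0" for m
    using bump_bounds[of m l u x] by auto
  then show ?thesis using False by simp
qed

text \<open>Bumps converge boundedly to the indicator of an interval, so all interval integrals of \<open>w\<close> vanish, and a continuous
  function is the derivative of its integral.\<close>

lemma fourier_eq_0_imp_eq_0:
  assumes w: "integrable lborel w" and c: "continuous_on UNIV w" and 0: "\<And>\<xi>. fourier w \<xi> = 0"
  shows "w x = 0"
proof -
  note [measurable] = borel_measurable_integrable[OF w]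
  have *: "integral {l..u} w = 0" if "l \<le> u" for l u
  proof -
    have "(\<lambda>m. LINT x|lborel. w x * of_real (bump m l u x)) \<longlonglongrightarrow> (LINT x|lborel. w x * of_real (indicator {l<..<u} x))"
    proof (rule integral_dominated_convergence[where w="\<lambda>x. cmod (w x)"])
      show "AE x in lborel. (\<lambda>m. w x * of_real (bump m l u x)) \<longlonglongrightarrow> w x * of_real (indicator {l<..<u} x)"
        by (intro AE_I2 tendsto_intros bump_tendsto)
      have "\<bar>bump m l u x\<bar> \<le> 1" for m x
        using bump_bounds[of m l u x] by (auto simp: indicator_def of_bool_def split: if_splits)
      then show "AE x in lborel. cmod (w x * of_real (bump m l u x)) \<le> cmod (w x)" for m
        by (intro AE_I2) (simp add: norm_mult mult_left_le)
      show "(\<lambda>x. w x * complex_of_real (bump m l u x)) \<in> borel_measurable lborel" for m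
        using C2c_borel[OF C2c_bump[of m l u]] by measurable
    qed (use w in auto)
    then have "(LINT x|lborel. w x * of_real (indicator {l<..<u} x)) = 0"
      by (simp add: fourier_eq_0_imp_weak_0[OF w 0 C2c_bump] LIMSEQ_const_iff)
    also have "(LINT x|lborel. w x * of_real (indicator {l<..<u} x)) = (LINT x:{l<..<u}|lborel. w x)"
      unfolding set_lebesgue_integral_def by (intro Bochner_Integration.integral_cong) (auto simp: indicator_def)
    also have "\<dots> = integral {l<..<u} w"
      by (rule set_borel_integral_eq_integral(2)) (auto simp: set_integrable_def intro: integrable_mult_indicator[OF _ w])
    finally show ?thesis
      by (simp add: integral_open_interval_real)
  qed
  have "((\<lambda>u. integral {x - 1..u} w) has_vector_derivative w x) (at x within {x - 1..x + 1})"
    by (rule integral_has_vector_derivative) (auto intro: continuous_on_subset[OF c])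
  then have "((\<lambda>u. integral {x - 1..u} w) has_vector_derivative w x) (at x)"
    by (simp add: at_within_Icc_at)
  moreover have "((\<lambda>u. integral {x - 1..u} w) has_vector_derivative 0) (at x)"
    by (rule has_vector_derivative_transform_within_open[where S="{x-1<..<x+1}" and f="\<lambda>x. 0"])
       (auto simp: *)
  ultimately show ?thesis
    by (rule vector_derivative_unique_at)
qed

text \<open>Among continuous integrable functions a function is determined by its Fourier transform, so the definite
  description denotes the inverse transform of the bell-cosine.\<close>

lemma brushlet_eq:
  assumes "\<epsilon> > 0" "\<epsilon>' > 0"
  shows "brushlet \<rho> n (\<alpha>, \<alpha>', \<epsilon>, \<epsilon>') = inv_fourier (brushlet_hat \<rho> n (\<alpha>, \<alpha>', \<epsilon>, \<epsilon>'))"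
proof -
  define g where "g = brushlet_hat \<rho> n (\<alpha>, \<alpha>', \<epsilon>, \<epsilon>')"
  have g: "C2c g"
    unfolding g_def by (rule C2c_brushlet_hat[OF assms])
  have leb: "integrable lebesgue w \<longleftrightarrow> integrable lborel w" if "continuous_on UNIV w" for w :: "real \<Rightarrow> complex"
    using borel_measurable_continuous_onI[OF that] by (intro integrable_completion) simp
  have "(THE w. continuous_on UNIV w \<and> integrable lebesgue w \<and> (\<forall>\<xi>. fourier w \<xi> = complex_of_real (g \<xi>))) = inv_fourier g"
  proof (rule the_equality)
    show ex: "continuous_on UNIV (inv_fourier g) \<and> integrable lebesgue (inv_fourier g) \<and> (\<forall>\<xi>. fourier (inv_fourier g) \<xi> = complex_of_real (g \<xi>))"
      using g by (simp add: leb inv_fourier_continuous inv_fourier_integrable fourier_inv_fourier)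
    fix w assume w: "continuous_on UNIV w \<and> integrable lebesgue w \<and> (\<forall>\<xi>. fourier w \<xi> = complex_of_real (g \<xi>))"
    have wi: "integrable lborel w" using w leb by blast
    have gi: "integrable lborel (inv_fourier g)" using g by (simp add: inv_fourier_integrable)
    have osci: "integrable lborel (\<lambda>x. v x * osc (- (x * \<xi>)))" if "integrable lborel v" for v \<xi>
      using borel_measurable_integrable[OF that]
      by (intro Bochner_Integration.integrable_bound[OF that]) (auto simp: norm_mult)
    have "w x - inv_fourier g x = 0" for x
    proof (rule fourier_eq_0_imp_eq_0[of "\<lambda>x. w x - inv_fourier g x"])
      fix \<xi>
      have "fourier (\<lambda>x. w x - inv_fourier g x) \<xi> = fourier w \<xi> - fourier (inv_fourier g) \<xi>"
        using wi gi by (simp add: fourier_lborel borel_measurable_integrable left_diff_distrib osci right_diff_distrib)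
      then show "fourier (\<lambda>x. w x - inv_fourier g x) \<xi> = 0"
        using w ex by simp
    qed (use wi gi w ex in \<open>auto intro: continuous_intros\<close>)
    then show "w = inv_fourier g" by (simp add: fun_eq_iff)
  qed
  then show ?thesis by (simp add: brushlet_def g_def)
qed

end

section \<open>Folding at the endpoints\<close>

text \<open>The transition zones of the two endpoints do not overlap.\<close>

definition admissible :: "cutoff_interval \<Rightarrow> bool" where
  "admissible I = (case I of (\<alpha>, \<beta>, \<epsilon>, \<epsilon>') \<Rightarrow> 0 < \<epsilon> \<and> 0 < \<epsilon>' \<and> \<epsilon> + \<epsilon>' \<le> \<beta> - \<alpha>)"

text \<open>Either the intervals are adjacent with a common cutoff radius, or the supports of the bells
  meet at most in a point.\<close>

definition before :: "cutoff_interval \<Rightarrow> cutoff_interval \<Rightarrow> bool" where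
  "before I J = (case (I, J) of ((\<alpha>, \<alpha>', \<epsilon>, \<epsilon>'), (\<beta>, \<beta>', \<delta>, \<delta>')) \<Rightarrow>
     (\<alpha>' = \<beta> \<and> \<epsilon>' = \<delta>) \<or> \<alpha>' + \<epsilon>' \<le> \<beta> - \<delta>)"

lemma integral_reflect_about:
  fixes f :: "real \<Rightarrow> real"
  assumes "continuous_on {2 * c - b..2 * c - a} f"
  shows "integral {2 * c - b..2 * c - a} f = integral {a..b} (\<lambda>x. f (2 * c - x))"
proof -
  have "(f has_integral integral {2 * c - b..2 * c - a} f) (cbox (2 * c - b) (2 * c - a))"
    using integrable_continuous_interval[OF assms] by (simp add: integrable_integral)
  from has_integral_affinity[OF this, of "-1" "2 * c"]
  have "((\<lambda>x. f (2 * c - x)) has_integral integral {2 * c - b..2 * c - a} f) ((\<lambda>x. 2 * c - x) ` {2 * c - b..2 * c - a})"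
    by (simp add: add.commute)
  also have "(\<lambda>x. 2 * c - x) ` {2 * c - b..2 * c - a} = {a..b}"
    by (simp add: image_diff_atLeastAtMost)
  finally show ?thesis by (simp add: integral_unique)
qed

lemma interval_cos_reflect_left: "interval_cos \<alpha> \<beta> n (2 * \<alpha> - \<xi>) = interval_cos \<alpha> \<beta> n \<xi>"
proof -
  have "pi * (real n + 1 / 2) * ((2 * \<alpha> - \<xi> - \<alpha>) / (\<beta> - \<alpha>)) = - (pi * (real n + 1 / 2) * ((\<xi> - \<alpha>) / (\<beta> - \<alpha>)))"
    by (simp add: field_simps diff_divide_distrib)
  then show ?thesis unfolding interval_cos_def by (simp only: cos_minus)
qed

lemma interval_cos_reflect_right:
  assumes "\<alpha> < \<beta>"
  shows "interval_cos \<alpha> \<beta> n (2 * \<beta> - \<xi>) = - interval_cos \<alpha> \<beta> n \<xi>"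
proof -
  define y where "y = (\<xi> - \<alpha>) / (\<beta> - \<alpha>)"
  have "(2 * \<beta> - \<xi> - \<alpha>) / (\<beta> - \<alpha>) = 2 - y"
    using assms by (simp add: y_def field_simps)
  then have "pi * (real n + 1 / 2) * ((2 * \<beta> - \<xi> - \<alpha>) / (\<beta> - \<alpha>)) = (2 * real n * pi + pi) - pi * (real n + 1 / 2) * y"
    by (simp only:) (simp add: field_simps)
  moreover have "cos ((2 * real n * pi + pi) - z) = - cos z" for z
    by (simp add: cos_diff cos_add sin_add)
  ultimately show ?thesis unfolding interval_cos_def by (simp only: y_def mult_minus_right)
qed

context brushlet_cutoff
begin

lemma brushlet_hat_eq_bell_cos:
  "brushlet_hat \<rho> n (\<alpha>, \<beta>, \<epsilon>, \<epsilon>') \<xi> = bell \<rho> (\<alpha>, \<beta>, \<epsilon>, \<epsilon>') \<xi> * interval_cos \<alpha> \<beta> n \<xi>"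
  by (simp add: interval_cos_def del: bell.simps)

lemma continuous_\<rho> [continuous_intros]: "continuous_on S f \<Longrightarrow> continuous_on S (\<lambda>x. \<rho> (f x))"
  using continuous_on_compose2[OF C2_continuous[OF C2_\<rho>, of UNIV], of S f] by simp

text \<open>The signs are the parities of the cosines about the endpoints: even on the left, odd on the right.\<close>

definition fold_back :: "(real \<Rightarrow> real) \<Rightarrow> cutoff_interval \<Rightarrow> real \<Rightarrow> real" where
  "fold_back h I \<xi> = (let (\<alpha>, \<beta>, \<epsilon>, \<epsilon>') = I in h \<xi> * bell \<rho> I \<xi> +
     h (2 * \<alpha> - \<xi>) * bell \<rho> I (2 * \<alpha> - \<xi>) - h (2 * \<beta> - \<xi>) * bell \<rho> I (2 * \<beta> - \<xi>))"

lemma continuous_bell: "continuous_on S (bell \<rho> I)"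
  by (cases I) (metis C2_bell C2_continuous)

lemma continuous_fold_back:
  assumes "continuous_on UNIV h"
  shows "continuous_on S (fold_back h I)"
proof -
  obtain \<alpha> \<beta> \<epsilon> \<epsilon>' where I: "I = (\<alpha>, \<beta>, \<epsilon>, \<epsilon>')" by (cases I)
  have *: "continuous_on S (\<lambda>\<xi>. h (c - \<xi>) * bell \<rho> I (c - \<xi>))" for c
    by (intro continuous_on_mult continuous_on_compose2[OF assms] continuous_on_compose2[OF continuous_bell[of UNIV]] continuous_intros) auto
  have "continuous_on S (\<lambda>\<xi>. h \<xi> * bell \<rho> I \<xi>)"
    by (intro continuous_on_mult continuous_on_subset[OF assms] continuous_bell) auto
  with * show ?thesis
    unfolding fold_back_def[abs_def] by (simp add: I continuous_on_add continuous_on_diff del: bell.simps)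
qed

text \<open>As neither radius exceeds the length, the integrand lives on the interval and its two mirror images; reflecting
  these into the interval and using the parities of the cosine collects the three parts.\<close>

lemma fold_back_integral:
  assumes "admissible (\<alpha>, \<beta>, \<epsilon>, \<epsilon>')" and h: "continuous_on UNIV h"
  shows "(LINT \<xi>|lborel. h \<xi> * brushlet_hat \<rho> n (\<alpha>, \<beta>, \<epsilon>, \<epsilon>') \<xi>) =
    integral {\<alpha>..\<beta>} (\<lambda>\<xi>. fold_back h (\<alpha>, \<beta>, \<epsilon>, \<epsilon>') \<xi> * interval_cos \<alpha> \<beta> n \<xi>)"
proof -
  have I: "0 < \<epsilon>" "0 < \<epsilon>'" "\<epsilon> + \<epsilon>' \<le> \<beta> - \<alpha>" "\<alpha> < \<beta>"
    using assms(1) by (auto simp: admissible_def)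
  define b where "b = bell \<rho> (\<alpha>, \<beta>, \<epsilon>, \<epsilon>')"
  define F where "F \<xi> = h \<xi> * b \<xi> * interval_cos \<alpha> \<beta> n \<xi>" for \<xi>
  have Fc: "continuous_on S F" for S
    unfolding F_def b_def
    by (intro continuous_on_mult continuous_bell continuous_interval_cos continuous_on_id continuous_on_subset[OF h]) auto
  have Fi: "F integrable_on {u..v}" for u v
    by (intro integrable_continuous_interval Fc)
  have rc: "continuous_on S (\<lambda>\<xi>. F (c - \<xi>))" for S c
    by (intro continuous_on_compose2[OF Fc[of UNIV]] continuous_intros) auto
  have "(LINT \<xi>|lborel. h \<xi> * brushlet_hat \<rho> n (\<alpha>, \<beta>, \<epsilon>, \<epsilon>') \<xi>) = (LINT \<xi>|lborel. F \<xi>)"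
    unfolding brushlet_hat_eq_bell_cos F_def b_def by (simp add: mult.assoc del: bell.simps)
  also have "\<dots> = integral {2 * \<alpha> - \<beta>..2 * \<beta> - \<alpha>} F"
  proof (rule lborel_integral_compact_support[OF Fc])
    fix \<xi> assume "\<xi> \<notin> {2 * \<alpha> - \<beta>..2 * \<beta> - \<alpha>}"
    then have "\<xi> \<le> \<alpha> - \<epsilon> \<or> \<beta> + \<epsilon>' \<le> \<xi>"
      using I by auto
    then show "F \<xi> = 0"
      using bell_eq_0[OF I(1,2), of \<xi> \<alpha> \<beta>] by (simp add: F_def b_def del: bell.simps)
  qed
  also have "\<dots> = integral {2 * \<alpha> - \<beta>..\<alpha>} F + integral {\<alpha>..\<beta>} F + integral {\<beta>..2 * \<beta> - \<alpha>} F"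
    using I by (simp add: Henstock_Kurzweil_Integration.integral_combine Fi)
  also have "integral {2 * \<alpha> - \<beta>..\<alpha>} F = integral {\<alpha>..\<beta>} (\<lambda>\<xi>. F (2 * \<alpha> - \<xi>))"
    using integral_reflect_about[OF Fc, of \<alpha> \<beta> \<alpha>] by simp
  also have "integral {\<beta>..2 * \<beta> - \<alpha>} F = integral {\<alpha>..\<beta>} (\<lambda>\<xi>. F (2 * \<beta> - \<xi>))"
    using integral_reflect_about[OF Fc, of \<beta> \<beta> \<alpha>] by simp
  also have "integral {\<alpha>..\<beta>} (\<lambda>\<xi>. F (2 * \<alpha> - \<xi>)) + integral {\<alpha>..\<beta>} F + integral {\<alpha>..\<beta>} (\<lambda>\<xi>. F (2 * \<beta> - \<xi>)) =
     integral {\<alpha>..\<beta>} (\<lambda>\<xi>. F (2 * \<alpha> - \<xi>) + F \<xi> + F (2 * \<beta> - \<xi>))"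
    by (subst Henstock_Kurzweil_Integration.integral_add | intro refl integrable_continuous_interval continuous_on_add rc Fc)+
  also have "(\<lambda>\<xi>. F (2 * \<alpha> - \<xi>) + F \<xi> + F (2 * \<beta> - \<xi>)) = (\<lambda>\<xi>. fold_back h (\<alpha>, \<beta>, \<epsilon>, \<epsilon>') \<xi> * interval_cos \<alpha> \<beta> n \<xi>)"
    by (simp add: fun_eq_iff fold_back_def b_def[symmetric] F_def interval_cos_reflect_left interval_cos_reflect_right[OF I(4)] del: bell.simps)
       (simp add: algebra_simps)
  finally show ?thesis .
qed

text \<open>At a mirror point the far factor of the bell is already \<open>1\<close>. Since the zones do not overlap, each
  point of the interval is outside at least one of them.\<close>

lemma bell_reflect:
  assumes "admissible (\<alpha>, \<beta>, \<epsilon>, \<epsilon>')" "\<xi> \<in> {\<alpha>..\<beta>}"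
  shows "bell \<rho> (\<alpha>, \<beta>, \<epsilon>, \<epsilon>') (2 * \<alpha> - \<xi>) = \<rho> ((\<alpha> - \<xi>) / \<epsilon>)"
    and "bell \<rho> (\<alpha>, \<beta>, \<epsilon>, \<epsilon>') (2 * \<beta> - \<xi>) = \<rho> ((\<xi> - \<beta>) / \<epsilon>')"
    and "(\<rho> ((\<xi> - \<alpha>) / \<epsilon>) = 1 \<and> \<rho> ((\<alpha> - \<xi>) / \<epsilon>) = 0) \<or> (\<rho> ((\<beta> - \<xi>) / \<epsilon>') = 1 \<and> \<rho> ((\<xi> - \<beta>) / \<epsilon>') = 0)"
proof -
  have I: "0 < \<epsilon>" "0 < \<epsilon>'" "\<epsilon> + \<epsilon>' \<le> \<beta> - \<alpha>" "\<alpha> \<le> \<xi>" "\<xi> \<le> \<beta>"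
    using assms by (auto simp: admissible_def)
  have "\<rho> ((\<beta> - (2 * \<alpha> - \<xi>)) / \<epsilon>') = 1" "\<rho> ((2 * \<beta> - \<xi> - \<alpha>) / \<epsilon>) = 1"
    using I by (auto intro!: \<rho>_1 simp: le_divide_eq)
  then show "bell \<rho> (\<alpha>, \<beta>, \<epsilon>, \<epsilon>') (2 * \<alpha> - \<xi>) = \<rho> ((\<alpha> - \<xi>) / \<epsilon>)"
    and "bell \<rho> (\<alpha>, \<beta>, \<epsilon>, \<epsilon>') (2 * \<beta> - \<xi>) = \<rho> ((\<xi> - \<beta>) / \<epsilon>')"
    by simp_all
  have "\<alpha> + \<epsilon> \<le> \<xi> \<or> \<xi> \<le> \<beta> - \<epsilon>'" using I by linarith
  then show "(\<rho> ((\<xi> - \<alpha>) / \<epsilon>) = 1 \<and> \<rho> ((\<alpha> - \<xi>) / \<epsilon>) = 0) \<or> (\<rho> ((\<beta> - \<xi>) / \<epsilon>') = 1 \<and> \<rho> ((\<xi> - \<beta>) / \<epsilon>') = 0)"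
    using I by (elim disj_forward) (auto intro!: \<rho>_1 \<rho>_0 simp: le_divide_eq divide_le_eq)
qed

lemma \<rho>_pair: "(\<rho> ((x - y) / \<epsilon>))\<^sup>2 + (\<rho> ((y - x) / \<epsilon>))\<^sup>2 = 1"
  using \<rho>_sq[of "(x - y) / \<epsilon>"] by (simp add: minus_divide_left)

text \<open>Folding the bell-cosine itself restores the cosine: the squares of the bell at a point and
  its two mirror points add up to one.\<close>

lemma brushlet_hat_orthonormal_same:
  assumes I: "admissible I"
  shows "(LINT \<xi>|lborel. brushlet_hat \<rho> m I \<xi> * brushlet_hat \<rho> n I \<xi>) = (if m = n then 1 else 0)"
proof -
  obtain \<alpha> \<beta> \<epsilon> \<epsilon>' where I_def: "I = (\<alpha>, \<beta>, \<epsilon>, \<epsilon>')" by (cases I)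
  have I: "admissible (\<alpha>, \<beta>, \<epsilon>, \<epsilon>')" and L: "\<alpha> < \<beta>"
    using assms by (auto simp: I_def admissible_def)
  define b where "b = bell \<rho> (\<alpha>, \<beta>, \<epsilon>, \<epsilon>')"
  have 1: "(b \<xi>)\<^sup>2 + (b (2 * \<alpha> - \<xi>))\<^sup>2 + (b (2 * \<beta> - \<xi>))\<^sup>2 = 1" if "\<xi> \<in> {\<alpha>..\<beta>}" for \<xi>
    using bell_reflect(3)[OF I that] \<rho>_pair[of \<xi> \<alpha> \<epsilon>] \<rho>_pair[of \<xi> \<beta> \<epsilon>']
    unfolding b_def bell_reflect(1,2)[OF I that] by auto
  have hc: "continuous_on UNIV (\<lambda>\<xi>. b \<xi> * interval_cos \<alpha> \<beta> m \<xi>)"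
    unfolding b_def by (intro continuous_on_mult continuous_bell continuous_interval_cos continuous_on_id)
  have "(LINT \<xi>|lborel. brushlet_hat \<rho> m I \<xi> * brushlet_hat \<rho> n I \<xi>) =
    (LINT \<xi>|lborel. (b \<xi> * interval_cos \<alpha> \<beta> m \<xi>) * brushlet_hat \<rho> n (\<alpha>, \<beta>, \<epsilon>, \<epsilon>') \<xi>)"
    unfolding I_def brushlet_hat_eq_bell_cos b_def ..
  also have "\<dots> = integral {\<alpha>..\<beta>} (\<lambda>\<xi>. fold_back (\<lambda>\<xi>. b \<xi> * interval_cos \<alpha> \<beta> m \<xi>) (\<alpha>, \<beta>, \<epsilon>, \<epsilon>') \<xi> * interval_cos \<alpha> \<beta> n \<xi>)"
    by (rule fold_back_integral[OF I hc])
  also have "\<dots> = integral {\<alpha>..\<beta>} (\<lambda>\<xi>. interval_cos \<alpha> \<beta> m \<xi> * interval_cos \<alpha> \<beta> n \<xi>)"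
  proof (rule Henstock_Kurzweil_Integration.integral_cong)
    fix \<xi> assume "\<xi> \<in> {\<alpha>..\<beta>}"
    have "fold_back (\<lambda>\<xi>. b \<xi> * interval_cos \<alpha> \<beta> m \<xi>) (\<alpha>, \<beta>, \<epsilon>, \<epsilon>') \<xi> =
      ((b \<xi>)\<^sup>2 + (b (2 * \<alpha> - \<xi>))\<^sup>2 + (b (2 * \<beta> - \<xi>))\<^sup>2) * interval_cos \<alpha> \<beta> m \<xi>"
      by (simp add: fold_back_def b_def[symmetric] interval_cos_reflect_left interval_cos_reflect_right[OF L] power2_eq_square del: bell.simps)
         (simp add: algebra_simps)
    then show "fold_back (\<lambda>\<xi>. b \<xi> * interval_cos \<alpha> \<beta> m \<xi>) (\<alpha>, \<beta>, \<epsilon>, \<epsilon>') \<xi> * interval_cos \<alpha> \<beta> n \<xi> = interval_cos \<alpha> \<beta> m \<xi> * interval_cos \<alpha> \<beta> n \<xi>"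
      using 1[OF \<open>\<xi> \<in> {\<alpha>..\<beta>}\<close>] by simp
  qed
  also have "\<dots> = (if m = n then 1 else 0)"
    by (rule interval_cos_orthonormal[OF L])
  finally show ?thesis .
qed

text \<open>For adjacent intervals the product of the two bells is even about the common endpoint, one cosine is odd
  and the other even, so the integrand is odd.\<close>

lemma brushlet_hat_orthogonal_before:
  assumes "admissible I" "admissible J" "before I J"
  shows "(LINT \<xi>|lborel. brushlet_hat \<rho> m I \<xi> * brushlet_hat \<rho> n J \<xi>) = 0"
proof -
  obtain \<alpha> \<alpha>' \<epsilon> \<epsilon>' \<beta> \<beta>' \<delta> \<delta>' where IJ: "I = (\<alpha>, \<alpha>', \<epsilon>, \<epsilon>')" "J = (\<beta>, \<beta>', \<delta>, \<delta>')"
    by (metis prod.exhaust)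
  have I: "0 < \<epsilon>" "0 < \<epsilon>'" "\<epsilon> + \<epsilon>' \<le> \<alpha>' - \<alpha>" "\<alpha> < \<alpha>'" and J: "0 < \<delta>" "0 < \<delta>'" "\<delta> + \<delta>' \<le> \<beta>' - \<beta>"
    using assms by (auto simp: IJ admissible_def)
  have bz: "bell \<rho> I \<xi> = 0" if "\<alpha>' + \<epsilon>' \<le> \<xi>" for \<xi>
    unfolding IJ by (rule bell_eq_0) (use I that in auto)
  have bz': "bell \<rho> J \<xi> = 0" if "\<xi> \<le> \<beta> - \<delta>" for \<xi>
    unfolding IJ by (rule bell_eq_0) (use J that in auto)
  consider "\<alpha>' + \<epsilon>' \<le> \<beta> - \<delta>" | "\<alpha>' = \<beta>" "\<epsilon>' = \<delta>"
    using assms(3) by (auto simp: IJ before_def)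
  then show ?thesis
  proof cases
    case 1
    have "bell \<rho> I \<xi> = 0 \<or> bell \<rho> J \<xi> = 0" for \<xi>
      using bz[of \<xi>] bz'[of \<xi>] 1 by linarith
    then have z: "brushlet_hat \<rho> m I \<xi> * brushlet_hat \<rho> n J \<xi> = 0" for \<xi>
      unfolding IJ brushlet_hat_eq_bell_cos by (metis mult_zero_left mult_zero_right)
    show ?thesis by (simp only: z) simp
  next
    case 2
    have bb: "bell \<rho> I \<xi> * bell \<rho> J \<xi> = \<rho> ((\<beta> - \<xi>) / \<delta>) * \<rho> ((\<xi> - \<beta>) / \<delta>)" for \<xi>
    proof -
      consider "\<xi> \<le> \<beta> - \<delta>" | "\<beta> + \<delta> \<le> \<xi>" | "\<beta> - \<delta> \<le> \<xi>" "\<xi> \<le> \<beta> + \<delta>" by linarith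
      then show ?thesis
      proof cases
        case 1
        then have "\<rho> ((\<xi> - \<beta>) / \<delta>) = 0" using J by (intro \<rho>_0) (simp add: divide_le_eq)
        then show ?thesis using bz'[OF 1] by simp
      next
        case 2
        then have "\<rho> ((\<beta> - \<xi>) / \<delta>) = 0" using J by (intro \<rho>_0) (simp add: divide_le_eq)
        then show ?thesis using bz[of \<xi>] 2 \<open>\<alpha>' = \<beta>\<close> \<open>\<epsilon>' = \<delta>\<close> by simp
      next
        case 3
        have "\<rho> ((\<xi> - \<alpha>) / \<epsilon>) = 1" "\<rho> ((\<beta>' - \<xi>) / \<delta>') = 1"
          using I J 3 2 by (auto intro!: \<rho>_1 simp: le_divide_eq)
        then show ?thesis using 2 by (simp add: IJ)
      qed
    qed
    define f where "f \<xi> = brushlet_hat \<rho> m I \<xi> * brushlet_hat \<rho> n J \<xi>" for \<xi>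
    have f: "f \<xi> = \<rho> ((\<beta> - \<xi>) / \<delta>) * \<rho> ((\<xi> - \<beta>) / \<delta>) * (interval_cos \<alpha> \<beta> m \<xi> * interval_cos \<beta> \<beta>' n \<xi>)" for \<xi>
      unfolding bb[symmetric] f_def IJ brushlet_hat_eq_bell_cos 2 by (simp add: mult_ac del: bell.simps)
    have "f (2 * \<beta> - \<xi>) = - f \<xi>" for \<xi>
      using I 2 by (simp add: f interval_cos_reflect_left interval_cos_reflect_right)
    moreover have "(LINT \<xi>|lborel. f \<xi>) = (LINT \<xi>|lborel. f (2 * \<beta> - \<xi>))"
      using lborel_integral_real_affine[of "-1" f "2 * \<beta>"] by simp
    ultimately have "(LINT \<xi>|lborel. f \<xi>) = - (LINT \<xi>|lborel. f \<xi>)" by simp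
    then show ?thesis by (simp add: f_def)
  qed
qed

text \<open>What folding at the left endpoint of an interval adds to $\<integral> h^2$. At a right endpoint the same
  amount is subtracted, because the two foldings of a pair of mirror values form a rotation.\<close>

definition edge_defect :: "(real \<Rightarrow> real) \<Rightarrow> real \<Rightarrow> real \<Rightarrow> real" where
  "edge_defect h \<alpha> \<epsilon> = integral {\<alpha>..\<alpha> + \<epsilon>} (\<lambda>\<xi>. (h \<xi> * \<rho> ((\<xi> - \<alpha>) / \<epsilon>) + h (2 * \<alpha> - \<xi>) * \<rho> ((\<alpha> - \<xi>) / \<epsilon>))\<^sup>2 - (h \<xi>)\<^sup>2)"

text \<open>Away from the transition zones folding does nothing. In the zone of the right endpoint the
  rotation identity $(xt-yr)^2+(yt+xr)^2=x^2+y^2$ rewrites the odd folding in terms of the even folding at the mirror point.\<close>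

lemma fold_back_energy:
  assumes I: "admissible (\<alpha>, \<beta>, \<epsilon>, \<epsilon>')" and h: "continuous_on UNIV h"
  shows "integral {\<alpha>..\<beta>} (\<lambda>\<xi>. (fold_back h (\<alpha>, \<beta>, \<epsilon>, \<epsilon>') \<xi>)\<^sup>2) =
     integral {\<alpha>..\<beta>} (\<lambda>\<xi>. (h \<xi>)\<^sup>2) + edge_defect h \<alpha> \<epsilon> - edge_defect h \<beta> \<epsilon>'"
proof -
  have I': "0 < \<epsilon>" "0 < \<epsilon>'" "\<epsilon> + \<epsilon>' \<le> \<beta> - \<alpha>" "\<alpha> < \<beta>"
    using I by (auto simp: admissible_def)
  define d where "d c r \<xi> = (h \<xi> * \<rho> ((\<xi> - c) / r) + h (2 * c - \<xi>) * \<rho> ((c - \<xi>) / r))\<^sup>2 - (h \<xi>)\<^sup>2" for c r \<xi>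
  have hc: "continuous_on S h" for S
    using h by (rule continuous_on_subset) simp
  have hc': "continuous_on S (\<lambda>\<xi>. h (c - \<xi>))" for S c
    by (intro continuous_on_compose2[OF h] continuous_intros) auto
  have dc: "r > 0 \<Longrightarrow> continuous_on S (d c r)" for c r S
    unfolding d_def by (intro continuous_intros hc hc') auto
  have dc': "r > 0 \<Longrightarrow> continuous_on S (\<lambda>\<xi>. d c r (t - \<xi>))" for c r S t
    by (intro continuous_on_compose2[OF dc[of _ UNIV]] continuous_intros) auto
  have dint: "integral {c..c + K} (d c r) = edge_defect h c r" if "0 < r" "r \<le> K" for c r K
  proof -
    have "integral {c + r..c + K} (d c r) = integral {c + r..c + K} (\<lambda>\<xi>. 0)"
    proof (rule Henstock_Kurzweil_Integration.integral_cong)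
      fix \<xi> assume "\<xi> \<in> {c + r..c + K}"
      then have "\<rho> ((\<xi> - c) / r) = 1" "\<rho> ((c - \<xi>) / r) = 0"
        using that by (auto intro!: \<rho>_1 \<rho>_0 simp: le_divide_eq divide_le_eq)
      then show "d c r \<xi> = 0" by (simp add: d_def)
    qed
    moreover have "integral {c..c + r} (d c r) + integral {c + r..c + K} (d c r) = integral {c..c + K} (d c r)"
      using that by (intro Henstock_Kurzweil_Integration.integral_combine integrable_continuous_interval dc) auto
    ultimately show ?thesis by (simp add: edge_defect_def d_def[abs_def])
  qed
  have "integral {\<alpha>..\<beta>} (\<lambda>\<xi>. (fold_back h (\<alpha>, \<beta>, \<epsilon>, \<epsilon>') \<xi>)\<^sup>2) =
    integral {\<alpha>..\<beta>} (\<lambda>\<xi>. (h \<xi>)\<^sup>2 + d \<alpha> \<epsilon> \<xi> - d \<beta> \<epsilon>' (2 * \<beta> - \<xi>))"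
  proof (rule Henstock_Kurzweil_Integration.integral_cong)
    fix \<xi> assume \<xi>: "\<xi> \<in> {\<alpha>..\<beta>}"
    define s c t r where "s = \<rho> ((\<xi> - \<alpha>) / \<epsilon>)" "c = \<rho> ((\<alpha> - \<xi>) / \<epsilon>)" "t = \<rho> ((\<beta> - \<xi>) / \<epsilon>')" "r = \<rho> ((\<xi> - \<beta>) / \<epsilon>')"
    have eq: "fold_back h (\<alpha>, \<beta>, \<epsilon>, \<epsilon>') \<xi> = h \<xi> * (s * t) + h (2 * \<alpha> - \<xi>) * c - h (2 * \<beta> - \<xi>) * r"
      unfolding fold_back_def Let_def prod.case bell_reflect(1,2)[OF I \<xi>] by (simp add: s_c_t_r_def)
    have d1: "d \<alpha> \<epsilon> \<xi> = (h \<xi> * s + h (2 * \<alpha> - \<xi>) * c)\<^sup>2 - (h \<xi>)\<^sup>2"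
      by (simp add: d_def s_c_t_r_def)
    have d2: "d \<beta> \<epsilon>' (2 * \<beta> - \<xi>) = (h (2 * \<beta> - \<xi>) * t + h \<xi> * r)\<^sup>2 - (h (2 * \<beta> - \<xi>))\<^sup>2"
      by (simp add: d_def s_c_t_r_def)
    have tr: "t\<^sup>2 + r\<^sup>2 = 1"
      unfolding s_c_t_r_def by (rule \<rho>_pair)
    have cases: "(s = 1 \<and> c = 0) \<or> (t = 1 \<and> r = 0)"
      unfolding s_c_t_r_def by (rule bell_reflect(3)[OF I \<xi>])
    have "(x * t - y * r)\<^sup>2 + (y * t + x * r)\<^sup>2 = (x\<^sup>2 + y\<^sup>2) * (t\<^sup>2 + r\<^sup>2)" for x y
      by (simp add: power2_eq_square algebra_simps)
    then have rot: "(x * t - y * r)\<^sup>2 = x\<^sup>2 + y\<^sup>2 - (y * t + x * r)\<^sup>2" for x y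
      unfolding tr by (simp add: eq_diff_eq)
    show "(fold_back h (\<alpha>, \<beta>, \<epsilon>, \<epsilon>') \<xi>)\<^sup>2 = (h \<xi>)\<^sup>2 + d \<alpha> \<epsilon> \<xi> - d \<beta> \<epsilon>' (2 * \<beta> - \<xi>)"
      using cases unfolding eq d1 d2
    proof (elim disjE conjE)
      assume "s = 1" "c = 0"
      then show "(h \<xi> * (s * t) + h (2 * \<alpha> - \<xi>) * c - h (2 * \<beta> - \<xi>) * r)\<^sup>2 = (h \<xi>)\<^sup>2 + ((h \<xi> * s + h (2 * \<alpha> - \<xi>) * c)\<^sup>2 - (h \<xi>)\<^sup>2) - ((h (2 * \<beta> - \<xi>) * t + h \<xi> * r)\<^sup>2 - (h (2 * \<beta> - \<xi>))\<^sup>2)"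
        using rot[of "h \<xi>" "h (2 * \<beta> - \<xi>)"] by simp
    qed simp
  qed
  also have "\<dots> = integral {\<alpha>..\<beta>} (\<lambda>\<xi>. (h \<xi>)\<^sup>2) + integral {\<alpha>..\<beta>} (d \<alpha> \<epsilon>) - integral {\<alpha>..\<beta>} (\<lambda>\<xi>. d \<beta> \<epsilon>' (2 * \<beta> - \<xi>))"
    using I' by (intro integral_unique has_integral_diff has_integral_add integrable_integral integrable_continuous_interval continuous_on_power hc dc dc')
  also have "integral {\<alpha>..\<beta>} (d \<alpha> \<epsilon>) = edge_defect h \<alpha> \<epsilon>"
    using dint[of \<epsilon> "\<beta> - \<alpha>" \<alpha>] I' by simp
  also have "integral {\<alpha>..\<beta>} (\<lambda>\<xi>. d \<beta> \<epsilon>' (2 * \<beta> - \<xi>)) = integral {2 * \<beta> - \<beta>..2 * \<beta> - \<alpha>} (d \<beta> \<epsilon>')"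
    using I' by (intro integral_reflect_about[symmetric] dc)
  also have "\<dots> = edge_defect h \<beta> \<epsilon>'"
    using dint[of \<epsilon>' "\<beta> - \<alpha>" \<beta>] I' by simp
  finally show ?thesis .
qed

text \<open>The energy of the even folding lies between zero and the energy of both sides of the endpoint.\<close>

lemma edge_defect_bounds:
  assumes "\<epsilon> > 0" and h: "continuous_on UNIV h"
  shows "- integral {\<alpha>..\<alpha> + \<epsilon>} (\<lambda>\<xi>. (h \<xi>)\<^sup>2) \<le> edge_defect h \<alpha> \<epsilon>"
    and "edge_defect h \<alpha> \<epsilon> \<le> integral {\<alpha> - \<epsilon>..\<alpha>} (\<lambda>\<xi>. (h \<xi>)\<^sup>2)"
proof -
  have hc: "continuous_on S h" for S
    using h by (rule continuous_on_subset) simp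
  have hc': "continuous_on S (\<lambda>\<xi>. h (c - \<xi>))" for S c
    by (intro continuous_on_compose2[OF h] continuous_intros) auto
  have c1: "continuous_on S (\<lambda>\<xi>. (h \<xi> * \<rho> ((\<xi> - \<alpha>) / \<epsilon>) + h (2 * \<alpha> - \<xi>) * \<rho> ((\<alpha> - \<xi>) / \<epsilon>))\<^sup>2 - (h \<xi>)\<^sup>2)" for S
    using assms(1) by (intro continuous_intros hc hc') auto
  have "integral {\<alpha>..\<alpha> + \<epsilon>} (\<lambda>\<xi>. - (h \<xi>)\<^sup>2) \<le> edge_defect h \<alpha> \<epsilon>"
    unfolding edge_defect_def
    by (intro integral_le integrable_continuous_interval c1 continuous_on_minus continuous_on_power hc) auto
  then show "- integral {\<alpha>..\<alpha> + \<epsilon>} (\<lambda>\<xi>. (h \<xi>)\<^sup>2) \<le> edge_defect h \<alpha> \<epsilon>"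
    by (simp add: integral_neg)
  have "edge_defect h \<alpha> \<epsilon> \<le> integral {\<alpha>..\<alpha> + \<epsilon>} (\<lambda>\<xi>. (h (2 * \<alpha> - \<xi>))\<^sup>2)"
    unfolding edge_defect_def
  proof (intro integral_le integrable_continuous_interval c1 continuous_on_power hc')
    fix \<xi>
    define s c where "s = \<rho> ((\<xi> - \<alpha>) / \<epsilon>)" "c = \<rho> ((\<alpha> - \<xi>) / \<epsilon>)"
    have sc: "s\<^sup>2 + c\<^sup>2 = 1"
      unfolding s_c_def by (rule \<rho>_pair)
    have "(x * s + y * c)\<^sup>2 + (x * c - y * s)\<^sup>2 = (x\<^sup>2 + y\<^sup>2) * (s\<^sup>2 + c\<^sup>2)" for x y
      by (simp add: power2_eq_square algebra_simps)
    then have "(x * s + y * c)\<^sup>2 + (x * c - y * s)\<^sup>2 = x\<^sup>2 + y\<^sup>2" for x y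
      by (simp only: sc mult_1_right)
    then have "(x * s + y * c)\<^sup>2 \<le> x\<^sup>2 + y\<^sup>2" for x y
      using zero_le_power2[of "x * c - y * s"] by (metis le_add_same_cancel1)
    from this[of "h \<xi>" "h (2 * \<alpha> - \<xi>)"]
    show "(h \<xi> * \<rho> ((\<xi> - \<alpha>) / \<epsilon>) + h (2 * \<alpha> - \<xi>) * \<rho> ((\<alpha> - \<xi>) / \<epsilon>))\<^sup>2 - (h \<xi>)\<^sup>2 \<le> (h (2 * \<alpha> - \<xi>))\<^sup>2"
      unfolding s_c_def by linarith
  qed
  also have "\<dots> = integral {2 * \<alpha> - (\<alpha> + \<epsilon>)..2 * \<alpha> - \<alpha>} (\<lambda>\<xi>. (h \<xi>)\<^sup>2)"
    by (rule integral_reflect_about[symmetric]) (intro continuous_on_power hc)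
  finally show "edge_defect h \<alpha> \<epsilon> \<le> integral {\<alpha> - \<epsilon>..\<alpha>} (\<lambda>\<xi>. (h \<xi>)\<^sup>2)"
    by simp
qed

lemma local_cosine_parseval:
  assumes I: "admissible (\<alpha>, \<beta>, \<epsilon>, \<epsilon>')" and h: "continuous_on UNIV h"
  shows "(\<lambda>n. (LINT \<xi>|lborel. h \<xi> * brushlet_hat \<rho> n (\<alpha>, \<beta>, \<epsilon>, \<epsilon>') \<xi>)\<^sup>2) sums
    (integral {\<alpha>..\<beta>} (\<lambda>\<xi>. (h \<xi>)\<^sup>2) + edge_defect h \<alpha> \<epsilon> - edge_defect h \<beta> \<epsilon>')"
proof -
  have "\<alpha> < \<beta>" using I by (auto simp: admissible_def)
  from interval_cos_parseval[OF this continuous_fold_back[OF h, of "{\<alpha>..\<beta>}" "(\<alpha>, \<beta>, \<epsilon>, \<epsilon>')"]] show ?thesis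
    unfolding fold_back_integral[OF I h] fold_back_energy[OF I h] .
qed

end

section \<open>The level intervals\<close>

lemma level_interval_scaled:
  defines "t \<equiv> \<lambda>a j. 2 powr (real_of_int (j - 1) * a)"
  shows "level_interval a j 1 = (0, t a j, t a j / (2 powr a)\<^sup>2, t a j / (2 powr a)\<^sup>2)"
    and "level_interval a j 2 = (t a j, t a j * 2 powr a, t a j / (2 powr a)\<^sup>2, t a j / 2 powr a)"
    and "level_interval a j (- 1) = (- t a j, 0, t a j / (2 powr a)\<^sup>2, t a j / (2 powr a)\<^sup>2)"
    and "level_interval a j (- 2) = (- (t a j * 2 powr a), - t a j, t a j / 2 powr a, t a j / (2 powr a)\<^sup>2)"
proof -
  have 1: "2 powr (real_of_int j * a) = t a j * 2 powr a"
    by (simp add: t_def powr_add[symmetric] algebra_simps)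
  have 2: "2 powr (real_of_int (j - 2) * a) = t a j / 2 powr a"
    by (simp add: t_def powr_diff[symmetric] algebra_simps)
  have 3: "2 powr (real_of_int (j - 3) * a) = t a j / (2 powr a)\<^sup>2"
  proof -
    have "(2 powr a)\<^sup>2 = 2 powr (a + a)"
      by (simp only: powr_add power2_eq_square)
    moreover have "real_of_int (j - 1) * a - (a + a) = real_of_int (j - 3) * a"
      by (simp add: algebra_simps)
    ultimately show ?thesis
      by (simp only: t_def powr_diff[symmetric])
  qed
  show "level_interval a j 1 = (0, t a j, t a j / (2 powr a)\<^sup>2, t a j / (2 powr a)\<^sup>2)"
    and "level_interval a j 2 = (t a j, t a j * 2 powr a, t a j / (2 powr a)\<^sup>2, t a j / 2 powr a)"
    and "level_interval a j (- 1) = (- t a j, 0, t a j / (2 powr a)\<^sup>2, t a j / (2 powr a)\<^sup>2)"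
    and "level_interval a j (- 2) = (- (t a j * 2 powr a), - t a j, t a j / 2 powr a, t a j / (2 powr a)\<^sup>2)"
    unfolding level_interval_def 1 2 3 by (simp_all add: t_def Let_def)
qed

text \<open>The inequalities that keep the transition zones of a level apart. They fail when \<open>a\<close> is close to \<open>0\<close>.\<close>

lemma level_scale:
  fixes a t :: real
  defines "s \<equiv> 2 powr a"
  assumes "a \<ge> 1" and t: "t > 0"
  shows "s \<ge> 2" "t / s \<le> t / 2" "t / s\<^sup>2 \<le> t / 4" "2 * t \<le> t * s" "t / s > 0" "t / s\<^sup>2 > 0"
proof -
  show s: "s \<ge> 2" using assms powr_mono[of 1 a 2] by (simp add: s_def)
  have s2: "s\<^sup>2 \<ge> 4" using power_mono[OF s, of 2] by simp
  show "t / s \<le> t / 2"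
    by (rule divide_left_mono) (use s t in auto)
  show "t / s\<^sup>2 \<le> t / 4"
    by (rule divide_left_mono) (use s s2 t in auto)
  show "2 * t \<le> t * s" using s t by simp
  show "t / s > 0" "t / s\<^sup>2 > 0" using s t by auto
qed

lemma level_admissible:
  assumes "a \<ge> 1" "k \<in> {1, -1, 2, -2}"
  shows "admissible (level_interval a j k)"
proof -
  define s t where st_def: "s = 2 powr a" "t = 2 powr (real_of_int (j - 1) * a)"
  note d = st_def
  have "t > 0" by (simp add: st_def)
  note st = this level_scale[OF assms(1) this, folded st_def]
  note l = level_interval_scaled[of a j, folded st_def]
  have "t / s\<^sup>2 + t / s\<^sup>2 \<le> t" "t / s\<^sup>2 + t / s \<le> t * s - t"
    using st by linarith+
  then show ?thesis
    using assms(2) st(6,7) by (auto simp: l admissible_def)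
qed

lemma level_before:
  assumes "a \<ge> 1" "k \<in> {1, -1, 2, -2}" "k' \<in> {1, -1, 2, -2}" "k < k'"
  shows "before (level_interval a j k) (level_interval a j k')"
proof -
  define s t where st_def: "s = 2 powr a" "t = 2 powr (real_of_int (j - 1) * a)"
  note d = st_def
  have "t > 0" by (simp add: st_def)
  note st = this level_scale[OF assms(1) this, folded st_def]
  note l = level_interval_scaled[of a j, folded st_def]
  have "t / s\<^sup>2 \<le> t - t / s\<^sup>2" "- t + t / s\<^sup>2 \<le> - (t / s\<^sup>2)" "- t + t / s\<^sup>2 \<le> t - t / s\<^sup>2"
    using st by linarith+
  then show ?thesis
    using assms(2-4) by (auto simp: l before_def)
qed

text \<open>The outer intervals of a higher level start at or beyond the ends of all lower-level intervals. If they
  touch, the levels are consecutive and the radii agree.\<close>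

lemma cross_level_before:
  assumes "a \<ge> 1" "k \<in> {1, -1, 2, -2}" "j < j'"
  shows "before (level_interval a j k) (level_interval a j' 2)"
    and "before (level_interval a j' (- 2)) (level_interval a j k)"
proof -
  define s t where st_def: "s = 2 powr a" "t = 2 powr (real_of_int (j - 1) * a)"
  note d = st_def
  have "t > 0" by (simp add: st_def)
  note st = this level_scale[OF assms(1) this, folded st_def]
  note l = level_interval_scaled[of a j, folded st_def]
  define t' where d': "t' = 2 powr (real_of_int (j' - 1) * a)"
  have "t' > 0" by (simp add: d')
  note st' = this level_scale[OF assms(1) this, folded st_def d']
  note l' = level_interval_scaled[of a j', folded st_def d']
  have far: "t + t / s\<^sup>2 \<le> t' - t' / s\<^sup>2" and touch: "(t' = t * s) \<or> t * s + t / s \<le> t' - t' / s\<^sup>2"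
  proof -
    have tm: "t * s powr x \<le> t'" if "j + x \<le> j'" "x \<ge> 0" for x :: real
    proof -
      have "t * s powr x = 2 powr (real_of_int (j - 1) * a + a * x)"
        by (simp add: d powr_powr powr_add)
      also have "\<dots> \<le> t'"
      proof -
        have "a * x \<le> a * (real_of_int j' - real_of_int j)"
          using that assms(1) by (intro mult_left_mono) auto
        then show ?thesis
          by (simp add: d' algebra_simps)
      qed
      finally show ?thesis .
    qed
    have 1: "t * s \<le> t'"
      using tm[of 1] assms(3) st by simp
    then show "t + t / s\<^sup>2 \<le> t' - t' / s\<^sup>2"
      using st st' by linarith
    show "(t' = t * s) \<or> t * s + t / s \<le> t' - t' / s\<^sup>2"
    proof (cases "j' = j + 1")
      case True
      have "t' = 2 powr (real_of_int (j - 1) * a + a)"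
        by (simp add: d' True algebra_simps)
      then show ?thesis by (simp add: d powr_add)
    next
      case False
      then have "t * s powr 2 \<le> t'" using assms(3) by (intro tm) auto
      then have 2: "t * s * s \<le> t'" using st by (simp add: powr_numeral power2_eq_square mult.assoc)
      have "t * s * 2 \<le> t * s * s"
        using st by (intro mult_left_mono) auto
      then show ?thesis using 2 st st' by linarith
    qed
  qed
  have fin: "t' = t * s \<Longrightarrow> t / s = t' / s\<^sup>2"
    using st(2) by (simp add: power2_eq_square)
  \<comment> \<open>Abstracting the quotients leaves facts that are linear in the new variables.\<close>
  define u w u' w' where uw_def: "u = t / s\<^sup>2" "w = t / s" "u' = t' / s\<^sup>2" "w' = t' / s"
  define q where q_def: "q = t * s"
  have key: "(t' = q \<and> w = u') \<or> q + w \<le> t' - u'" and far': "t + u \<le> t' - u'"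
    using touch fin far unfolding uw_def q_def by auto
  have pos: "0 < t" "0 < u" "0 < w" "0 < q"
    using st(1,2,6,7) unfolding uw_def q_def by simp_all
  note L = l[folded uw_def q_def] l'[folded uw_def]
  show "before (level_interval a j k) (level_interval a j' 2)"
    using assms(2) key far' pos by (auto simp: L before_def)
  show "before (level_interval a j' (- 2)) (level_interval a j k)"
    using assms(2) key far' pos by (auto simp: L before_def)
qed

lemma indicator_integral:
  fixes f :: "real \<Rightarrow> real"
  assumes "integrable lborel f"
  shows "integral {u..v} f = (LINT x|lborel. indicator {u..v} x * f x)"
proof -
  have "set_integrable lborel {u..v} f"
    using integrable_mult_indicator[OF _ assms, of "{u..v}"] by (simp add: set_integrable_def)
  from set_borel_integral_eq_integral(2)[OF this] show ?thesis
    by (simp add: set_lebesgue_integral_def)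
qed

lemma integral_tendsto_expanding:
  fixes f :: "real \<Rightarrow> real"
  assumes f: "integrable lborel f" and r: "filterlim r at_top sequentially"
  shows "(\<lambda>n. integral {- r n..r n} f) \<longlonglongrightarrow> (LINT x|lborel. f x)"
proof -
  note [measurable] = borel_measurable_integrable[OF f]
  have "(\<lambda>n. LINT x|lborel. indicator {- r n..r n} x * f x) \<longlonglongrightarrow> (LINT x|lborel. f x)"
  proof (rule integral_dominated_convergence[where w="\<lambda>x. \<bar>f x\<bar>"])
    show "AE x in lborel. (\<lambda>n. indicator {- r n..r n} x * f x) \<longlonglongrightarrow> f x"
    proof (rule AE_I2)
      fix x
      have "eventually (\<lambda>n. \<bar>x\<bar> \<le> r n) sequentially"
        using r by (simp add: filterlim_at_top)
      then have "eventually (\<lambda>n. indicator {- r n..r n} x * f x = f x) sequentially"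
        by eventually_elim (auto simp: indicator_def abs_le_iff)
      then show "(\<lambda>n. indicator {- r n..r n} x * f x) \<longlonglongrightarrow> f x"
        by (rule tendsto_eventually)
    qed
  qed (use f in \<open>auto simp: indicator_def\<close>)
  then show ?thesis by (simp add: indicator_integral[OF f])
qed

lemma integral_tendsto_shrinking:
  fixes f :: "real \<Rightarrow> real"
  assumes f: "integrable lborel f" and r: "r \<longlonglongrightarrow> 0"
  shows "(\<lambda>n. integral {- r n..r n} f) \<longlonglongrightarrow> 0"
proof -
  note [measurable] = borel_measurable_integrable[OF f]
  have "(\<lambda>n. LINT x|lborel. indicator {- r n..r n} x * f x) \<longlonglongrightarrow> (LINT x|(lborel::real measure). 0)"
  proof (rule integral_dominated_convergence[where w="\<lambda>x. \<bar>f x\<bar>"])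
    have "AE x in lborel. x \<noteq> (0::real)"
      by (rule AE_lborel_singleton)
    then show "AE x in lborel. (\<lambda>n. indicator {- r n..r n} x * f x) \<longlonglongrightarrow> 0"
    proof eventually_elim
      case (elim x)
      then have "eventually (\<lambda>n. r n < \<bar>x\<bar>) sequentially"
        by (intro order_tendstoD(2)[OF r]) auto
      then have "eventually (\<lambda>n. indicator {- r n..r n} x * f x = 0) sequentially"
        by eventually_elim (auto simp: indicator_def abs_if split: if_splits)
      then show "(\<lambda>n. indicator {- r n..r n} x * f x) \<longlonglongrightarrow> 0"
        by (rule tendsto_eventually)
    qed
  qed (use f in \<open>auto simp: indicator_def\<close>)
  then show ?thesis by (simp add: indicator_integral[OF f])
qed

context brushlet_cutoff
begin

lemma brushlet_hat_commute:
  "(LINT \<xi>|lborel. brushlet_hat \<rho> m I \<xi> * brushlet_hat \<rho> n J \<xi>) = (LINT \<xi>|lborel. brushlet_hat \<rho> n J \<xi> * brushlet_hat \<rho> m I \<xi>)"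
  by (simp add: mult.commute)

lemma level_orthonormal:
  assumes "a \<ge> 1" "k \<in> {1, -1, 2, -2}" "k' \<in> {1, -1, 2, -2}"
  shows "(LINT \<xi>|lborel. brushlet_hat \<rho> m (level_interval a j k) \<xi> * brushlet_hat \<rho> n (level_interval a j k') \<xi>) =
    (if m = n \<and> k = k' then 1 else 0)"
proof -
  note adm = level_admissible[OF assms(1,2)] level_admissible[OF assms(1,3)]
  consider "k = k'" | "k < k'" | "k' < k" by linarith
  then show ?thesis
  proof cases
    case 1
    then show ?thesis using brushlet_hat_orthonormal_same[OF adm(1), where m=m and n=n] by simp
  next
    case 2
    then show ?thesis
      using brushlet_hat_orthogonal_before[OF adm level_before[OF assms 2]] by simp
  next
    case 3
    then show ?thesis
      using brushlet_hat_orthogonal_before[OF adm(2,1) level_before[OF assms(1,3,2) 3], where m=n and n=m]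
      unfolding brushlet_hat_commute[of m] by simp
  qed
qed

lemma cross_level_orthogonal:
  assumes "a \<ge> 1" "k \<in> {1, -1, 2, -2}" "k' \<in> {2, -2}" "j < j'"
  shows "(LINT \<xi>|lborel. brushlet_hat \<rho> m (level_interval a j k) \<xi> * brushlet_hat \<rho> n (level_interval a j' k') \<xi>) = 0"
proof -
  have k': "k' \<in> {1, -1, 2, -2}" using assms(3) by auto
  note adm = level_admissible[OF assms(1,2)] level_admissible[OF assms(1) k']
  note bef = cross_level_before[OF assms(1,2,4)]
  consider "k' = 2" | "k' = -2" using assms(3) by auto
  then show ?thesis
  proof cases
    case 1
    then show ?thesis
      using brushlet_hat_orthogonal_before[OF adm] bef by simp
  next
    case 2
    then show ?thesis
      unfolding brushlet_hat_commute[of m]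
      using brushlet_hat_orthogonal_before[OF adm(2,1)] bef by simp
  qed
qed

text \<open>By \<open>local_cosine_parseval\<close> the total energy of the coefficients of \<open>h\<close> for this interval.\<close>

definition energy :: "(real \<Rightarrow> real) \<Rightarrow> cutoff_interval \<Rightarrow> real" where
  "energy h I = (case I of (\<alpha>, \<beta>, \<epsilon>, \<epsilon>') \<Rightarrow>
     integral {\<alpha>..\<beta>} (\<lambda>\<xi>. (h \<xi>)\<^sup>2) + edge_defect h \<alpha> \<epsilon> - edge_defect h \<beta> \<epsilon>')"

lemma energy_sums:
  assumes I: "admissible I" and h: "continuous_on UNIV h"
  shows "(\<lambda>n. (LINT \<xi>|lborel. h \<xi> * brushlet_hat \<rho> n I \<xi>)\<^sup>2) sums energy h I"
proof -
  obtain \<alpha> \<beta> \<epsilon> \<epsilon>' where "I = (\<alpha>, \<beta>, \<epsilon>, \<epsilon>')" by (cases I)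
  then show ?thesis
    using local_cosine_parseval[of \<alpha> \<beta> \<epsilon> \<epsilon>' h] assms by (simp add: energy_def del: brushlet_hat.simps)
qed

text \<open>The defects at the common endpoint cancel, so the value depends only on the outer endpoints and radii.\<close>

lemma energy_join:
  assumes h: "continuous_on UNIV h" and "\<alpha> \<le> \<beta>" "\<beta> \<le> \<gamma>"
  shows "energy h (\<alpha>, \<beta>, \<epsilon>, \<delta>) + energy h (\<beta>, \<gamma>, \<delta>, \<epsilon>') = energy h (\<alpha>, \<gamma>, \<epsilon>, \<epsilon>')"
proof -
  have "integral {\<alpha>..\<beta>} (\<lambda>\<xi>. (h \<xi>)\<^sup>2) + integral {\<beta>..\<gamma>} (\<lambda>\<xi>. (h \<xi>)\<^sup>2) = integral {\<alpha>..\<gamma>} (\<lambda>\<xi>. (h \<xi>)\<^sup>2)"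
    using assms(2,3)
    by (intro Henstock_Kurzweil_Integration.integral_combine integrable_continuous_interval continuous_on_power continuous_on_subset[OF h]) auto
  then show ?thesis by (simp add: energy_def)
qed

definition inner_energy :: "(real \<Rightarrow> real) \<Rightarrow> real \<Rightarrow> int \<Rightarrow> real" where
  "inner_energy h a j = energy h (level_interval a j 1) + energy h (level_interval a j (- 1))"

text \<open>Joining the four intervals of level \<open>j\<close> and joining the two inner intervals of level \<open>j + 1\<close> gives the
  same interval with the same outer radii, although the radii at the interior endpoint \<open>0\<close> differ.\<close>

lemma inner_energy_Suc:
  assumes "a \<ge> 1" and h: "continuous_on UNIV h"
  shows "(\<Sum>k\<in>{1, -1, 2, -2}. energy h (level_interval a j k)) = inner_energy h a (j + 1)"
proof -
  define s t where st_def: "s = 2 powr a" "t = 2 powr (real_of_int (j - 1) * a)"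
  note d = st_def
  have "t > 0" by (simp add: st_def)
  note st = this level_scale[OF assms(1) this, folded st_def]
  note l = level_interval_scaled[of a j, folded st_def]
  define t' where d': "t' = 2 powr (real_of_int (j + 1 - 1) * a)"
  note l' = level_interval_scaled[of a "j + 1", folded st_def d']
  have t': "t' = t * s"
    by (simp add: d d' powr_add[symmetric] algebra_simps)
  have e: "t * s / s\<^sup>2 = t / s"
    using st by (simp add: power2_eq_square)
  show ?thesis
    using energy_join[OF h, of 0 t "t * s" "t / s\<^sup>2" "t / s\<^sup>2" "t / s"]
      energy_join[OF h, of "- (t * s)" "- t" 0 "t / s" "t / s\<^sup>2" "t / s\<^sup>2"]
      energy_join[OF h, of "- (t * s)" 0 "t * s" "t / s" "t / s\<^sup>2" "t / s"]
      energy_join[OF h, of "- (t * s)" 0 "t * s" "t / s" "t / s" "t / s"] st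
    by (simp add: inner_energy_def l l' t' e)
qed

lemma inner_energy_bounds:
  fixes j :: int
  assumes "a \<ge> 1" and h: "continuous_on UNIV h"
  defines "t \<equiv> 2 powr (real_of_int (j - 1) * a)"
  shows "integral {-(t / 2)..t / 2} (\<lambda>\<xi>. (h \<xi>)\<^sup>2) \<le> inner_energy h a j" (is ?A)
    and "inner_energy h a j \<le> integral {-(2 * t)..2 * t} (\<lambda>\<xi>. (h \<xi>)\<^sup>2)" (is ?B)
proof -
  define G where "G u v = integral {u..v} (\<lambda>\<xi>. (h \<xi>)\<^sup>2)" for u v
  define s where "s = 2 powr a"
  have "t > 0" by (simp add: t_def)
  note st = this level_scale[OF assms(1) this, folded s_def]
  note l = level_interval_scaled[of a j, folded s_def t_def]
  define d where "d = t / s\<^sup>2"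
  \<comment> \<open>The defects only reach a distance \<open>d\<close> into and out of the interval, far less than \<open>t / 2\<close> and \<open>t\<close>.\<close>
  have d: "0 < d" "d \<le> t / 4" using st by (auto simp: d_def)
  have int: "(\<lambda>\<xi>. (h \<xi>)\<^sup>2) integrable_on {u..v}" for u v
    by (intro integrable_continuous_interval continuous_on_power continuous_on_subset[OF h]) auto
  have join: "G u v + G v w = G u w" if "u \<le> v" "v \<le> w" for u v w
    unfolding G_def by (intro Henstock_Kurzweil_Integration.integral_combine that int)
  have pos: "0 \<le> G u v" for u v
    unfolding G_def by (intro integral_nonneg int) auto
  have E: "inner_energy h a j = G (- t) t + edge_defect h (- t) d - edge_defect h t d"
    using energy_join[OF h, of "- t" 0 t d d d] st by (simp add: inner_energy_def l d_def[symmetric] energy_def G_def)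
  note b = edge_defect_bounds[OF d(1) h, folded G_def]
  have "G (- t) t = G (- t) (- t + d) + G (- t + d) (-(t / 2)) + G (-(t / 2)) (t / 2) + G (t / 2) (t - d) + G (t - d) t"
    using st d by (simp add: join)
  then show ?A
    unfolding E G_def[symmetric] using b(1)[of "- t"] b(2)[of t] pos[of "- t + d" "-(t / 2)"] pos[of "t / 2" "t - d"] by linarith
  have "G (-(2 * t)) (2 * t) = G (-(2 * t)) (- t - d) + G (- t - d) (- t) + G (- t) t + G t (t + d) + G (t + d) (2 * t)"
    using st d by (simp add: join)
  then show ?B
    unfolding E G_def[symmetric] using b(2)[of "- t"] b(1)[of t] pos[of "-(2 * t)" "- t - d"] pos[of "t + d" "2 * t"] by linarith
qed

lemma inner_energy_limits:
  assumes "a \<ge> 1" and h: "continuous_on UNIV h" and i: "integrable lborel (\<lambda>\<xi>. (h \<xi>)\<^sup>2)"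
  shows "(\<lambda>J. inner_energy h a (int J)) \<longlonglongrightarrow> (LINT \<xi>|lborel. (h \<xi>)\<^sup>2)"
    and "(\<lambda>J. inner_energy h a (- int J)) \<longlonglongrightarrow> 0"
proof -
  define t where "t j = 2 powr (real_of_int (j - 1) * a)" for j
  have t1: "filterlim (\<lambda>J. t (int J)) at_top sequentially"
  proof (rule filterlim_at_top_mono[OF _ eventually_mono[OF eventually_ge_at_top[of 1]]])
    show "filterlim (\<lambda>J. 1 / 2 * real J) at_top sequentially"
      by (intro filterlim_tendsto_pos_mult_at_top[OF tendsto_const] filterlim_real_sequentially) auto
    fix J :: nat assume "1 \<le> J"
    have "real J \<le> 2 ^ J" using less_exp[of J] by (metis less_imp_le of_nat_le_iff of_nat_numeral of_nat_power)
    then have "1 / 2 * real J \<le> 2 ^ J / 2" by simp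
    also have "\<dots> = 2 powr (real J - 1)" by (simp add: powr_diff powr_realpow)
    also have "\<dots> \<le> t (int J)"
      unfolding t_def using \<open>1 \<le> J\<close> assms(1) mult_left_mono[of 1 a "real J - 1"] by simp
    finally show "1 / 2 * real J \<le> t (int J)" .
  qed
  have t2: "(\<lambda>J. t (- int J)) \<longlonglongrightarrow> 0"
  proof (rule tendsto_sandwich[OF _ _ tendsto_const LIMSEQ_power_zero[of "1/2 :: real"]])
    show "\<forall>\<^sub>F J in sequentially. 0 \<le> t (- int J)" by (simp add: t_def)
    have "t (- int J) \<le> (1 / 2) ^ J" for J
    proof -
      have "t (- int J) \<le> 2 powr (- real J)"
        unfolding t_def using assms(1) mult_left_mono[of 1 a "real J + 1"] by (simp add: algebra_simps)
      also have "\<dots> = (1 / 2) ^ J" by (simp add: powr_minus powr_realpow power_one_over field_simps)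
      finally show ?thesis .
    qed
    then show "\<forall>\<^sub>F J in sequentially. t (- int J) \<le> (1 / 2) ^ J" by simp
  qed auto
  note bnd = inner_energy_bounds[OF assms(1) h, folded t_def]
  have up: "filterlim (\<lambda>J. c * t (int J)) at_top sequentially" if "c > 0" for c
    by (intro filterlim_tendsto_pos_mult_at_top[OF tendsto_const _ t1] that)
  have down: "(\<lambda>J. c * t (- int J)) \<longlonglongrightarrow> 0" for c
    using tendsto_mult[OF tendsto_const t2, of c] by simp
  show "(\<lambda>J. inner_energy h a (int J)) \<longlonglongrightarrow> (LINT \<xi>|lborel. (h \<xi>)\<^sup>2)"
    by (rule tendsto_sandwich[OF _ _ integral_tendsto_expanding[OF i up[of "1/2"]] integral_tendsto_expanding[OF i up[of 2]]])
       (use bnd in auto)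
  show "(\<lambda>J. inner_energy h a (- int J)) \<longlonglongrightarrow> 0"
    by (rule tendsto_sandwich[OF _ _ integral_tendsto_shrinking[OF i down[of "1/2"]] integral_tendsto_shrinking[OF i down[of 2]]])
       (use bnd in auto)
qed

end

section \<open>Closed subspaces of square-integrable functions\<close>

lemma L2_inner_integrable:
  assumes "f \<in> L2_fun M" "g \<in> L2_fun M"
  shows "integrable M (\<lambda>x. f x * cnj (g x))"
proof -
  have [measurable]: "f \<in> borel_measurable M" "g \<in> borel_measurable M"
    and i: "integrable M (\<lambda>x. (cmod (f x))\<^sup>2 + (cmod (g x))\<^sup>2)"
    using assms by (auto simp: L2_fun_def)
  have "(\<lambda>x. cnj (g x)) \<in> borel_measurable M"
    using borel_measurable_continuous_onI[OF continuous_on_cnj[OF continuous_on_id]] measurable_compose[of g M borel cnj borel] by simp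
  then have m: "(\<lambda>x. f x * cnj (g x)) \<in> borel_measurable M" by simp
  show ?thesis
  proof (rule Bochner_Integration.integrable_bound[OF i m], rule AE_I2)
    fix x
    have "cmod (f x) * cmod (g x) \<le> (cmod (f x))\<^sup>2 + (cmod (g x))\<^sup>2"
    proof -
      have "0 \<le> cmod (f x) * cmod (g x)" by simp
      then show ?thesis
        using sum_squares_bound[of "cmod (f x)" "cmod (g x)"] unfolding mult.assoc by linarith
    qed
    then show "cmod (f x * cnj (g x)) \<le> norm ((cmod (f x))\<^sup>2 + (cmod (g x))\<^sup>2)"
      by (simp add: norm_mult)
  qed
qed

lemma cmod_add_sq_le: "(cmod (x + y))\<^sup>2 \<le> 2 * (cmod x)\<^sup>2 + 2 * (cmod y)\<^sup>2"
proof -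
  have "(cmod (x + y))\<^sup>2 \<le> (cmod x + cmod y)\<^sup>2"
    by (intro power_mono norm_triangle_ineq) auto
  also have "\<dots> \<le> 2 * (cmod x)\<^sup>2 + 2 * (cmod y)\<^sup>2"
    using sum_squares_bound[of "cmod x" "cmod y"] by (simp add: power2_sum)
  finally show ?thesis .
qed

lemma L2_fun_add:
  assumes "f \<in> L2_fun M" "g \<in> L2_fun M"
  shows "(\<lambda>x. f x + g x) \<in> L2_fun M"
proof -
  have [measurable]: "f \<in> borel_measurable M" "g \<in> borel_measurable M"
    and i: "integrable M (\<lambda>x. 2 * (cmod (f x))\<^sup>2 + 2 * (cmod (g x))\<^sup>2)"
    using assms by (auto simp: L2_fun_def)
  have "integrable M (\<lambda>x. (cmod (f x + g x))\<^sup>2)"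
    by (rule Bochner_Integration.integrable_bound[OF i]) (auto simp: cmod_add_sq_le)
  then show ?thesis by (simp add: L2_fun_def)
qed

lemma L2_fun_scale: "f \<in> L2_fun M \<Longrightarrow> (\<lambda>x. c * f x) \<in> L2_fun M"
  by (auto simp: L2_fun_def norm_mult power_mult_distrib)

lemma L2_fun_zero: "(\<lambda>x. 0) \<in> L2_fun M"
  by (simp add: L2_fun_def)

lemma L2_fun_sum: "(\<And>p. p \<in> F \<Longrightarrow> w p \<in> L2_fun M) \<Longrightarrow> (\<lambda>x. \<Sum>p\<in>F. c p * w p x) \<in> L2_fun M"
  by (induction F rule: infinite_finite_induct) (simp_all add: L2_fun_zero L2_fun_add L2_fun_scale)

lemma L2_fun_diff:
  assumes "f \<in> L2_fun M" "g \<in> L2_fun M"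
  shows "(\<lambda>x. f x - g x) \<in> L2_fun M"
  using L2_fun_add[OF assms(1) L2_fun_scale[OF assms(2), of "-1"]] by simp

definition sq_norm :: "'a measure \<Rightarrow> ('a \<Rightarrow> complex) \<Rightarrow> real" where
  "sq_norm M f = (LINT x|M. (cmod (f x))\<^sup>2)"

lemma L2_norm_less_iff: "e > 0 \<Longrightarrow> L2_norm M f < e \<longleftrightarrow> sq_norm M f < e\<^sup>2"
  unfolding L2_norm_def sq_norm_def
  by (metis abs_of_pos real_sqrt_abs real_sqrt_less_iff)

text \<open>The triangle inequality for squares, with a factor of two: enough to show that the closure of a span is a
  closed subspace.\<close>

lemma sq_norm_add_le:
  assumes "f \<in> L2_fun M" "g \<in> L2_fun M"
  shows "sq_norm M (\<lambda>x. f x + g x) \<le> 2 * sq_norm M f + 2 * sq_norm M g"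
proof -
  have i: "integrable M (\<lambda>x. (cmod (f x))\<^sup>2)" "integrable M (\<lambda>x. (cmod (g x))\<^sup>2)" "integrable M (\<lambda>x. (cmod (f x + g x))\<^sup>2)"
    using assms L2_fun_add[OF assms] by (auto simp: L2_fun_def)
  have "sq_norm M (\<lambda>x. f x + g x) \<le> (LINT x|M. 2 * (cmod (f x))\<^sup>2 + 2 * (cmod (g x))\<^sup>2)"
    unfolding sq_norm_def using i by (intro integral_mono cmod_add_sq_le) auto
  also have "\<dots> = 2 * sq_norm M f + 2 * sq_norm M g"
    unfolding sq_norm_def using i by simp
  finally show ?thesis .
qed

lemma sq_norm_scale: "sq_norm M (\<lambda>x. c * f x) = (cmod c)\<^sup>2 * sq_norm M f"
  by (simp add: sq_norm_def norm_mult power_mult_distrib)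

lemma L2_inner_self: "L2_inner M f f = complex_of_real (sq_norm M f)"
  unfolding L2_inner_def sq_norm_def complex_norm_square[symmetric] by (simp del: of_real_power)

lemma L2_inner_cnj: "L2_inner M g f = cnj (L2_inner M f g)"
  unfolding L2_inner_def Bochner_Integration.integral_cnj[symmetric] by (simp add: mult.commute)

lemma L2_inner_sum_right:
  assumes "f \<in> L2_fun M" "\<And>p. p \<in> F \<Longrightarrow> w p \<in> L2_fun M"
  shows "L2_inner M f (\<lambda>x. \<Sum>p\<in>F. c p * w p x) = (\<Sum>p\<in>F. cnj (c p) * L2_inner M f (w p))"
proof -
  have "L2_inner M f (\<lambda>x. \<Sum>p\<in>F. c p * w p x) = (LINT x|M. (\<Sum>p\<in>F. cnj (c p) * (f x * cnj (w p x))))"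
    unfolding L2_inner_def by (simp add: sum_distrib_left mult_ac)
  also have "\<dots> = (\<Sum>p\<in>F. (LINT x|M. cnj (c p) * (f x * cnj (w p x))))"
    using assms by (intro Bochner_Integration.integral_sum integrable_mult_right L2_inner_integrable)
  finally show ?thesis by (simp add: L2_inner_def)
qed

lemma L2_inner_diff_right:
  assumes "f \<in> L2_fun M" "g \<in> L2_fun M" "h \<in> L2_fun M"
  shows "L2_inner M f (\<lambda>x. g x - h x) = L2_inner M f g - L2_inner M f h"
  using L2_inner_integrable[OF assms(1,2)] L2_inner_integrable[OF assms(1,3)]
  by (simp add: L2_inner_def right_diff_distrib)

text \<open>Bessel's identity: the error of the orthogonal expansion is the missing part of the energy.\<close>

lemma sq_norm_diff_projection:
  assumes f: "f \<in> L2_fun M" and w: "\<And>p. p \<in> F \<Longrightarrow> w p \<in> L2_fun M" and F: "finite F"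
    and on: "\<And>p q. p \<in> F \<Longrightarrow> q \<in> F \<Longrightarrow> L2_inner M (w p) (w q) = (if p = q then 1 else 0)"
  shows "sq_norm M (\<lambda>x. f x - (\<Sum>p\<in>F. L2_inner M f (w p) * w p x)) = sq_norm M f - (\<Sum>p\<in>F. (cmod (L2_inner M f (w p)))\<^sup>2)"
proof -
  define c where "c p = L2_inner M f (w p)" for p
  define s where "s x = (\<Sum>p\<in>F. c p * w p x)" for x
  define S where "S = (\<Sum>p\<in>F. (cmod (c p))\<^sup>2)"
  have s: "s \<in> L2_fun M"
    unfolding s_def[abs_def] by (rule L2_fun_sum) (rule w)
  have fs: "(\<lambda>x. f x - s x) \<in> L2_fun M" by (rule L2_fun_diff[OF f s])
  have 1: "L2_inner M f s = of_real S"
    unfolding s_def[abs_def] S_def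
    by (subst L2_inner_sum_right[OF f w]) (simp_all add: c_def complex_norm_square mult.commute del: of_real_power)
  have 2: "L2_inner M s s = of_real S"
  proof -
    have "L2_inner M (w p) s = cnj (c p)" if "p \<in> F" for p
      unfolding s_def[abs_def] using that F
      by (subst L2_inner_sum_right[OF w w]) (simp_all add: on if_distrib[of "\<lambda>x. _ * x"] cong: if_cong)
    then have "L2_inner M s (w p) = c p" if "p \<in> F" for p
      using that by (subst L2_inner_cnj) simp
    then have "L2_inner M s s = (\<Sum>p\<in>F. cnj (c p) * c p)"
      using s by (subst (2) s_def[abs_def], subst L2_inner_sum_right[OF _ w]) simp_all
    then show ?thesis by (simp add: S_def complex_norm_square mult.commute del: of_real_power)
  qed
  have "of_real (sq_norm M (\<lambda>x. f x - s x)) = L2_inner M (\<lambda>x. f x - s x) (\<lambda>x. f x - s x)"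
    by (simp add: L2_inner_self)
  also have "\<dots> = L2_inner M (\<lambda>x. f x - s x) f - L2_inner M (\<lambda>x. f x - s x) s"
    by (rule L2_inner_diff_right[OF fs f s])
  also have "\<dots> = cnj (L2_inner M f (\<lambda>x. f x - s x)) - cnj (L2_inner M s (\<lambda>x. f x - s x))"
    by (simp only: L2_inner_cnj[of M "\<lambda>x. f x - s x"])
  also have "\<dots> = cnj (of_real (sq_norm M f) - of_real S) - cnj (cnj (of_real S) - of_real S)"
    by (simp only: L2_inner_diff_right[OF f f s] L2_inner_diff_right[OF s f s] 1 2 L2_inner_cnj[of M s f] L2_inner_self[of M f])
  also have "\<dots> = of_real (sq_norm M f - S)" by simp
  finally show ?thesis
    unfolding of_real_eq_iff by (simp add: s_def S_def c_def)
qed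

locale L2_closed_subspace =
  fixes M :: "'a measure" and C :: "('a \<Rightarrow> complex) set"
  assumes L2: "C \<subseteq> L2_fun M"
    and zero: "(\<lambda>x. 0) \<in> C"
    and add: "f \<in> C \<Longrightarrow> g \<in> C \<Longrightarrow> (\<lambda>x. f x + g x) \<in> C"
    and scale: "f \<in> C \<Longrightarrow> (\<lambda>x. c * f x) \<in> C"
    and closed: "f \<in> L2_fun M \<Longrightarrow> (\<And>e. e > 0 \<Longrightarrow> \<exists>g\<in>C. sq_norm M (\<lambda>x. f x - g x) < e) \<Longrightarrow> f \<in> C"
begin

lemma sum: "(\<And>p. p \<in> F \<Longrightarrow> w p \<in> C) \<Longrightarrow> (\<lambda>x. \<Sum>p\<in>F. w p x) \<in> C"
  by (induction F rule: infinite_finite_induct) (simp_all add: zero add)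

lemma diff: "f \<in> C \<Longrightarrow> g \<in> C \<Longrightarrow> (\<lambda>x. f x - g x) \<in> C"
  using add[of f "\<lambda>x. - 1 * g x"] scale[of g "- 1"] by simp

text \<open>The form in which closedness is used below: pointwise approximations with a common square-integrable bound.\<close>

lemma dominated_limit:
  assumes s: "\<And>n. s n \<in> C" and f [measurable]: "f \<in> borel_measurable M"
    and lim: "AE x in M. (\<lambda>n. s n x) \<longlonglongrightarrow> f x"
    and w: "integrable M (\<lambda>x. (w x)\<^sup>2)" and b: "\<And>n x. cmod (s n x) \<le> w x"
  shows "f \<in> C"
proof (rule closed)
  have sm [measurable]: "s n \<in> borel_measurable M" for n
    using s L2 by (auto simp: L2_fun_def)
  have fb: "AE x in M. cmod (f x) \<le> w x"
    using lim
  proof eventually_elim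
    case (elim x)
    show ?case
      by (rule LIMSEQ_le_const2[OF tendsto_norm[OF elim]]) (use b in auto)
  qed
  have w0: "0 \<le> w x" for x using order_trans[OF norm_ge_zero b] .
  have "integrable M (\<lambda>x. (cmod (f x))\<^sup>2)"
  proof (rule Bochner_Integration.integrable_bound[OF w])
    show "AE x in M. norm ((cmod (f x))\<^sup>2) \<le> norm ((w x)\<^sup>2)"
      using fb by eventually_elim (auto intro: power_mono)
  qed measurable
  then show "f \<in> L2_fun M" using f by (simp add: L2_fun_def)
  fix e :: real assume "e > 0"
  have "(\<lambda>n. LINT x|M. (cmod (f x - s n x))\<^sup>2) \<longlonglongrightarrow> (LINT x|M. 0)"
  proof (rule integral_dominated_convergence[where w="\<lambda>x. 4 * (w x)\<^sup>2"])
    show "AE x in M. (\<lambda>n. (cmod (f x - s n x))\<^sup>2) \<longlonglongrightarrow> 0"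
      using lim
    proof eventually_elim
      case (elim x)
      have "(\<lambda>n. (cmod (f x - s n x))\<^sup>2) \<longlonglongrightarrow> (cmod (f x - f x))\<^sup>2"
        by (intro tendsto_power tendsto_norm tendsto_diff tendsto_const elim)
      then show ?case by simp
    qed
    show "AE x in M. norm ((cmod (f x - s n x))\<^sup>2) \<le> 4 * (w x)\<^sup>2" for n
      using fb
    proof eventually_elim
      case (elim x)
      have "cmod (f x - s n x) \<le> 2 * w x"
        using norm_triangle_ineq4[of "f x" "s n x"] elim b[of n x] by linarith
      then have "(cmod (f x - s n x))\<^sup>2 \<le> (2 * w x)\<^sup>2" by (rule power_mono) simp
      then show ?case by (simp add: power_mult_distrib)
    qed
  qed (use w in simp_all)
  then have "eventually (\<lambda>n. sq_norm M (\<lambda>x. f x - s n x) < e) sequentially"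
    unfolding sq_norm_def by (rule order_tendstoD(2)) (simp add: \<open>e > 0\<close>)
  then show "\<exists>g\<in>C. sq_norm M (\<lambda>x. f x - g x) < e"
    using s by (auto simp: eventually_sequentially)
qed

end

lemma lebesgue_indicator_L2:
  assumes "A \<in> lmeasurable"
  shows "integrable lebesgue (\<lambda>x. (indicator A x :: real)\<^sup>2)"
proof -
  have "(\<lambda>x. (indicator A x :: real)\<^sup>2) = indicator A" by (auto simp: indicator_def)
  then show ?thesis using assms by (auto intro: integrable_real_indicator simp: fmeasurable_def)
qed

text \<open>Boxes are stable under intersection, so a Dynkin argument inside a fixed box gives the indicators of
  all bounded Borel sets. Exhausting by boxes and discarding null sets gives all Lebesgue sets of finite measure, then
  simple functions, and these approximate every square-integrable function with a dominating bound.\<close>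

lemma L2_closed_subspace_boxes:
  fixes C :: "('a::euclidean_space \<Rightarrow> complex) set"
  assumes "L2_closed_subspace lebesgue C"
    and box: "\<And>l u. indicator (box l u) \<in> C"
  shows "L2_fun lebesgue \<subseteq> C"
proof -
  interpret L2_closed_subspace lebesgue C by fact
  \<comment> \<open>The intersection with a box keeps complements inside the space.\<close>
  have 1: "indicator (A \<inter> box l u) \<in> C" if "A \<in> sets borel" for A and l u :: 'a
  proof -
    have gen: "sets borel = sigma_sets UNIV (range (\<lambda>(a, b). box a b :: 'a set))"
      by (simp add: borel_eq_box)
    have "Int_stable (range (\<lambda>(a, b). box a b :: 'a set))"
      by (auto simp: Int_stable_def box_Int_box)
    moreover have "range (\<lambda>(a, b). box a b :: 'a set) \<subseteq> Pow UNIV"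
      by simp
    moreover have "A \<in> sigma_sets UNIV (range (\<lambda>(a, b). box a b :: 'a set))"
      using that by (simp only: gen)
    ultimately show ?thesis
    proof (induction rule: sigma_sets_induct_disjoint)
      case (basic A)
      then show ?case by (auto simp: box_Int_box box)
    next
      case empty
      have "indicator {} = (\<lambda>x::'a. 0::complex)" by (simp add: fun_eq_iff)
      then show ?case using zero by simp
    next
      case (compl A)
      have "indicator ((UNIV - A) \<inter> box l u) = (\<lambda>x. indicator (box l u) x - indicator (A \<inter> box l u) x :: complex)"
        by (auto simp: indicator_def)
      then show ?case using diff[OF box compl(2)] by simp
    next
      case (union A)
      have Am [measurable]: "A i \<in> sets borel" for i
        using union(2) gen by auto
      show ?case
      proof (rule dominated_limit)
        show "(\<lambda>x. \<Sum>i<n. indicator (A i \<inter> box l u) x) \<in> C" for n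
          by (rule sum) (rule union)
        show "integrable lebesgue (\<lambda>x. (indicator (box l u) x :: real)\<^sup>2)"
          by (rule lebesgue_indicator_L2) simp
        have disj: "disjoint_family (\<lambda>i. A i \<inter> box l u)"
          using union(1) by (auto simp: disjoint_family_on_def)
        have eq: "(\<Sum>i<n. indicator (A i \<inter> box l u) x :: complex) = indicator (\<Union>i<n. A i \<inter> box l u) x" for n x
          by (rule indicator_UN_disjoint[symmetric, OF finite_lessThan disjoint_family_on_mono[OF subset_UNIV disj]])
        show "cmod (\<Sum>i<n. indicator (A i \<inter> box l u) x) \<le> indicator (box l u) x" for n x
          unfolding eq by (auto simp: indicator_def)
        have "(\<lambda>n. indicator (\<Union>i<n. A i \<inter> box l u) x) \<longlonglongrightarrow> (indicator (\<Union>i. A i \<inter> box l u) x :: complex)" for x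
          by (rule LIMSEQ_indicator_UN)
        then show "AE x in lebesgue. (\<lambda>n. \<Sum>i<n. indicator (A i \<inter> box l u) x) \<longlonglongrightarrow> (indicator (\<Union> (range A) \<inter> box l u) x :: complex)"
          unfolding eq by (simp add: Int_UN_distrib2 UN_extend_simps(4)[symmetric] Int_commute)
        have "\<Union> (range A) \<inter> box l u \<in> sets lborel"
          by (simp add: sets.Int sets.countable_UN)
        then show "indicator (\<Union> (range A) \<inter> box l u) \<in> borel_measurable lebesgue"
          by (intro borel_measurable_indicator sets_completionI_sets)
      qed
    qed
  qed
  have 2: "indicator A \<in> C" if A: "A \<in> lmeasurable" for A
  proof -
    have "A \<in> sets lebesgue" using A by blast
    then obtain S N N' where S: "A = S \<union> N" "N \<subseteq> N'" "N' \<in> null_sets lborel" "S \<in> sets lborel"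
      by (rule sets_completionE)
    show ?thesis
    proof (rule dominated_limit)
      show "indicator (S \<inter> box (- (real n *\<^sub>R One)) (real n *\<^sub>R One)) \<in> C" for n
        by (rule 1) (use S in simp)
      show "integrable lebesgue (\<lambda>x. (indicator A x :: real)\<^sup>2)"
        by (rule lebesgue_indicator_L2[OF A])
      have "AE x in lebesgue. x \<notin> N'"
        using S(3) by (intro AE_completion AE_not_in)
      then show "AE x in lebesgue. (\<lambda>n. indicator (S \<inter> box (- (real n *\<^sub>R One)) (real n *\<^sub>R One)) x) \<longlonglongrightarrow> (indicator A x :: complex)"
      proof eventually_elim
        case (elim x)
        have "eventually (\<lambda>n. norm x < real n) sequentially"
          by (rule filterlim_at_top_dense[THEN iffD1, OF filterlim_real_sequentially, rule_format])
        then have "eventually (\<lambda>n. indicator (S \<inter> box (- (real n *\<^sub>R One)) (real n *\<^sub>R One)) x = (indicator A x :: complex)) sequentially"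
        proof eventually_elim
          case (elim n)
          have "x \<in> box (- (real n *\<^sub>R One)) (real n *\<^sub>R One)"
            unfolding mem_box
          proof
            fix i :: 'a assume "i \<in> Basis"
            then show "- (real n *\<^sub>R One) \<bullet> i < x \<bullet> i \<and> x \<bullet> i < real n *\<^sub>R One \<bullet> i"
              using Basis_le_norm[of i x] elim by auto
          qed
          then show ?case using S \<open>x \<notin> N'\<close> by (auto simp: indicator_def)
        qed
        then show ?case by (rule tendsto_eventually)
      qed
      show "cmod (indicator (S \<inter> box (- (real n *\<^sub>R One)) (real n *\<^sub>R One)) x) \<le> indicator A x" for n x
        using S by (auto simp: indicator_def)
    qed (use A in auto)
  qed
  show ?thesis
  proof
    fix f :: "'a \<Rightarrow> complex" assume f: "f \<in> L2_fun lebesgue"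
    then have fm [measurable]: "f \<in> borel_measurable lebesgue" and fi: "integrable lebesgue (\<lambda>x. (cmod (f x))\<^sup>2)"
      by (auto simp: L2_fun_def)
    from borel_measurable_implies_sequence_metric[OF fm, of 0]
    obtain s where s: "\<And>i. simple_function lebesgue (s i)" "\<And>x. (\<lambda>i. s i x) \<longlonglongrightarrow> f x" "\<And>i x. cmod (s i x) \<le> 2 * cmod (f x)"
      by (auto simp: dist_norm)
    show "f \<in> C"
    proof (rule dominated_limit[where s=s, OF _ fm])
      show "integrable lebesgue (\<lambda>x. (2 * cmod (f x))\<^sup>2)"
        using fi by (simp add: power_mult_distrib)
      show "s i \<in> C" for i
      proof -
        have fin: "finite (range (s i))" and m: "\<And>y. y \<in> range (s i) \<Longrightarrow> s i -` {y} \<in> sets lebesgue"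
          using s(1)[of i] by (auto simp: simple_function_def)
        have "s i = (\<lambda>x. \<Sum>y\<in>range (s i) - {0}. y * indicator (s i -` {y}) x)"
        proof
          fix x
          have "(\<Sum>y\<in>range (s i) - {0}. y * indicator (s i -` {y}) x) = (\<Sum>y\<in>range (s i) - {0}. if y = s i x then y else 0)"
            by (intro sum.cong) (auto simp: indicator_def)
          also have "\<dots> = s i x" using fin by simp
          finally show "s i x = (\<Sum>y\<in>range (s i) - {0}. y * indicator (s i -` {y}) x)" by simp
        qed
        also have "\<dots> \<in> C"
        proof (intro sum scale 2)
          fix y assume y: "y \<in> range (s i) - {0}"
          have "integrable lebesgue (indicator (s i -` {y}) :: 'a \<Rightarrow> real)"
          proof (rule Bochner_Integration.integrable_bound)
            show "integrable lebesgue (\<lambda>x. 4 / (cmod y)\<^sup>2 * (cmod (f x))\<^sup>2)"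
              using fi by (rule integrable_mult_right)
            have "(cmod y)\<^sup>2 \<le> 4 * (cmod (f x))\<^sup>2" if "s i x = y" for x
              using power_mono[OF s(3)[of i x], of 2] that by (simp add: power_mult_distrib)
            then show "AE x in lebesgue. norm (indicator (s i -` {y}) x :: real) \<le> norm (4 / (cmod y)\<^sup>2 * (cmod (f x))\<^sup>2)"
              using y by (intro AE_I2) (auto simp: indicator_def le_divide_eq)
          qed (use m y in auto)
          then show "s i -` {y} \<in> lmeasurable"
            using m y by (simp add: fmeasurable_def integrable_indicator_iff)
        qed
        finally show ?thesis .
      qed
    qed (use s in auto)
  qed
qed

definition span_closure :: "'a measure \<Rightarrow> 'i set \<Rightarrow> ('i \<Rightarrow> 'a \<Rightarrow> complex) \<Rightarrow> ('a \<Rightarrow> complex) set" where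
  "span_closure M P w = {f \<in> L2_fun M. \<forall>e>0. \<exists>F c. finite F \<and> F \<subseteq> P \<and> sq_norm M (\<lambda>x. f x - (\<Sum>p\<in>F. c p * w p x)) < e}"

lemma L2_closed_subspace_span_closure:
  assumes w: "\<And>p. p \<in> P \<Longrightarrow> w p \<in> L2_fun M"
  shows "L2_closed_subspace M (span_closure M P w)"
proof
  have near: "\<exists>F c. finite F \<and> F \<subseteq> P \<and> sq_norm M (\<lambda>x. f x - (\<Sum>p\<in>F. c p * w p x)) < e"
    if "f \<in> span_closure M P w" "e > 0" for f e
    using that by (auto simp: span_closure_def)
  have s: "(\<lambda>x. \<Sum>p\<in>F. c p * w p x) \<in> L2_fun M" if "F \<subseteq> P" for F c
    using that w by (intro L2_fun_sum) auto
  show sub: "span_closure M P w \<subseteq> L2_fun M" by (auto simp: span_closure_def)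
  show "(\<lambda>x. 0) \<in> span_closure M P w"
    unfolding span_closure_def
    by (auto simp: L2_fun_zero sq_norm_def intro!: exI[of _ "{}"])
  show "(\<lambda>x. f x + g x) \<in> span_closure M P w" if f: "f \<in> span_closure M P w" and g: "g \<in> span_closure M P w" for f g
    unfolding span_closure_def
  proof (intro CollectI conjI allI impI)
    show "(\<lambda>x. f x + g x) \<in> L2_fun M" using f g sub by (auto intro: L2_fun_add)
    fix e :: real assume "e > 0"
    then have e4: "e / 4 > 0" by simp
    obtain F c where F: "finite F" "F \<subseteq> P" "sq_norm M (\<lambda>x. f x - (\<Sum>p\<in>F. c p * w p x)) < e / 4"
      using near[OF f e4] by blast
    obtain G d where G: "finite G" "G \<subseteq> P" "sq_norm M (\<lambda>x. g x - (\<Sum>p\<in>G. d p * w p x)) < e / 4"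
      using near[OF g e4] by blast
    define b where "b p = (if p \<in> F then c p else 0) + (if p \<in> G then d p else 0)" for p
    have 1: "(\<Sum>p\<in>F. c p * w p x) = (\<Sum>p\<in>F \<union> G. (if p \<in> F then c p else 0) * w p x)" for x
      using F(1) G(1) by (intro sum.mono_neutral_cong_left) auto
    have 2: "(\<Sum>p\<in>G. d p * w p x) = (\<Sum>p\<in>F \<union> G. (if p \<in> G then d p else 0) * w p x)" for x
      using F(1) G(1) by (intro sum.mono_neutral_cong_left) auto
    have eq: "f x + g x - (\<Sum>p\<in>F \<union> G. b p * w p x) = (f x - (\<Sum>p\<in>F. c p * w p x)) + (g x - (\<Sum>p\<in>G. d p * w p x))" for x
      unfolding 1 2 b_def distrib_right sum.distrib by simp
    have "sq_norm M (\<lambda>x. f x + g x - (\<Sum>p\<in>F \<union> G. b p * w p x)) \<le>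
      2 * sq_norm M (\<lambda>x. f x - (\<Sum>p\<in>F. c p * w p x)) + 2 * sq_norm M (\<lambda>x. g x - (\<Sum>p\<in>G. d p * w p x))"
      unfolding eq using f g sub F G by (intro sq_norm_add_le L2_fun_diff s) auto
    also have "\<dots> < e" using F(3) G(3) by simp
    finally show "\<exists>F c. finite F \<and> F \<subseteq> P \<and> sq_norm M (\<lambda>x. f x + g x - (\<Sum>p\<in>F. c p * w p x)) < e"
      using F(1,2) G(1,2) by (intro exI[of _ "F \<union> G"] exI[of _ b]) simp
  qed
  show "(\<lambda>x. a * f x) \<in> span_closure M P w" if f: "f \<in> span_closure M P w" for f a
    unfolding span_closure_def
  proof (intro CollectI conjI allI impI)
    show "(\<lambda>x. a * f x) \<in> L2_fun M" using f sub by (auto intro: L2_fun_scale)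
    fix e :: real assume "e > 0"
    have pos: "(cmod a)\<^sup>2 + 1 > 0" by (simp add: add_nonneg_pos)
    then have "e / ((cmod a)\<^sup>2 + 1) > 0" using \<open>e > 0\<close> by simp
    from near[OF f this] obtain F c where F: "finite F" "F \<subseteq> P" "sq_norm M (\<lambda>x. f x - (\<Sum>p\<in>F. c p * w p x)) < e / ((cmod a)\<^sup>2 + 1)"
      by blast
    have eq: "a * f x - (\<Sum>p\<in>F. (a * c p) * w p x) = a * (f x - (\<Sum>p\<in>F. c p * w p x))" for x
      by (simp add: right_diff_distrib sum_distrib_left mult.assoc)
    have n0: "0 \<le> sq_norm M (\<lambda>x. f x - (\<Sum>p\<in>F. c p * w p x))"
      by (simp add: sq_norm_def)
    have "sq_norm M (\<lambda>x. a * f x - (\<Sum>p\<in>F. (a * c p) * w p x)) = (cmod a)\<^sup>2 * sq_norm M (\<lambda>x. f x - (\<Sum>p\<in>F. c p * w p x))"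
      unfolding eq by (rule sq_norm_scale)
    also have "\<dots> \<le> ((cmod a)\<^sup>2 + 1) * sq_norm M (\<lambda>x. f x - (\<Sum>p\<in>F. c p * w p x))"
      using n0 by (intro mult_right_mono) auto
    also have "\<dots> < e" using F(3) pos by (simp add: less_divide_eq mult.commute)
    finally show "\<exists>F c. finite F \<and> F \<subseteq> P \<and> sq_norm M (\<lambda>x. a * f x - (\<Sum>p\<in>F. c p * w p x)) < e"
      using F(1,2) by (intro exI[of _ F] exI[of _ "\<lambda>p. a * c p"]) simp
  qed
  show "f \<in> span_closure M P w" if f: "f \<in> L2_fun M"
    and app: "\<And>e. e > 0 \<Longrightarrow> \<exists>g\<in>span_closure M P w. sq_norm M (\<lambda>x. f x - g x) < e" for f
    unfolding span_closure_def
  proof (intro CollectI conjI allI impI f)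
    fix e :: real assume "e > 0"
    then have e4: "e / 4 > 0" by simp
    obtain g where g: "g \<in> span_closure M P w" "sq_norm M (\<lambda>x. f x - g x) < e / 4"
      using app[OF e4] by blast
    obtain F c where F: "finite F" "F \<subseteq> P" "sq_norm M (\<lambda>x. g x - (\<Sum>p\<in>F. c p * w p x)) < e / 4"
      using near[OF g(1) e4] by blast
    have eq: "f x - (\<Sum>p\<in>F. c p * w p x) = (f x - g x) + (g x - (\<Sum>p\<in>F. c p * w p x))" for x
      by simp
    have "sq_norm M (\<lambda>x. f x - (\<Sum>p\<in>F. c p * w p x)) \<le> 2 * sq_norm M (\<lambda>x. f x - g x) + 2 * sq_norm M (\<lambda>x. g x - (\<Sum>p\<in>F. c p * w p x))"
      by (subst eq, rule sq_norm_add_le) (use f g sub F in \<open>auto intro!: L2_fun_diff s\<close>)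
    also have "\<dots> < e" using F(3) g(2) by simp
    finally show "\<exists>F c. finite F \<and> F \<subseteq> P \<and> sq_norm M (\<lambda>x. f x - (\<Sum>p\<in>F. c p * w p x)) < e"
      using F(1,2) by blast
  qed
qed

lemma orthonormal_basis_L2I:
  assumes "\<And>p. p \<in> P \<Longrightarrow> w p \<in> L2_fun M"
    and "\<And>p q. p \<in> P \<Longrightarrow> q \<in> P \<Longrightarrow> L2_inner M (w p) (w q) = (if p = q then 1 else 0)"
    and "L2_fun M \<subseteq> span_closure M P w"
  shows "orthonormal_basis_L2 M P w"
  unfolding orthonormal_basis_L2_def
proof (intro conjI ballI allI impI assms(1,2))
  fix f and e :: real assume "f \<in> L2_fun M" "e > 0"
  then have "f \<in> span_closure M P w" "e\<^sup>2 > 0" using assms(3) by auto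
  then show "\<exists>F c. finite F \<and> F \<subseteq> P \<and> L2_norm M (\<lambda>x. f x - (\<Sum>p\<in>F. c p * w p x)) < e"
    unfolding L2_norm_less_iff[OF \<open>e > 0\<close>] span_closure_def by blast
qed

section \<open>Tensor products\<close>

lemma measurable_vec_lambda_PiM:
  "(\<lambda>f. \<chi> i. f i) \<in> (\<Pi>\<^sub>M i\<in>(UNIV::'d set). lborel) \<rightarrow>\<^sub>M (borel :: (real ^ 'd::finite) measure)"
proof (rule borel_measurable_euclidean_space[THEN iffD2], rule ballI)
  fix b :: "real ^ 'd" assume "b \<in> Basis"
  then obtain i where b: "b = axis i 1" by (auto simp: Basis_vec_def)
  have "(\<lambda>f. (\<chi> i. f i) \<bullet> b) = (\<lambda>f. f i)"
    by (simp add: b inner_axis)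
  then show "(\<lambda>f. (\<chi> i. f i) \<bullet> b) \<in> borel_measurable (\<Pi>\<^sub>M i\<in>(UNIV::'d set). lborel)"
    using measurable_component_singleton[of i UNIV "\<lambda>_. lborel :: real measure"] by simp
qed

text \<open>Lebesgue measure on a vector space is given through its orthonormal basis; indexing by
  coordinates instead makes the product integral formulas applicable.\<close>

lemma lborel_vec_eq_PiM:
  "(lborel :: (real ^ 'd::finite) measure) = distr (\<Pi>\<^sub>M i\<in>UNIV. lborel) borel (\<lambda>f. \<chi> i. f i)"
proof (rule lborel_eqI)
  interpret product_sigma_finite "\<lambda>_::'d. lborel :: real measure" by standard
  show "sets (distr (\<Pi>\<^sub>M i\<in>(UNIV::'d set). lborel) borel (\<lambda>f. \<chi> i. f i)) = sets borel" by simp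
  fix l u :: "real ^ 'd" assume le: "\<And>b. b \<in> Basis \<Longrightarrow> l \<bullet> b \<le> u \<bullet> b"
  have le': "l $ i \<le> u $ i" for i
    using le[of "axis i 1"] by (simp add: inner_axis)
  have pre: "(\<lambda>f. \<chi> i. f i) -` box l u \<inter> space (\<Pi>\<^sub>M i\<in>(UNIV::'d set). lborel) = (\<Pi>\<^sub>E i\<in>UNIV. {l $ i<..<u $ i})"
    by (auto simp: mem_box_cart space_PiM PiE_def Pi_def)
  have "emeasure (distr (\<Pi>\<^sub>M i\<in>(UNIV::'d set). lborel) borel (\<lambda>f. \<chi> i. f i)) (box l u) =
    emeasure (\<Pi>\<^sub>M i\<in>(UNIV::'d set). lborel) (\<Pi>\<^sub>E i\<in>UNIV. {l $ i<..<u $ i})"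
    by (subst emeasure_distr[OF measurable_vec_lambda_PiM]) (simp_all add: pre)
  also have "\<dots> = (\<Prod>i\<in>UNIV. emeasure lborel {l $ i<..<u $ i})"
    by (intro emeasure_PiM) auto
  also have "\<dots> = (\<Prod>i\<in>UNIV. ennreal (u $ i - l $ i))"
    using le' by simp
  also have "\<dots> = ennreal (\<Prod>i\<in>UNIV. u $ i - l $ i)"
    using le' by (intro prod_ennreal) auto
  also have "(\<Prod>i\<in>UNIV. u $ i - l $ i) = (\<Prod>b\<in>Basis. (u - l) \<bullet> b)"
  proof -
    have B: "(Basis :: (real ^ 'd) set) = (\<lambda>i. axis i 1) ` UNIV"
      by (auto simp: Basis_vec_def)
    show ?thesis
      unfolding B by (subst prod.reindex) (auto simp: inj_on_def axis_eq_axis inner_axis)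
  qed
  finally show "emeasure (distr (\<Pi>\<^sub>M i\<in>(UNIV::'d set). lborel) borel (\<lambda>f. \<chi> i. f i)) (box l u) = ennreal (\<Prod>b\<in>Basis. (u - l) \<bullet> b)" .
qed

lemma lborel_tensor:
  fixes f :: "'d::finite \<Rightarrow> real \<Rightarrow> 'b::{real_normed_field, banach, second_countable_topology}"
  assumes "\<And>i. integrable lborel (f i)"
  shows "integrable lborel (\<lambda>x::real ^ 'd. \<Prod>i\<in>UNIV. f i (x $ i))"
    and "(LINT x|(lborel :: (real ^ 'd) measure). (\<Prod>i\<in>UNIV. f i (x $ i))) = (\<Prod>i\<in>UNIV. (LINT t|lborel. f i t))"
proof -
  interpret product_sigma_finite "\<lambda>_::'d. lborel :: real measure" by standard
  note [measurable] = borel_measurable_integrable[OF assms]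
  have fm: "(\<lambda>x::real ^ 'd. \<Prod>i\<in>UNIV. f i (x $ i)) \<in> borel_measurable borel"
  proof (intro borel_measurable_prod)
    fix i :: 'd
    have [measurable]: "(\<lambda>x::real ^ 'd. x $ i) \<in> borel_measurable borel"
      by (intro borel_measurable_continuous_onI continuous_intros)
    show "(\<lambda>x::real ^ 'd. f i (x $ i)) \<in> borel_measurable borel" by measurable
  qed
  show "integrable lborel (\<lambda>x::real ^ 'd. \<Prod>i\<in>UNIV. f i (x $ i))"
    unfolding lborel_vec_eq_PiM integrable_distr_eq[OF measurable_vec_lambda_PiM fm]
    using product_integrable_prod[of UNIV f] assms by simp
  show "(LINT x|(lborel :: (real ^ 'd) measure). (\<Prod>i\<in>UNIV. f i (x $ i))) = (\<Prod>i\<in>UNIV. (LINT t|lborel. f i t))"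
    unfolding lborel_vec_eq_PiM integral_distr[OF measurable_vec_lambda_PiM fm]
    using product_integral_prod[of UNIV f] assms by simp
qed

lemma sum_vec_prod:
  fixes f :: "'d::finite \<Rightarrow> 'a \<Rightarrow> 'b::comm_semiring_1"
  assumes "\<And>i. finite (A i)"
  shows "(\<Sum>n\<in>{n :: 'a ^ 'd. \<forall>i. n $ i \<in> A i}. \<Prod>i\<in>UNIV. f i (n $ i)) = (\<Prod>i\<in>UNIV. \<Sum>m\<in>A i. f i m)"
proof -
  have "(\<Prod>i\<in>UNIV. \<Sum>m\<in>A i. f i m) = (\<Sum>g\<in>Pi\<^sub>E UNIV A. \<Prod>i\<in>UNIV. f i (g i))"
    using assms by (intro prod_sum_PiE) auto
  also have "\<dots> = (\<Sum>n\<in>{n :: 'a ^ 'd. \<forall>i. n $ i \<in> A i}. \<Prod>i\<in>UNIV. f i (n $ i))"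
    by (rule sum.reindex_bij_witness[where i="vec_nth" and j="vec_lambda"]) auto
  finally show ?thesis by simp
qed

lemma finite_vec_set:
  assumes "\<And>i. finite (A i)"
  shows "finite {n :: 'a ^ 'd::finite. \<forall>i. n $ i \<in> A i}"
proof (rule finite_imageD[where f=vec_nth])
  have "vec_nth ` {n :: 'a ^ 'd. \<forall>i. n $ i \<in> A i} \<subseteq> Pi\<^sub>E UNIV A" by auto
  moreover have "finite (Pi\<^sub>E (UNIV :: 'd set) A)" using assms by (intro finite_PiE) auto
  ultimately show "finite (vec_nth ` {n :: 'a ^ 'd. \<forall>i. n $ i \<in> A i})" by (rule finite_subset)
qed (auto simp: inj_on_def vec_nth_inject)

lemma prod_indicator: "(\<Prod>i\<in>UNIV. if P i then 1 else (0::'b::comm_semiring_1)) = (if \<forall>i::'d::finite. P i then 1 else 0)"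
proof (cases "\<forall>i. P i")
  case False
  then show ?thesis by (auto intro!: prod_zero)
qed simp

lemma sum_symmetric_telescope:
  fixes A :: "int \<Rightarrow> real"
  shows "(\<Sum>j\<in>{- int J..<int J}. A (j + 1) - A j) = A (int J) - A (- int J)"
proof (induction J)
  case (Suc J)
  have "{- int (Suc J)..<int (Suc J)} = insert (- int (Suc J)) (insert (int J) {- int J..<int J})"
    by auto
  then show ?case using Suc by (simp add: algebra_simps)
qed simp

lemma lebesgue_lborel_integral:
  fixes f :: "'a::euclidean_space \<Rightarrow> 'b::{banach, second_countable_topology}"
  assumes "f \<in> borel_measurable borel"
  shows "(LINT x|lebesgue. f x) = (LINT x|lborel. f x)" "integrable lebesgue f \<longleftrightarrow> integrable lborel f"
  using assms by (simp_all add: integral_completion integrable_completion)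

lemma L2_fun_lborelD: "f \<in> L2_fun lborel \<Longrightarrow> f \<in> L2_fun lebesgue"
  unfolding L2_fun_def
  by (auto simp: measurable_completion lebesgue_lborel_integral(2))

lemma tensor_borel:
  fixes f :: "'d::finite \<Rightarrow> real \<Rightarrow> complex"
  assumes "\<And>i. f i \<in> borel_measurable borel"
  shows "(\<lambda>x::real ^ 'd. \<Prod>i\<in>UNIV. f i (x $ i)) \<in> borel_measurable borel"
proof (intro borel_measurable_prod)
  fix i :: 'd
  have "(\<lambda>x::real ^ 'd. x $ i) \<in> borel_measurable borel"
    by (intro borel_measurable_continuous_onI continuous_intros)
  then show "(\<lambda>x::real ^ 'd. f i (x $ i)) \<in> borel_measurable borel"
    using assms by (rule measurable_compose)
qed

lemma tensor_L2:
  fixes f :: "'d::finite \<Rightarrow> real \<Rightarrow> complex"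
  assumes "\<And>i. f i \<in> L2_fun lborel"
  shows "(\<lambda>x::real ^ 'd. \<Prod>i\<in>UNIV. f i (x $ i)) \<in> L2_fun lebesgue"
    and "sq_norm lebesgue (\<lambda>x::real ^ 'd. \<Prod>i\<in>UNIV. f i (x $ i)) = (\<Prod>i\<in>UNIV. sq_norm lborel (f i))"
proof -
  have m: "f i \<in> borel_measurable borel" and i: "integrable lborel (\<lambda>t. (cmod (f i t))\<^sup>2)" for i
    using assms[of i] by (auto simp: L2_fun_def)
  have eq: "(cmod (\<Prod>i\<in>UNIV. f i (x $ i)))\<^sup>2 = (\<Prod>i\<in>UNIV. (cmod (f i (x $ i)))\<^sup>2)" for x :: "real ^ 'd"
    by (simp add: prod_norm[symmetric] prod_power_distrib)
  show L: "(\<lambda>x::real ^ 'd. \<Prod>i\<in>UNIV. f i (x $ i)) \<in> L2_fun lebesgue"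
    by (rule L2_fun_lborelD) (use lborel_tensor(1)[of "\<lambda>i t. (cmod (f i t))\<^sup>2", OF i] tensor_borel[of f, OF m] in \<open>simp add: L2_fun_def eq\<close>)
  show "sq_norm lebesgue (\<lambda>x::real ^ 'd. \<Prod>i\<in>UNIV. f i (x $ i)) = (\<Prod>i\<in>UNIV. sq_norm lborel (f i))"
    unfolding sq_norm_def
    by (subst lebesgue_lborel_integral)
       (use lborel_tensor(2)[of "\<lambda>i t. (cmod (f i t))\<^sup>2", OF i] tensor_borel[of f, OF m] in \<open>simp_all add: eq[symmetric]\<close>)
qed

lemma tensor_inner:
  fixes f g :: "'d::finite \<Rightarrow> real \<Rightarrow> complex"
  assumes "\<And>i. f i \<in> L2_fun lborel" "\<And>i. g i \<in> L2_fun lborel"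
  shows "L2_inner lebesgue (\<lambda>x::real ^ 'd. \<Prod>i\<in>UNIV. f i (x $ i)) (\<lambda>x. \<Prod>i\<in>UNIV. g i (x $ i)) =
    (\<Prod>i\<in>UNIV. L2_inner lborel (f i) (g i))"
proof -
  have i: "integrable lborel (\<lambda>t. f i t * cnj (g i t))" for i
    by (rule L2_inner_integrable[OF assms])
  have m: "(\<lambda>t. f i t * cnj (g i t)) \<in> borel_measurable borel" for i
    using borel_measurable_integrable[OF i] by simp
  show ?thesis
    unfolding L2_inner_def cnj_prod prod.distrib[symmetric]
    using tensor_borel[of "\<lambda>i t. f i t * cnj (g i t)", OF m] lborel_tensor(2)[of "\<lambda>i t. f i t * cnj (g i t)", OF i]
    by (simp add: lebesgue_lborel_integral)
qed

section \<open>The tensor brushlet basis\<close>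

context brushlet_cutoff
begin

lemma admissible_brushlet:
  assumes "admissible I"
  shows "C2c (brushlet_hat \<rho> n I)" "brushlet \<rho> n I = inv_fourier (brushlet_hat \<rho> n I)"
    "brushlet \<rho> n I \<in> L2_fun lborel"
proof -
  obtain \<alpha> \<beta> \<epsilon> \<epsilon>' where I: "I = (\<alpha>, \<beta>, \<epsilon>, \<epsilon>')" by (cases I)
  have \<epsilon>: "\<epsilon> > 0" "\<epsilon>' > 0" using assms by (auto simp: I admissible_def)
  show g: "C2c (brushlet_hat \<rho> n I)" unfolding I by (rule C2c_brushlet_hat[OF \<epsilon>])
  show eq: "brushlet \<rho> n I = inv_fourier (brushlet_hat \<rho> n I)" unfolding I by (rule brushlet_eq[OF \<epsilon>])
  show "brushlet \<rho> n I \<in> L2_fun lborel"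
    unfolding eq L2_fun_def using inv_fourier_integrable(2)[OF g] inv_fourier_borel[OF g] by simp
qed

lemma brushlet_inner:
  assumes "admissible I" "admissible J"
  shows "L2_inner lborel (brushlet \<rho> n I) (brushlet \<rho> m J) =
    complex_of_real (LINT \<xi>|lborel. brushlet_hat \<rho> n I \<xi> * brushlet_hat \<rho> m J \<xi>)"
  unfolding L2_inner_def admissible_brushlet(2)[OF assms(1)] admissible_brushlet(2)[OF assms(2)]
  by (intro inv_fourier_plancherel admissible_brushlet assms)

definition brushlet_coef :: "(real \<Rightarrow> real) \<Rightarrow> cutoff_interval \<Rightarrow> nat \<Rightarrow> complex" where
  "brushlet_coef \<phi> I n = L2_inner lborel (\<lambda>x. complex_of_real (\<phi> x)) (brushlet \<rho> n I)"

text \<open>The Fourier transform of the real function $\<phi>$, written as a reflected inverse transform.\<close>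

definition spectrum :: "(real \<Rightarrow> real) \<Rightarrow> real \<Rightarrow> complex" where
  "spectrum \<phi> \<xi> = inv_fourier \<phi> (- \<xi>)"

lemma spectrum_continuous:
  assumes "C2c \<phi>"
  shows "continuous_on S (spectrum \<phi>)" "continuous_on S (\<lambda>\<xi>. Re (spectrum \<phi> \<xi>))" "continuous_on S (\<lambda>\<xi>. Im (spectrum \<phi> \<xi>))"
proof -
  show 1: "continuous_on S (spectrum \<phi>)"
    unfolding spectrum_def
    by (intro continuous_on_compose2[OF inv_fourier_continuous[OF assms, of UNIV]] continuous_intros) auto
  show "continuous_on S (\<lambda>\<xi>. Re (spectrum \<phi> \<xi>))" "continuous_on S (\<lambda>\<xi>. Im (spectrum \<phi> \<xi>))"
    by (intro continuous_on_Re continuous_on_Im 1)+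
qed

lemma spectrum_square_integrable:
  assumes "C2c \<phi>"
  shows "integrable lborel (\<lambda>\<xi>. (Re (spectrum \<phi> \<xi>))\<^sup>2)" "integrable lborel (\<lambda>\<xi>. (Im (spectrum \<phi> \<xi>))\<^sup>2)"
    and "(LINT \<xi>|lborel. (Re (spectrum \<phi> \<xi>))\<^sup>2) + (LINT \<xi>|lborel. (Im (spectrum \<phi> \<xi>))\<^sup>2) = (LINT x|lborel. (\<phi> x)\<^sup>2)"
proof -
  have i: "integrable lborel (\<lambda>\<xi>. (cmod (spectrum \<phi> \<xi>))\<^sup>2)"
    using lborel_integrable_real_affine[OF inv_fourier_integrable(2)[OF assms], of "-1" 0]
    by (simp add: spectrum_def)
  have [measurable]: "spectrum \<phi> \<in> borel_measurable borel"
    by (intro borel_measurable_continuous_onI spectrum_continuous assms)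
  show 1: "integrable lborel (\<lambda>\<xi>. (Re (spectrum \<phi> \<xi>))\<^sup>2)"
    by (rule Bochner_Integration.integrable_bound[OF i]) (auto simp: cmod_power2)
  show 2: "integrable lborel (\<lambda>\<xi>. (Im (spectrum \<phi> \<xi>))\<^sup>2)"
    by (rule Bochner_Integration.integrable_bound[OF i]) (auto simp: cmod_power2)
  have "(LINT \<xi>|lborel. (Re (spectrum \<phi> \<xi>))\<^sup>2) + (LINT \<xi>|lborel. (Im (spectrum \<phi> \<xi>))\<^sup>2) = (LINT \<xi>|lborel. (cmod (spectrum \<phi> \<xi>))\<^sup>2)"
    using 1 2 by (simp add: cmod_power2)
  also have "\<dots> = (LINT x|lborel. (cmod (inv_fourier \<phi> x))\<^sup>2)"
    using lborel_integral_real_affine[of "-1" "\<lambda>x. (cmod (inv_fourier \<phi> x))\<^sup>2" 0] by (simp add: spectrum_def)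
  also have "complex_of_real \<dots> = (LINT x|lborel. inv_fourier \<phi> x * cnj (inv_fourier \<phi> x))"
    unfolding complex_norm_square[symmetric] by (simp del: of_real_power)
  also have "\<dots> = of_real (LINT x|lborel. (\<phi> x)\<^sup>2)"
    by (subst inv_fourier_plancherel[OF assms assms]) (simp add: power2_eq_square)
  finally show "(LINT \<xi>|lborel. (Re (spectrum \<phi> \<xi>))\<^sup>2) + (LINT \<xi>|lborel. (Im (spectrum \<phi> \<xi>))\<^sup>2) = (LINT x|lborel. (\<phi> x)\<^sup>2)"
    by (simp only: of_real_eq_iff)
qed

text \<open>Splitting into real and imaginary parts reduces to the real-valued expansions, since the bell-cosines are real.\<close>

lemma brushlet_coef_norm:
  assumes \<phi>: "C2c \<phi>" and I: "admissible I"
  shows "(cmod (brushlet_coef \<phi> I n))\<^sup>2 = (LINT \<xi>|lborel. Re (spectrum \<phi> \<xi>) * brushlet_hat \<rho> n I \<xi>)\<^sup>2 +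
    (LINT \<xi>|lborel. Im (spectrum \<phi> \<xi>) * brushlet_hat \<rho> n I \<xi>)\<^sup>2"
proof -
  define g where "g = brushlet_hat \<rho> n I"
  have g: "C2c g" unfolding g_def by (rule admissible_brushlet[OF I])
  obtain R where R: "\<And>x. R \<le> \<bar>x\<bar> \<Longrightarrow> g x = 0" using g by (auto simp: C2c_def)
  have i: "integrable lborel (\<lambda>\<xi>. spectrum \<phi> \<xi> * of_real (g \<xi>))"
    by (rule integrable_compact_support[of _ R])
       (auto intro!: continuous_on_mult continuous_on_of_real spectrum_continuous \<phi> C2c_continuous g simp: R)
  have c: "brushlet_coef \<phi> I n = (LINT \<xi>|lborel. spectrum \<phi> \<xi> * of_real (g \<xi>))"
    unfolding brushlet_coef_def L2_inner_def admissible_brushlet(2)[OF I] spectrum_def g_def[symmetric]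
    by (rule inner_inv_fourier[OF \<phi> g])
  show ?thesis
    unfolding c cmod_power2 integral_Re[OF i, symmetric] integral_Im[OF i, symmetric] by (simp add: g_def)
qed

definition spectral_energy :: "(real \<Rightarrow> real) \<Rightarrow> cutoff_interval \<Rightarrow> real" where
  "spectral_energy \<phi> I = energy (\<lambda>\<xi>. Re (spectrum \<phi> \<xi>)) I + energy (\<lambda>\<xi>. Im (spectrum \<phi> \<xi>)) I"

lemma brushlet_coef_sums:
  assumes "C2c \<phi>" "admissible I"
  shows "(\<lambda>n. (cmod (brushlet_coef \<phi> I n))\<^sup>2) sums spectral_energy \<phi> I"
  unfolding brushlet_coef_norm[OF assms] spectral_energy_def
  by (intro sums_add energy_sums spectrum_continuous assms)

definition core_energy :: "(real \<Rightarrow> real) \<Rightarrow> real \<Rightarrow> int \<Rightarrow> real" where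
  "core_energy \<phi> a j = (\<Sum>k\<in>{1, -1}. spectral_energy \<phi> (level_interval a j k))"

lemma core_energy_inner: "core_energy \<phi> a j = inner_energy (\<lambda>\<xi>. Re (spectrum \<phi> \<xi>)) a j + inner_energy (\<lambda>\<xi>. Im (spectrum \<phi> \<xi>)) a j"
  by (simp add: core_energy_def inner_energy_def spectral_energy_def)

lemma core_energy_Suc:
  assumes "C2c \<phi>" "a \<ge> 1"
  shows "(\<Sum>k\<in>{1, -1, 2, -2}. spectral_energy \<phi> (level_interval a j k)) = core_energy \<phi> a (j + 1)"
  unfolding core_energy_inner spectral_energy_def sum.distrib
  using inner_energy_Suc[OF assms(2) spectrum_continuous(2)[OF assms(1)], of j]
    inner_energy_Suc[OF assms(2) spectrum_continuous(3)[OF assms(1)], of j] by simp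

lemma core_energy_limits:
  assumes "C2c \<phi>" "a \<ge> 1"
  shows "(\<lambda>J. core_energy \<phi> a (int J)) \<longlonglongrightarrow> (LINT x|lborel. (\<phi> x)\<^sup>2)"
    and "(\<lambda>J. core_energy \<phi> a (- int J)) \<longlonglongrightarrow> 0"
proof -
  note R = inner_energy_limits[OF assms(2) spectrum_continuous(2)[OF assms(1)] spectrum_square_integrable(1)[OF assms(1)]]
  note I = inner_energy_limits[OF assms(2) spectrum_continuous(3)[OF assms(1)] spectrum_square_integrable(2)[OF assms(1)]]
  show "(\<lambda>J. core_energy \<phi> a (int J)) \<longlonglongrightarrow> (LINT x|lborel. (\<phi> x)\<^sup>2)"
    unfolding core_energy_inner spectrum_square_integrable(3)[OF assms(1), symmetric] by (intro tendsto_add R I)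
  show "(\<lambda>J. core_energy \<phi> a (- int J)) \<longlonglongrightarrow> 0"
    unfolding core_energy_inner using tendsto_add[OF R(2) I(2)] by simp
qed

lemma corona_labelsD: "k \<in> corona_labels \<Longrightarrow> k $ i \<in> {1, - 1, 2, - 2}"
  by (auto simp: corona_labels_def)

lemma tensor_brushlet_L2:
  fixes a :: "real ^ 'd::finite"
  assumes a: "\<And>i. a $ i \<ge> 1" and k: "k \<in> corona_labels"
  shows "tensor_brushlet \<rho> a n j k \<in> L2_fun lebesgue"
  unfolding tensor_brushlet_def[abs_def]
  by (intro tensor_L2 admissible_brushlet level_admissible a corona_labelsD k)

text \<open>Within a level each axis contributes an orthonormal system. Across levels one axis suffices: the higher
  corona label has an entry $\<plusminus>2$, and that axis already gives zero.\<close>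

lemma tensor_brushlet_orthonormal:
  fixes a :: "real ^ 'd::finite"
  assumes a: "\<And>i. a $ i \<ge> 1" and k: "k \<in> corona_labels" "k' \<in> corona_labels"
  shows "L2_inner lebesgue (tensor_brushlet \<rho> a n j k) (tensor_brushlet \<rho> a n' j' k') =
    (if (n, j, k) = (n', j', k') then 1 else 0)"
proof -
  have adm: "admissible (level_interval (a $ i) j (k $ i))" if "k \<in> corona_labels" for i j k
    using that a corona_labelsD level_admissible by blast
  define q where "q n j k n' j' k' i = (LINT \<xi>|lborel. brushlet_hat \<rho> (n $ i) (level_interval (a $ i) j (k $ i)) \<xi> *
      brushlet_hat \<rho> (n' $ i) (level_interval (a $ i) j' (k' $ i)) \<xi>)" for n n' :: "nat ^ 'd" and j j' and k k' :: "int ^ 'd" and i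
  have inner: "L2_inner lebesgue (tensor_brushlet \<rho> a n j k) (tensor_brushlet \<rho> a n' j' k') = (\<Prod>i\<in>UNIV. complex_of_real (q n j k n' j' k' i))"
    unfolding tensor_brushlet_def[abs_def] q_def
    by (subst tensor_inner) (auto intro!: admissible_brushlet adm k prod.cong brushlet_inner)
  have cross: "\<exists>i. q n j k n' j' k' i = 0" if j: "j < j'" and k: "k \<in> corona_labels" and k': "k' \<in> corona_labels" for n j k n' j' k'
  proof -
    obtain i where i: "k' $ i \<in> {2, -2}"
      using k' by (auto simp: corona_labels_def)
    have "q n j k n' j' k' i = 0"
      unfolding q_def by (rule cross_level_orthogonal[OF a corona_labelsD[OF k] i j])
    then show ?thesis by blast
  qed
  consider "j = j'" | "j < j'" | "j' < j" by linarith
  then show ?thesis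
  proof cases
    case 1
    have "complex_of_real (q n j k n' j' k' i) = (if n $ i = n' $ i \<and> k $ i = k' $ i then 1 else 0)" for i
      unfolding q_def 1 using level_orthonormal[OF a corona_labelsD[OF k(1)] corona_labelsD[OF k(2)]] by simp
    then show ?thesis
      unfolding inner by (simp add: prod_indicator 1 vec_eq_iff)
  next
    case 2
    then show ?thesis
      unfolding inner using cross[OF 2 k] by (auto intro!: prod_zero)
  next
    case 3
    obtain i where "q n' j' k' n j k i = 0" using cross[OF 3 k(2,1)] by blast
    then have "q n j k n' j' k' i = 0" by (simp add: q_def mult.commute)
    then show ?thesis
      unfolding inner using 3 by (auto intro!: prod_zero)
  qed
qed

lemma C2c_L2:
  assumes "C2c \<phi>"
  shows "(\<lambda>x. complex_of_real (\<phi> x)) \<in> L2_fun lborel"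
proof -
  note [measurable] = C2c_borel[OF assms]
  obtain R where R: "\<And>x. R \<le> \<bar>x\<bar> \<Longrightarrow> \<phi> x = 0" using assms by (auto simp: C2c_def)
  have "integrable lborel (\<lambda>x. (\<phi> x)\<^sup>2)"
    by (rule integrable_compact_support[of _ R]) (auto intro!: continuous_on_power[OF C2c_continuous[OF assms]] simp: R)
  then show ?thesis by (simp add: L2_fun_def)
qed

text \<open>The corona is the difference of two product sets of labels, and over each of them the sum of products factors.\<close>

lemma corona_sum:
  fixes e :: "'d::finite \<Rightarrow> int \<Rightarrow> real"
  shows "(\<Sum>k\<in>corona_labels. \<Prod>i\<in>UNIV. e i (k $ i)) = (\<Prod>i\<in>UNIV. \<Sum>k\<in>{1, - 1, 2, - 2}. e i k) - (\<Prod>i\<in>UNIV. \<Sum>k\<in>{1, - 1}. e i k)"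
proof -
  have "(\<Sum>k\<in>corona_labels. \<Prod>i\<in>UNIV. e i (k $ i)) =
    (\<Sum>k\<in>{k. \<forall>i. k $ i \<in> {1, - 1, 2, - 2}}. \<Prod>i\<in>UNIV. e i (k $ i)) - (\<Sum>k\<in>{k. \<forall>i. k $ i \<in> {1, - 1}}. \<Prod>i\<in>UNIV. e i (k $ i))"
    unfolding corona_labels_def
  proof (rule sum_diff)
    show "finite {k :: int ^ 'd. \<forall>i. k $ i \<in> {1, - 1, 2, - 2}}" by (rule finite_vec_set) simp
  qed auto
  then show ?thesis
    by (simp only: sum_vec_prod[of "\<lambda>_::'d. {1, - 1, 2, - 2}" e] sum_vec_prod[of "\<lambda>_::'d. {1, - 1}" e] finite.intros)
qed

lemma finite_corona: "finite (corona_labels :: (int ^ 'd::finite) set)"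
  unfolding corona_labels_def by (intro finite_Diff finite_vec_set) auto

text \<open>For each level and label the sum of squared coefficients over $n_i<N$ factors over the axes. Summed over the corona
  and $-J\<le>j<J$ it tends, as $N\<rightarrow>\<infinity>$, to a telescoping sum over \<open>j\<close>, and as $J\<rightarrow>\<infinity>$ this tends to the square norm. So some finite partial
  expansion misses less than any given energy.\<close>

lemma tensor_parseval:
  fixes a :: "real ^ 'd::finite" and \<phi> :: "'d \<Rightarrow> real \<Rightarrow> real"
  assumes a: "\<And>i. a $ i \<ge> 1" and \<phi>: "\<And>i. C2c (\<phi> i)"
  shows "(\<lambda>x. \<Prod>i\<in>UNIV. complex_of_real (\<phi> i (x $ i))) \<in>
    span_closure lebesgue (UNIV \<times> UNIV \<times> corona_labels) (\<lambda>(n, j, k). tensor_brushlet \<rho> a n j k)"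
proof -
  define w where "w = (\<lambda>(n, j, k). tensor_brushlet \<rho> a n j k)"
  define f where "f x = (\<Prod>i\<in>UNIV. complex_of_real (\<phi> i (x $ i)))" for x :: "real ^ 'd"
  have f: "f \<in> L2_fun lebesgue"
    unfolding f_def[abs_def] by (intro tensor_L2 C2c_L2 \<phi>)
  have adm: "admissible (level_interval (a $ i) j (k $ i))" if "k \<in> corona_labels" for i j k
    using that a corona_labelsD level_admissible by blast
  have brushlet_coef: "L2_inner lebesgue f (w (n, j, k)) = (\<Prod>i\<in>UNIV. brushlet_coef (\<phi> i) (level_interval (a $ i) j (k $ i)) (n $ i))"
    if "k \<in> corona_labels" for n j k
    unfolding f_def[abs_def] w_def tensor_brushlet_def[abs_def] prod.case brushlet_coef_def
    by (intro tensor_inner C2c_L2 \<phi> admissible_brushlet adm that)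
  define E where "E = (\<Prod>i\<in>UNIV. LINT t|lborel. (\<phi> i t)\<^sup>2)"
  have normf: "sq_norm lebesgue f = E"
    unfolding f_def[abs_def] E_def by (subst tensor_L2(2)) (auto intro: C2c_L2 \<phi> simp: sq_norm_def)
  define A where "A j = (\<Prod>i\<in>UNIV. core_energy (\<phi> i) (a $ i) j)" for j
  define F where "F N J = {n :: nat ^ 'd. \<forall>i. n $ i \<in> {..<N}} \<times> {- int J..<int J} \<times> (corona_labels :: (int ^ 'd) set)" for N J
  have finF: "finite (F N J)" for N J
    unfolding F_def by (intro finite_cartesian_product finite_vec_set finite_corona) auto
  define T where "T N J = (\<Sum>p\<in>F N J. (cmod (L2_inner lebesgue f (w p)))\<^sup>2)" for N J
  have T: "T N J = (\<Sum>j\<in>{- int J..<int J}. \<Sum>k\<in>corona_labels. \<Prod>i\<in>UNIV. \<Sum>m<N. (cmod (brushlet_coef (\<phi> i) (level_interval (a $ i) j (k $ i)) m))\<^sup>2)" for N J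
  proof -
    have "T N J = (\<Sum>j\<in>{- int J..<int J}. \<Sum>k\<in>corona_labels. \<Sum>n\<in>{n :: nat ^ 'd. \<forall>i. n $ i \<in> {..<N}}. (cmod (L2_inner lebesgue f (w (n, j, k))))\<^sup>2)"
      unfolding T_def F_def by (simp only: sum.cartesian_product' sum.swap[of _ _ "{n :: nat ^ 'd. \<forall>i. n $ i \<in> {..<N}}"])
    also have "\<dots> = (\<Sum>j\<in>{- int J..<int J}. \<Sum>k\<in>corona_labels. \<Sum>n\<in>{n :: nat ^ 'd. \<forall>i. n $ i \<in> {..<N}}.
      \<Prod>i\<in>UNIV. (cmod (brushlet_coef (\<phi> i) (level_interval (a $ i) j (k $ i)) (n $ i)))\<^sup>2)"
      by (intro sum.cong refl) (simp add: brushlet_coef prod_norm[symmetric] prod_power_distrib)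
    finally show ?thesis by (subst (asm) sum_vec_prod) auto
  qed
  have Tlim: "(\<lambda>N. T N J) \<longlonglongrightarrow> A (int J) - A (- int J)" for J
  proof -
    have "(\<lambda>N. T N J) \<longlonglongrightarrow> (\<Sum>j\<in>{- int J..<int J}. \<Sum>k\<in>corona_labels. \<Prod>i\<in>UNIV. spectral_energy (\<phi> i) (level_interval (a $ i) j (k $ i)))"
      unfolding T
      by (intro tendsto_sum tendsto_prod brushlet_coef_sums[unfolded sums_def] \<phi> adm)
    also have "(\<Sum>j\<in>{- int J..<int J}. \<Sum>k\<in>corona_labels. \<Prod>i\<in>UNIV. spectral_energy (\<phi> i) (level_interval (a $ i) j (k $ i))) =
       (\<Sum>j\<in>{- int J..<int J}. A (j + 1) - A j)"
      by (subst corona_sum) (simp only: core_energy_Suc[OF \<phi> a] A_def core_energy_def[symmetric])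
    also have "\<dots> = A (int J) - A (- int J)"
      by (rule sum_symmetric_telescope)
    finally show ?thesis .
  qed
  \<comment> \<open>The product of zeros is zero as there is at least one axis.\<close>
  have "(\<lambda>J. A (int J) - A (- int J)) \<longlonglongrightarrow> E - (\<Prod>i\<in>(UNIV :: 'd set). 0)"
    unfolding A_def E_def by (intro tendsto_diff tendsto_prod core_energy_limits \<phi> a)
  then have Alim: "(\<lambda>J. A (int J) - A (- int J)) \<longlonglongrightarrow> E" by (simp add: power_0_left)
  have "\<exists>F c. finite F \<and> F \<subseteq> UNIV \<times> UNIV \<times> corona_labels \<and> sq_norm lebesgue (\<lambda>x. f x - (\<Sum>p\<in>F. c p * w p x)) < e" if "e > 0" for e
  proof -
    have "eventually (\<lambda>J. E - e < A (int J) - A (- int J)) sequentially"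
      by (rule order_tendstoD(1)[OF Alim]) (use that in simp)
    then obtain J where J: "E - e < A (int J) - A (- int J)"
      by (auto simp: eventually_sequentially)
    have "eventually (\<lambda>N. E - e < T N J) sequentially"
      by (rule order_tendstoD(1)[OF Tlim J])
    then obtain N where N: "E - e < T N J"
      by (auto simp: eventually_sequentially)
    have "sq_norm lebesgue (\<lambda>x. f x - (\<Sum>p\<in>F N J. L2_inner lebesgue f (w p) * w p x)) = sq_norm lebesgue f - T N J"
      unfolding T_def
    proof (rule sq_norm_diff_projection[OF f _ finF])
      show "w p \<in> L2_fun lebesgue" if "p \<in> F N J" for p
        using that a by (auto simp: F_def w_def intro: tensor_brushlet_L2)
      show "L2_inner lebesgue (w p) (w q) = (if p = q then 1 else 0)" if "p \<in> F N J" "q \<in> F N J" for p q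
        using that a by (cases p; cases q) (simp add: F_def w_def tensor_brushlet_orthonormal)
    qed
    also have "\<dots> < e" using N by (simp add: normf)
    finally show ?thesis
      using finF[of N J] by (intro exI[of _ "F N J"] exI[of _ "\<lambda>p. L2_inner lebesgue f (w p)"]) (auto simp: F_def)
  qed
  then show ?thesis
    using f by (simp add: span_closure_def f_def[abs_def] w_def)
qed

lemma tensor_brushlet_basis:
  fixes a :: "real ^ 'd::finite"
  assumes a: "\<And>i. a $ i \<ge> 1"
  shows "orthonormal_basis_L2 lebesgue (UNIV \<times> UNIV \<times> corona_labels) (\<lambda>(n, j, k). tensor_brushlet \<rho> a n j k)"
proof (rule orthonormal_basis_L2I)
  let ?P = "(UNIV :: (nat ^ 'd) set) \<times> (UNIV :: int set) \<times> (corona_labels :: (int ^ 'd) set)"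
  let ?w = "\<lambda>(n, j, k). tensor_brushlet \<rho> a n j k"
  show w: "?w p \<in> L2_fun lebesgue" if "p \<in> ?P" for p
    using that a by (auto intro: tensor_brushlet_L2)
  show "L2_inner lebesgue (?w p) (?w q) = (if p = q then 1 else 0)" if "p \<in> ?P" "q \<in> ?P" for p q
    using that a by (cases p; cases q) (simp add: tensor_brushlet_orthonormal)
  have cl: "L2_closed_subspace lebesgue (span_closure lebesgue ?P ?w)"
    by (rule L2_closed_subspace_span_closure) (rule w)
  show "L2_fun lebesgue \<subseteq> span_closure lebesgue ?P ?w"
  proof (rule L2_closed_subspace_boxes[OF cl])
    fix l u :: "real ^ 'd"
    show "indicator (box l u) \<in> span_closure lebesgue ?P ?w"
    proof (rule L2_closed_subspace.dominated_limit[OF cl])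
      show "(\<lambda>x. \<Prod>i\<in>UNIV. complex_of_real (bump m (l $ i) (u $ i) (x $ i))) \<in> span_closure lebesgue ?P ?w" for m
        by (rule tensor_parseval) (auto intro: a C2c_bump)
      have ind: "(indicator (box l u) x :: 'b::comm_semiring_1) = (\<Prod>i\<in>UNIV. indicator {l $ i<..<u $ i} (x $ i))" for x
        by (simp add: indicator_def of_bool_def prod_indicator mem_box_cart)
      have "(\<lambda>m. \<Prod>i\<in>UNIV. complex_of_real (bump m (l $ i) (u $ i) (x $ i))) \<longlonglongrightarrow> (\<Prod>i\<in>UNIV. complex_of_real (indicator {l $ i<..<u $ i} (x $ i)))" for x
        by (intro tendsto_prod tendsto_of_real bump_tendsto)
      then show "AE x in lebesgue. (\<lambda>m. \<Prod>i\<in>UNIV. complex_of_real (bump m (l $ i) (u $ i) (x $ i))) \<longlonglongrightarrow> indicator (box l u) x"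
        by (simp add: ind of_real_indicator)
      show "cmod (\<Prod>i\<in>UNIV. complex_of_real (bump m (l $ i) (u $ i) (x $ i))) \<le> indicator (box l u) x" for m x
        unfolding prod_norm[symmetric] ind using bump_bounds by (intro prod_mono) simp
      show "integrable lebesgue (\<lambda>x. (indicator (box l u) x :: real)\<^sup>2)"
        by (rule lebesgue_indicator_L2) simp
      show "indicator (box l u) \<in> borel_measurable lebesgue"
        by (intro borel_measurable_indicator) simp
    qed
  qed
qed

end

theorem proposition5p1:
  fixes \<rho> :: "real \<Rightarrow> real" and a :: "real ^ 'd::finite"
  assumes "smooth \<rho>"
    and "\<And>\<xi>. \<rho> \<xi> \<ge> 0"
    and "\<And>\<xi>. \<xi> \<le> - 1 \<Longrightarrow> \<rho> \<xi> = 0"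
    and "\<And>\<xi>. \<xi> \<ge> 1 \<Longrightarrow> \<rho> \<xi> = 1"
    and "\<And>\<xi>. (\<rho> \<xi>)\<^sup>2 + (\<rho> (- \<xi>))\<^sup>2 = 1"
    and "\<And>i. a $ i \<ge> 1"
  shows "orthonormal_basis_L2 (lebesgue :: (real ^ 'd) measure)
           ((UNIV :: (nat ^ 'd) set) \<times> (UNIV :: int set) \<times> (corona_labels :: (int ^ 'd) set))
           (\<lambda>(n, j, k). tensor_brushlet \<rho> a n j k)"
proof -
  interpret brushlet_cutoff \<rho> by standard (use assms in auto)
  show ?thesis by (rule tensor_brushlet_basis) (rule assms)
qed

end
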